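(* Let $X$ be an asymptotic $\ell_1$ space not containing (a subspace isomorphic to) $\ell_1$. Then $I_\Delta(X)=\omega^\alpha$ for some $\alpha<\omega_1$. If $I_\Delta(X)=\alpha_0$ and $\ddot\delta_{\alpha_0}(X)=\theta$, then $\ddot\delta_{\alpha_0\cdot n+\beta}(X)=\theta^n$ for all $n\in\mathbb N$ and all $\beta<\alpha_0$. Finally, $\ddot\delta_\beta(X)=0$ for all $\beta$ with $\alpha_0\cdot\omega\le\beta<\omega_1$.
   Context: Spaces are separable infinite-dimensional Banach spaces; ordinal arithmetic is the usual one. For a basic sequence $(x_i)$, $(y_i)\prec(x_i)$ means that $(y_i)$ is a (finite or infinite) block basis of $(x_i)$; supports of vectors are taken w.r.t. $(x_i)$, and $x<y$ means $\max\operatorname{supp}x<\min\operatorname{supp}y$. A space $X$ with a basis $(e_i)$ is asymptotic $\ell_1$ (w.r.t. $(e_i)$) if there is $C$ such that for all $n$ and all finitely supported $e_n\le x_1<\dots<x_n$ (i.e. $n\le\min\operatorname{supp}x_1$), $\|\sum_1^nx_i\|\ge(1/C)\sum_1^n\|x_i\|$. For finite $F,G\subseteq\mathbb N$, $F<G$ means $\max F<\min G$ (or one is empty); $F\ge n$ means $\min F\ge n$. Schreier classes: for sets $\mathcal F,\mathcal G$ of finite subsets of $\mathbb N$, $\mathcal F[\mathcal G]=\{\bigcup_1^nG_i: n\in\mathbb N, G_1<\dots<G_n, G_i\in\mathcal G, (\min G_i)_1^n\in\mathcal F\}$. $\mathcal S_0=\{\{n\}:n\in\mathbb N\}\cup\{\emptyset\}$,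 $\mathcal S_1=\{F:\min F\ge|F|\}\cup\{\emptyset\}$, $\mathcal S_{\alpha+1}=\mathcal S_1[\mathcal S_\alpha]$, and for a limit ordinal $\alpha<\omega_1$ one fixes $\alpha_n\uparrow\alpha$ and sets $\mathcal S_\alpha=\{F:\text{for some }n,\ F\in\mathcal S_{\alpha_n}\text{ and }F\ge n\}$. A finite block sequence $(y_i)_1^k\prec(x_i)$ is $\alpha$-admissible w.r.t. $(x_i)$ if $(\min\operatorname{supp}(y_i))_{i=1}^k\in\mathcal S_\alpha$. $\delta_\alpha((x_i),|\cdot|)$ is the supremum of $\delta\ge0$ such that $|\sum_1^ky_i|\ge\delta\sum_1^k|y_i|$ for all $(y_i)_1^k\prec(x_i)$ $\alpha$-admissible w.r.t. $(x_i)$. For $X$ with basis $(e_i)$, $\dot\delta_\alpha((e_i),|\cdot|)=\sup\{\delta_\alpha((x_i),|\cdot|):(x_i)\prec(e_i)\}$ and $\ddot\delta_\alpha(X)=\sup\{\dot\delta_\alpha((e_i),|\cdot|):|\cdot|\text{ an equivalent norm on }X\}$. The spectral index is $I_\Delta(X)=\inf\{\alpha<\omega_1:\ddot\delta_\alpha(X)<1\}$. *)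

theory Defs
  imports "HOL-Analysis.Analysis"
begin

section \<open>Countable ordinals\<close>

text \<open>The type \<open>cord\<close> is the first uncountable ordinal: the library's cardinal successor of
  the cardinal of the naturals.  Its elements are the ordinals below the first uncountable one.\<close>

typedef cord = "Field (cardSuc natLeq)"
proof -
  have "infinite (Field (cardSuc natLeq))"
    using cardSuc_finite[OF natLeq_Card_order] by (simp add: Field_natLeq)
  then show ?thesis
    by (metis equals0I finite.emptyI)
qed

instantiation cord :: wellorder
begin

definition less_eq_cord :: "cord \<Rightarrow> cord \<Rightarrow> bool"
  where "less_eq_cord a b \<longleftrightarrow> (Rep_cord a, Rep_cord b) \<in> cardSuc natLeq"

definition less_cord :: "cord \<Rightarrow> cord \<Rightarrow> bool"
  where "less_cord a b \<longleftrightarrow> a \<le> b \<and> a \<noteq> b"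

instance
proof -
  have wo: "Well_order (cardSuc natLeq)"
    by (rule cardSuc_Well_order[OF natLeq_Card_order])
  then have lin: "Linear_order (cardSuc natLeq)" and wf: "wf (cardSuc natLeq - Id)"
    by (auto simp: well_order_on_def)
  have refl: "a \<le> a" for a :: cord
    using lin Rep_cord[of a] unfolding less_eq_cord_def
    by (auto simp: linear_order_on_def partial_order_on_def preorder_on_def refl_on_def)
  have trans: "a \<le> b \<Longrightarrow> b \<le> c \<Longrightarrow> a \<le> c" for a b c :: cord
    using lin unfolding less_eq_cord_def
    by (auto simp: linear_order_on_def partial_order_on_def preorder_on_def elim: transE)
  have antisym: "a \<le> b \<Longrightarrow> b \<le> a \<Longrightarrow> a = b" for a b :: cord
    using lin unfolding less_eq_cord_def
    by (auto simp: linear_order_on_def partial_order_on_def antisym_def simp flip: Rep_cord_inject)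
  have total: "a \<le> b \<or> b \<le> a" for a b :: cord
  proof (cases "a = b")
    case False
    then show ?thesis
      using lin Rep_cord[of a] Rep_cord[of b] unfolding less_eq_cord_def
      by (auto simp: linear_order_on_def total_on_def Rep_cord_inject)
  qed (use refl in auto)
  have wf': "wf {(a, b :: cord). a < b}"
  proof -
    have "{(a, b :: cord). a < b} \<subseteq> inv_image (cardSuc natLeq - Id) Rep_cord"
      by (auto simp: less_cord_def less_eq_cord_def Rep_cord_inject)
    then show ?thesis
      using wf wf_inv_image wf_subset by blast
  qed
  show "OFCLASS(cord, wellorder_class)"
  proof
    fix P :: "cord \<Rightarrow> bool" and a
    assume step: "\<And>x. (\<And>y. y < x \<Longrightarrow> P y) \<Longrightarrow> P x"
    show "P a"
      by (induction a rule: wf_induct_rule[OF wf']) (auto intro: step)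
  qed (use refl trans antisym total in \<open>auto simp: less_cord_def\<close>)
qed

end

lemma countable_initial_segment:
  includes cardinal_syntax
  shows "countable {..<a :: cord}"
proof -
  let ?r = "cardSuc natLeq"
  have co: "Card_order ?r"
    by (rule cardSuc_Card_order[OF natLeq_Card_order])
  have "|Order_Relation.underS ?r (Rep_cord a)| <o ?r"
    using card_of_underS[OF co] Rep_cord[of a] by auto
  then have "|Order_Relation.underS ?r (Rep_cord a)| \<le>o natLeq"
    using cardSuc_ordLeq_ordLess[OF natLeq_Card_order card_of_Card_order] by blast
  then have "|Order_Relation.underS ?r (Rep_cord a)| \<le>o |UNIV :: nat set|"
    using card_of_nat ordIso_symmetric ordLeq_ordIso_trans by blast
  then have "countable (Order_Relation.underS ?r (Rep_cord a))"
    unfolding countable_def card_of_ordLeq[symmetric] by auto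
  moreover have "Rep_cord ` {..<a} \<subseteq> Order_Relation.underS ?r (Rep_cord a)"
    by (auto simp: underS_def less_cord_def less_eq_cord_def Rep_cord_inject)
  ultimately have "countable (Rep_cord ` {..<a})"
    by (rule countable_subset[rotated])
  then show ?thesis
    by (simp add: countable_image_inj_eq inj_on_def Rep_cord_inject)
qed

lemma uncountable_cord:
  includes cardinal_syntax
  shows "uncountable (UNIV :: cord set)"
proof
  assume "countable (UNIV :: cord set)"
  then have "countable (Rep_cord ` UNIV)"
    by (rule countable_image)
  then have "countable (Field (cardSuc natLeq))"
    using type_definition.Rep_range[OF type_definition_cord] by simp
  then have "|Field (cardSuc natLeq)| \<le>o |UNIV :: nat set|"
    unfolding countable_def card_of_ordLeq[symmetric] by auto
  then have "|Field (cardSuc natLeq)| \<le>o natLeq"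
    using card_of_nat ordLeq_ordIso_trans by blast
  moreover have "natLeq <o |Field (cardSuc natLeq)|"
    using cardSuc_greater[OF natLeq_Card_order] 
      card_of_Field_ordIso[OF cardSuc_Card_order[OF natLeq_Card_order]]
    by (metis ordIso_symmetric ordLess_ordIso_trans)
  ultimately show False
    using not_ordLess_ordLeq by blast
qed

lemma countable_bounded:
  fixes A :: "cord set"
  assumes "countable A"
  shows "\<exists>b. \<forall>a\<in>A. a < b"
proof (rule ccontr)
  assume "\<not> ?thesis"
  then have "UNIV = (\<Union>a\<in>A. {..<a} \<union> {a})"
    by (auto simp: not_less) (metis order_le_less)
  moreover have "countable (\<Union>a\<in>A. {..<a} \<union> {a})"
    using assms countable_initial_segment by auto
  ultimately show False
    using uncountable_cord by simp
qed

instantiation cord :: zero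
begin
definition zero_cord :: cord where "zero_cord = (LEAST a. True)"
instance ..
end

definition osucc :: "cord \<Rightarrow> cord"
  where "osucc a = (LEAST b. a < b)"

definition is_limit :: "cord \<Rightarrow> bool"
  where "is_limit a \<longleftrightarrow> a \<noteq> 0 \<and> (\<forall>b. a \<noteq> osucc b)"

definition opred :: "cord \<Rightarrow> cord"
  where "opred a = (THE b. a = osucc b)"

definition osup :: "cord set \<Rightarrow> cord"
  where "osup A = (LEAST b. \<forall>a\<in>A. a \<le> b)"

lemma zero_le_cord [simp]: "0 \<le> (a :: cord)"
  unfolding zero_cord_def by (rule Least_le) simp

lemma osucc_greater: "a < osucc a"
  unfolding osucc_def using countable_bounded[of "{a}"] by (auto intro: LeastI)

lemma osucc_le_iff: "osucc a \<le> b \<longleftrightarrow> a < b"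
  using osucc_greater[of a] by (auto simp: osucc_def intro: Least_le)

lemma osucc_inject [simp]: "osucc a = osucc b \<longleftrightarrow> a = b"
  by (metis leD linorder_neqE osucc_greater osucc_le_iff)

lemma osucc_nonzero [simp]: "osucc a \<noteq> 0"
  using osucc_greater[of a] zero_le_cord[of a] by (metis leD)

lemma opred_osucc [simp]: "opred (osucc a) = a"
  unfolding opred_def by auto

lemma not_limit_osucc [simp]: "\<not> is_limit (osucc a)"
  unfolding is_limit_def by auto

lemma opred_less: "a \<noteq> 0 \<Longrightarrow> \<not> is_limit a \<Longrightarrow> opred a < a"
  unfolding is_limit_def using osucc_greater by auto

lemma osup_upper:
  assumes "countable A" "a \<in> A"
  shows "a \<le> osup A"
proof -
  obtain b where "\<forall>a\<in>A. a \<le> b"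
    using countable_bounded[OF assms(1)] less_imp_le by blast
  then have "\<forall>a\<in>A. a \<le> osup A"
    unfolding osup_def by (rule LeastI)
  with assms(2) show ?thesis by blast
qed

lemma osup_least: "(\<And>a. a \<in> A \<Longrightarrow> a \<le> b) \<Longrightarrow> osup A \<le> b"
  unfolding osup_def by (rule Least_le) blast

text \<open>Continuous transfinite iteration of \<open>s\<close> starting from \<open>z\<close>.\<close>

function ord_iter :: "cord \<Rightarrow> (cord \<Rightarrow> cord) \<Rightarrow> cord \<Rightarrow> cord" where
  "ord_iter z s b =
    (if b = 0 then z
     else if is_limit b then osup ((\<lambda>c. ord_iter z s c) ` {..<b})
     else s (ord_iter z s (opred b)))"
  by pat_completeness auto
termination
  by (relation "inv_image {(b, b'). b < b'} (\<lambda>(z, s, b). b)") (auto simp: opred_less wf)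

declare ord_iter.simps [simp del]

instantiation cord :: "{one, plus, times}"
begin
definition one_cord :: cord where "one_cord = osucc 0"
definition plus_cord :: "cord \<Rightarrow> cord \<Rightarrow> cord" where "plus_cord a b = ord_iter a osucc b"
definition times_cord :: "cord \<Rightarrow> cord \<Rightarrow> cord" where "times_cord a b = ord_iter 0 (\<lambda>c. c + a) b"
instance ..
end

definition ord_of_nat :: "nat \<Rightarrow> cord"
  where "ord_of_nat n = (osucc ^^ n) 0"

definition omega :: cord
  where "omega = osup (range ord_of_nat)"

definition omega_pow :: "cord \<Rightarrow> cord"
  where "omega_pow a = ord_iter 1 (\<lambda>c. c * omega) a"

lemma cord_add_rec:
  "a + 0 = (a :: cord)"
  "a + osucc b = osucc (a + b)"
  "is_limit c \<Longrightarrow> a + c = osup ((\<lambda>b. a + b) ` {..<c})"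
  by (subst plus_cord_def, subst ord_iter.simps, simp add: plus_cord_def is_limit_def)+

lemma cord_mult_rec:
  "a * 0 = (0 :: cord)"
  "a * osucc b = a * b + a"
  "is_limit c \<Longrightarrow> a * c = osup ((\<lambda>b. a * b) ` {..<c})"
  by (subst times_cord_def, subst ord_iter.simps, simp add: times_cord_def is_limit_def)+

lemma omega_pow_rec:
  "omega_pow 0 = 1"
  "omega_pow (osucc b) = omega_pow b * omega"
  "is_limit c \<Longrightarrow> omega_pow c = osup (omega_pow ` {..<c})"
  by (subst omega_pow_def, subst ord_iter.simps, simp add: omega_pow_def [abs_def] is_limit_def)+


section \<open>Schreier classes\<close>

text \<open>The natural numbers of the mathematics are 1, 2, 3, \<dots>\<close>

definition set_less :: "nat set \<Rightarrow> nat set \<Rightarrow> bool"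
  where "set_less F G \<longleftrightarrow> F = {} \<or> G = {} \<or> Max F < Min G"

text \<open>The sets \<open>G i\<close> have to be nonempty for \<open>Min (G i)\<close> to make sense.\<close>

definition schreier_conv :: "nat set set \<Rightarrow> nat set set \<Rightarrow> nat set set"
  where "schreier_conv \<F> \<G> =
    {\<Union>i<n. G i | (n :: nat) G. (\<forall>i<n. G i \<in> \<G> \<and> G i \<noteq> {}) \<and>
       (\<forall>i j :: nat. i < j \<and> j < n \<longrightarrow> set_less (G i) (G j)) \<and>
       (\<lambda>i. Min (G i)) ` {..<n} \<in> \<F>}"

definition schreier0 :: "nat set set"
  where "schreier0 = {{n} | n. n \<ge> 1} \<union> {{}}"

definition schreier1 :: "nat set set"
  where "schreier1 = {F. finite F \<and> F \<noteq> {} \<and> card F \<le> Min F} \<union> {{}}"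

text \<open>A choice, for each limit ordinal \<open>a\<close>, of a sequence \<open>(l a n)\<close>, \<open>n \<ge> 1\<close>, increasing
  to \<open>a\<close>.\<close>

definition ladder_system :: "(cord \<Rightarrow> nat \<Rightarrow> cord) \<Rightarrow> bool"
  where "ladder_system l \<longleftrightarrow>
    (\<forall>a. is_limit a \<longrightarrow> strict_mono_on {1..} (l a) \<and> (\<forall>n\<ge>1. l a n < a) \<and>
       osup (l a ` {1..}) = a)"

text \<open>The guard \<open>l a n < a\<close> only serves termination; it holds whenever \<open>ladder_system l\<close>.\<close>

context
  notes conj_cong [fundef_cong]
begin

function schreier :: "(cord \<Rightarrow> nat \<Rightarrow> cord) \<Rightarrow> cord \<Rightarrow> nat set set" where
  "schreier l a =
    (if a = 0 then schreier0
     else if a = 1 then schreier1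
     else if is_limit a then
       {F. \<exists>n\<ge>1. l a n < a \<and> F \<in> schreier l (l a n) \<and> (\<forall>m\<in>F. n \<le> m)}
     else schreier_conv schreier1 (schreier l (opred a)))"
  by pat_completeness auto
termination
  by (relation "inv_image {(a, a'). a < a'} snd") (auto simp: opred_less wf)

end

declare schreier.simps [simp del]

lemma schreier_rec:
  "schreier l 0 = schreier0"
  "schreier l 1 = schreier1"
  "a \<noteq> 0 \<Longrightarrow> schreier l (osucc a) = schreier_conv schreier1 (schreier l a)"
  "ladder_system l \<Longrightarrow> is_limit a \<Longrightarrow>
     schreier l a = {F. \<exists>n\<ge>1. F \<in> schreier l (l a n) \<and> (\<forall>m\<in>F. n \<le> m)}"
proof -
  show "schreier l 0 = schreier0" "schreier l 1 = schreier1"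
    by (subst schreier.simps, simp add: one_cord_def)+
  show "a \<noteq> 0 \<Longrightarrow> schreier l (osucc a) = schreier_conv schreier1 (schreier l a)"
    by (subst schreier.simps) (simp add: one_cord_def)
  assume "ladder_system l" "is_limit a"
  moreover from this have "a \<noteq> 0" "a \<noteq> 1"
    by (auto simp: is_limit_def one_cord_def)
  ultimately show "schreier l a = {F. \<exists>n\<ge>1. F \<in> schreier l (l a n) \<and> (\<forall>m\<in>F. n \<le> m)}"
    by (subst schreier.simps) (auto simp: ladder_system_def)
qed


section \<open>Bases, block bases and supports\<close>

text \<open>A sequence \<open>x :: nat \<Rightarrow> 'a\<close> stands for \<open>(x\<^sub>i)\<close>, \<open>i = 1, 2, \<dots>\<close>, with \<open>x\<^sub>i = x (i - 1)\<close>;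
  hence the \<open>Suc\<close> in the definition of the support.\<close>

definition schauder_basis :: "(nat \<Rightarrow> 'a::real_normed_vector) \<Rightarrow> bool"
  where "schauder_basis e \<longleftrightarrow> (\<forall>x. \<exists>!c :: nat \<Rightarrow> real. (\<lambda>i. c i *\<^sub>R e i) sums x)"

definition supp :: "(nat \<Rightarrow> 'a::real_vector) \<Rightarrow> 'a \<Rightarrow> nat set"
  where "supp x y = {Suc i | i. representation (range x) y (x i) \<noteq> 0}"

text \<open>\<open>(y i)\<close>, \<open>i \<in> I\<close>, is a block basis of \<open>x\<close>; here \<open>I = {..<k}\<close> or \<open>I = UNIV\<close>.\<close>

definition block_basis :: "nat set \<Rightarrow> (nat \<Rightarrow> 'a::real_vector) \<Rightarrow> (nat \<Rightarrow> 'a) \<Rightarrow> bool"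
  where "block_basis I x y \<longleftrightarrow>
    (\<forall>i\<in>I. y i \<in> span (range x) \<and> y i \<noteq> 0) \<and>
    (\<forall>i\<in>I. \<forall>j\<in>I. i < j \<longrightarrow> set_less (supp x (y i)) (supp x (y j)))"

definition asymptotic_l1 :: "(nat \<Rightarrow> 'a::real_normed_vector) \<Rightarrow> bool"
  where "asymptotic_l1 e \<longleftrightarrow>
    (\<exists>C>0. \<forall>n\<ge>1. \<forall>x. block_basis {..<n} e x \<and> n \<le> Min (supp e (x 0)) \<longrightarrow>
       norm (\<Sum>i<n. x i) \<ge> (1 / C) * (\<Sum>i<n. norm (x i)))"

definition l1 :: "(nat \<Rightarrow> real) set"
  where "l1 = {a. summable (\<lambda>i. \<bar>a i\<bar>)}"

definition l1_norm :: "(nat \<Rightarrow> real) \<Rightarrow> real"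
  where "l1_norm a = (\<Sum>i. \<bar>a i\<bar>)"

definition contains_l1 :: "'a::real_normed_vector itself \<Rightarrow> bool"
  where "contains_l1 _ \<longleftrightarrow>
    (\<exists>T :: (nat \<Rightarrow> real) \<Rightarrow> 'a.
       (\<forall>a\<in>l1. \<forall>b\<in>l1. T (\<lambda>i. a i + b i) = T a + T b) \<and>
       (\<forall>r. \<forall>a\<in>l1. T (\<lambda>i. r * a i) = r *\<^sub>R T a) \<and>
       (\<exists>c>0. \<exists>C>0. \<forall>a\<in>l1. c * l1_norm a \<le> norm (T a) \<and> norm (T a) \<le> C * l1_norm a))"

definition equivalent_norm :: "('a::real_normed_vector \<Rightarrow> real) \<Rightarrow> bool"
  where "equivalent_norm N \<longleftrightarrow>
    (\<forall>x y. N (x + y) \<le> N x + N y) \<and> (\<forall>r x. N (r *\<^sub>R x) = \<bar>r\<bar> * N x) \<and>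
    (\<exists>c>0. \<exists>C>0. \<forall>x. c * norm x \<le> N x \<and> N x \<le> C * norm x)"


section \<open>The moduli and the spectral index\<close>

context
  fixes l :: "cord \<Rightarrow> nat \<Rightarrow> cord"
begin

definition admissible ::
  "cord \<Rightarrow> (nat \<Rightarrow> 'a::real_vector) \<Rightarrow> nat \<Rightarrow> (nat \<Rightarrow> 'a) \<Rightarrow> bool"
  where "admissible a x k y \<longleftrightarrow>
    block_basis {..<k} x y \<and> (\<lambda>i. Min (supp x (y i))) ` {..<k} \<in> schreier l a"

definition delta :: "cord \<Rightarrow> (nat \<Rightarrow> 'a::real_vector) \<Rightarrow> ('a \<Rightarrow> real) \<Rightarrow> real"
  where "delta a x N =
    Sup {d. d \<ge> 0 \<and> (\<forall>k y. admissible a x k y \<longrightarrow> N (\<Sum>i<k. y i) \<ge> d * (\<Sum>i<k. N (y i)))}"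

text \<open>The block bases \<open>x\<close> are infinite: for a single vector \<open>delta\<close> would be 1.\<close>

definition delta_dot :: "cord \<Rightarrow> (nat \<Rightarrow> 'a::real_vector) \<Rightarrow> ('a \<Rightarrow> real) \<Rightarrow> real"
  where "delta_dot a e N = Sup {delta a x N | x. block_basis UNIV e x}"

definition delta_ddot :: "cord \<Rightarrow> (nat \<Rightarrow> 'a::real_normed_vector) \<Rightarrow> real"
  where "delta_ddot a e = Sup {delta_dot a e N | N. equivalent_norm N}"

text \<open>\<open>None\<close> is the first uncountable ordinal, the infimum of the empty set.\<close>

definition spectral_index :: "(nat \<Rightarrow> 'a::real_normed_vector) \<Rightarrow> cord option"
  where "spectral_index e =
    (if \<exists>a. delta_ddot a e < 1 then Some (LEAST a. delta_ddot a e < 1) else None)"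

end

end

(* An estimate for admissible blocks of a block basis passes to subsequences, so only the Schreier classes up to
   spreading along a subsequence matter, and there S_(b + a) agrees with the convolution S_a[S_b].  Writing f(a) for
   the supremum of the moduli over norms and block bases, f decreases and f(a k) >= f(a)^k by iterating the estimate.
   Conversely f(a k) <= f(a)^k: from an estimate for the k m-fold convolution of S_a one gets a norm with an almost
   as good estimate for S_a by averaging over the first k m convolutions, and letting m grow removes the constants.
   Bourgain's l1-index argument gives f(a) < 1 for some a.  Hence the index a0 is closed under b |-> b k, that is, a
   power of omega, and f(a0 n + b) = f(a0)^n because (a0 n + b) k <= a0 (n k + 1) for all k and b < a0. *)

theory Submission
  imports Defs
begin

text \<open>The limit stages of the Schreier classes are built along arbitrary ladders, and the
  ladders of b + c and of c are unrelated. Hence the classes can be compared only after moving sets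
  to the right. The moduli survive this because they are suprema over all block bases, subsequences
  included. The supremum over equivalent norms is what makes f(a k) <= f(a)^k possible: an estimate
  for the large class has to become a norm with a good estimate for the small one. The averaged norm
  must be subadditive, so it is built from intervals with free end points instead of the blocks of
  an admissible sequence. Passing between the two costs a constant that depends on the norm only,
  not on the number of blocks. Iterating the given estimate first puts this constant against the
  ratio of the K-th powers of two distinct numbers, which absorbs it for large K.\<close>

section \<open>Arithmetic of countable ordinals\<close>

declare cord_add_rec(1,2) [simp] cord_mult_rec(1,2) [simp]

section \<open>Induction, monotonicity and continuity of ordinal sums\<close>

lemma cord_cases:
  fixes a :: cord
  obtains "a = 0" | b where "a = osucc b" | "is_limit a"
  unfolding is_limit_def by blast

lemma cord_induct [case_names zero succ limit]:
  fixes a :: cord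
  assumes "P 0" "\<And>b. P b \<Longrightarrow> P (osucc b)"
    "\<And>c. is_limit c \<Longrightarrow> (\<And>b. b < c \<Longrightarrow> P b) \<Longrightarrow> P c"
  shows "P a"
proof (induction a rule: less_induct)
  case (less a)
  then show ?case
    by (cases a rule: cord_cases) (use assms osucc_greater in auto)
qed

lemma less_osucc_iff: "a < osucc b \<longleftrightarrow> a \<le> b"
  by (meson leD leI osucc_greater osucc_le_iff order.strict_trans1)

lemma limit_osucc_less: "is_limit c \<Longrightarrow> b < c \<Longrightarrow> osucc b < c"
  by (metis is_limit_def order_less_le osucc_le_iff)

lemma countable_image_lessThan: "countable (f ` {..<c :: cord})"
  using countable_initial_segment by blast

lemma less_osupE:
  fixes x :: cord
  assumes "x < osup A"
  obtains a where "a \<in> A" "x < a"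
  using assms osup_least[of A x] by (metis leD leI)

lemma cord_add_upper: "is_limit c \<Longrightarrow> b < c \<Longrightarrow> a + b \<le> a + (c :: cord)"
  unfolding cord_add_rec(3) by (rule osup_upper[OF countable_image_lessThan]) auto

lemma cord_le_add: "a \<le> a + (b :: cord)"
proof (induction b rule: cord_induct)
  case (succ b)
  then show ?case using cord_add_rec(2) osucc_greater[of "a + b"] by (metis order.strict_trans1 order_less_le)
next
  case (limit c)
  then show ?case
    by (metis cord_add_rec(1) cord_add_upper is_limit_def order_less_le zero_le_cord)
qed (simp add: cord_add_rec)

lemma cord_add_strict_mono: "b < c \<Longrightarrow> a + b < a + (c :: cord)"
proof (induction c rule: cord_induct)
  case zero
  then show ?case by (metis leD zero_le_cord)
next
  case (succ c)
  then show ?case by (metis cord_add_rec(2) less_osucc_iff order_less_le order.strict_trans2 osucc_greater)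
next
  case (limit c)
  have "osucc b < c" using limit limit_osucc_less by blast
  then have "a + osucc b \<le> a + c" using limit cord_add_upper by blast
  then show ?case using cord_add_rec(2) osucc_le_iff by metis
qed

lemma cord_add_mono: "b \<le> c \<Longrightarrow> a + b \<le> a + (c :: cord)"
  using cord_add_strict_mono by (metis order_le_less)

lemma cord_add_mono_left: "a \<le> a' \<Longrightarrow> a + b \<le> a' + (b :: cord)"
proof (induction b rule: cord_induct)
  case (succ b)
  then show ?case by (metis cord_add_rec(2) less_osucc_iff osucc_le_iff)
next
  case (limit c)
  then show ?case
    unfolding cord_add_rec(3)[OF limit(1), of a]
    by (intro osup_least) (use cord_add_upper in \<open>fastforce intro: order_trans\<close>)
qed (simp add: cord_add_rec)

text \<open>A predecessor d of the sum would lie below some a + b with b < c; then a + b would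
  already reach the sum, against strict monotonicity.\<close>

lemma limit_add: "is_limit c \<Longrightarrow> is_limit (a + (c :: cord))"
proof -
  assume c: "is_limit c"
  have "a + c \<noteq> osucc d" for d
  proof
    assume eq: "a + c = osucc d"
    then have "d < osup ((\<lambda>b. a + b) ` {..<c})"
      using cord_add_rec(3)[OF c] osucc_greater by metis
    then obtain b where b: "b < c" "d < a + b" by (auto elim: less_osupE)
    then have "osucc d \<le> a + b" by (simp add: osucc_le_iff)
    also have "\<dots> < a + c" by (rule cord_add_strict_mono[OF b(1)])
    finally show False using eq by simp
  qed
  moreover have "a + c \<noteq> 0"
    by (metis c cord_add_strict_mono is_limit_def leD order_less_le zero_le_cord)
  ultimately show ?thesis by (simp add: is_limit_def)
qed

lemma less_add_limitE:
  fixes x :: cord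
  assumes "is_limit c" "x < a + c"
  obtains b where "b < c" "x < a + b"
  using assms unfolding cord_add_rec(3)[OF assms(1)] by (auto elim: less_osupE)

lemma cord_add_assoc: "(a + b) + c = a + (b + (c :: cord))"
proof (induction c rule: cord_induct)
  case (limit c)
  show ?case
  proof (rule antisym)
    show "a + b + c \<le> a + (b + c)"
      unfolding cord_add_rec(3)[OF limit(1), of "a + b"]
      by (intro osup_least) (use limit cord_add_mono cord_add_upper in fastforce)
    show "a + (b + c) \<le> a + b + c"
      unfolding cord_add_rec(3)[OF limit_add[OF limit(1)], of a]
    proof (intro osup_least)
      fix x assume "x \<in> (+) a ` {..<b + c}"
      then obtain y where y: "x = a + y" "y < b + c" by auto
      then obtain d where d: "d < c" "y < b + d" using less_add_limitE limit(1) by blast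
      have "x \<le> a + (b + d)" using y d cord_add_mono order_less_imp_le by simp
      also have "\<dots> = a + b + d" using limit d by simp
      also have "\<dots> \<le> a + b + c" using cord_add_upper limit d by blast
      finally show "x \<le> a + b + c" .
    qed
  qed
qed (simp_all add: cord_add_rec)

lemma cord_zero_add [simp]: "0 + (a :: cord) = a"
proof (induction a rule: cord_induct)
  case (limit c)
  show ?case
  proof (rule antisym)
    show "0 + c \<le> c" unfolding cord_add_rec(3)[OF limit(1)]
      by (intro osup_least) (use limit in auto)
    show "c \<le> 0 + c"
    proof (rule ccontr)
      assume "\<not> c \<le> 0 + c"
      then have less: "0 + c < c" by simp
      then have "0 + (0 + c) < 0 + c" by (rule cord_add_strict_mono)
      with limit(2)[OF less] show False by simp
    qed
  qed
qed (simp_all add: cord_add_rec)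

section \<open>Finite multiples, omega and its powers\<close>

lemma is_limit_omega: "is_limit omega"
  and ord_of_nat_less_omega: "ord_of_nat n < omega"
  and less_omegaE: "b < omega \<Longrightarrow> \<exists>n. b < ord_of_nat n"
proof -
  have le: "ord_of_nat n \<le> omega" for n
    unfolding omega_def by (rule osup_upper) auto
  have less: "ord_of_nat n < omega" for n
    using le[of "Suc n"] by (simp add: ord_of_nat_def osucc_le_iff)
  have ex: "\<exists>n. b < ord_of_nat n" if "b < omega" for b
    using that unfolding omega_def by (auto elim: less_osupE)
  show "ord_of_nat n < omega" by (rule less)
  show "b < omega \<Longrightarrow> \<exists>n. b < ord_of_nat n" by (rule ex)
  have "omega \<noteq> osucc b" for b
  proof
    assume b: "omega = osucc b"
    then obtain n where "b < ord_of_nat n" using ex osucc_greater by metis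
    then have "omega \<le> ord_of_nat n" unfolding b osucc_le_iff .
    with less[of n] show False by simp
  qed
  moreover have "omega \<noteq> 0" using less[of 0] zero_le_cord by (metis leD)
  ultimately show "is_limit omega" by (simp add: is_limit_def)
qed

lemma ord_of_nat_rec [simp]: "ord_of_nat 0 = 0" "ord_of_nat (Suc n) = osucc (ord_of_nat n)"
  by (simp_all add: ord_of_nat_def)

lemma less_ord_of_natE: "b < ord_of_nat n \<Longrightarrow> \<exists>m<n. b = ord_of_nat m"
proof (induction n)
  case 0
  then show ?case by (simp add: leD)
next
  case (Suc n)
  then show ?case by (metis less_SucI lessI less_osucc_iff order_le_less ord_of_nat_rec(2))
qed

lemma mult_omega_le_iff: "a * omega \<le> b \<longleftrightarrow> (\<forall>n. a * ord_of_nat n \<le> (b :: cord))"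
proof
  assume le: "a * omega \<le> b"
  show "\<forall>n. a * ord_of_nat n \<le> b"
  proof
    fix n
    have "a * ord_of_nat n \<le> a * omega"
      unfolding cord_mult_rec(3)[OF is_limit_omega]
      by (rule osup_upper[OF countable_image_lessThan]) (simp add: ord_of_nat_less_omega)
    with le show "a * ord_of_nat n \<le> b" by simp
  qed
next
  assume *: "\<forall>n. a * ord_of_nat n \<le> b"
  show "a * omega \<le> b"
    unfolding cord_mult_rec(3)[OF is_limit_omega]
    by (rule osup_least) (use * less_omegaE less_ord_of_natE in fastforce)
qed

lemma cord_mult_nat_add: "a * ord_of_nat (m + n) = a * ord_of_nat m + a * ord_of_nat n"
  by (induction n) (simp_all add: cord_add_rec cord_add_assoc)

lemma cord_mult_nat_assoc: "a * ord_of_nat m * ord_of_nat n = a * ord_of_nat (m * n)"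
  by (induction n) (simp_all add: cord_mult_nat_add add.commute[of m])

text \<open>Guarantees that the powers of omega exceed every countable ordinal, so that there is a
  least power above a given one.\<close>

lemma le_omega_pow: "a < omega_pow (osucc a)"
proof -
  have one: "1 \<le> omega_pow a \<and> a \<le> omega_pow a" for a
  proof (induction a rule: cord_induct)
    case (succ b)
    have "omega_pow b * ord_of_nat 2 \<le> omega_pow b * omega"
      using mult_omega_le_iff by blast
    then have "omega_pow b + omega_pow b \<le> omega_pow b * omega"
      by (simp add: numeral_2_eq_2)
    moreover have "omega_pow b < omega_pow b + omega_pow b"
      using cord_add_strict_mono[of 0 "omega_pow b" "omega_pow b"] succ
      by (metis cord_add_rec(1) one_cord_def order.strict_trans2 osucc_greater)
    ultimately have "omega_pow b < omega_pow (osucc b)" by (simp add: omega_pow_rec)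
    with succ show ?case by (metis order.strict_trans1 order_less_imp_le osucc_le_iff)
  next
    case (limit c)
    have up: "omega_pow b \<le> omega_pow c" if "b < c" for b
      unfolding omega_pow_rec(3)[OF limit(1)]
      by (rule osup_upper[OF countable_image_lessThan]) (use that in auto)
    have "0 < c" using limit(1) by (metis is_limit_def order_le_less zero_le_cord)
    then have "1 \<le> omega_pow c" using up omega_pow_rec(1) by metis
    moreover have "c \<le> omega_pow c"
    proof (rule ccontr)
      assume "\<not> c \<le> omega_pow c"
      then have *: "osucc (omega_pow c) < c" using limit_osucc_less limit(1) by simp
      then have "osucc (omega_pow c) \<le> omega_pow c" using limit(2) up order_trans by blast
      then show False using osucc_le_iff by blast
    qed
    ultimately show ?case by blast
  qed (simp_all add: omega_pow_rec)
  show ?thesis using one[of "osucc a"] by (simp add: osucc_le_iff)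
qed

text \<open>The ordinal \<open>a\<close> lies in some interval between \<open>\<omega>\<close>-powers \<open>\<omega>\<^sup>c \<le> a < \<omega>\<^sup>c \<omega>\<close>, and
  the closure assumption leaves only the left end point.\<close>

lemma omega_pow_if_mult_closed:
  fixes a :: cord
  assumes "a \<noteq> 0" and closed: "\<And>b n. b < a \<Longrightarrow> b * ord_of_nat n < a"
  shows "\<exists>c. a = omega_pow c"
proof -
  define d where "d = (LEAST d. a < omega_pow d)"
  have d: "a < omega_pow d" unfolding d_def by (rule LeastI) (rule le_omega_pow)
  have below: "omega_pow c \<le> a" if "c < d" for c
    using that not_less_Least unfolding d_def by (metis leI)
  show ?thesis
  proof (cases d rule: cord_cases)
    case 1
    then have "a < 1" using d omega_pow_rec(1) by simp
    then show ?thesis using assms(1) by (simp add: one_cord_def less_osucc_iff order_antisym)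
  next
    case (2 c)
    then have "omega_pow c \<le> a" using below osucc_greater by simp
    moreover have "\<not> omega_pow c < a"
    proof
      assume "omega_pow c < a"
      then have "omega_pow c * omega \<le> a"
        unfolding mult_omega_le_iff using closed order_less_imp_le by blast
      then show False using d 2 omega_pow_rec(2) by simp
    qed
    ultimately show ?thesis by (metis order_le_less)
  next
    case 3
    have "omega_pow d \<le> a"
      unfolding omega_pow_rec(3)[OF 3] by (rule osup_least) (use below in auto)
    then show ?thesis using d by simp
  qed
qed

text \<open>For y < a the sum b + y is at most twice the larger of b and y, and closure keeps this
  below a. At a limit a these sums exhaust b + a.\<close>

lemma add_absorb_if_mult_closed:
  fixes a b :: cord
  assumes "b < a" and closed: "\<And>b n. b < a \<Longrightarrow> b * ord_of_nat n < a"
  shows "b + a = a"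
proof (cases a rule: cord_cases)
  case 1
  then show ?thesis using assms(1) by (simp add: leD)
next
  case (2 c)
  \<comment> \<open>Among the successors only 1 is closed under doubling.\<close>
  have "c * ord_of_nat 2 < a" using closed 2 osucc_greater by simp
  then have "c + c \<le> c" using 2 by (simp add: numeral_2_eq_2 less_osucc_iff)
  then have "c = 0" using cord_add_strict_mono[of 0 c c]
    by (metis cord_add_rec(1) leD order_le_less zero_le_cord)
  then have "b = 0" using assms(1) 2 by (simp add: less_osucc_iff order_antisym)
  then show ?thesis by simp
next
  case 3
  show ?thesis
  proof (rule antisym)
    show "b + a \<le> a"
      unfolding cord_add_rec(3)[OF 3]
    proof (rule osup_least)
      fix x assume "x \<in> (+) b ` {..<a}"
      then obtain y where y: "x = b + y" "y < a" by auto
      have "x \<le> max b y + max b y" unfolding y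
        by (rule order_trans[OF cord_add_mono cord_add_mono_left]) auto
      also have "\<dots> = max b y * ord_of_nat 2" by (simp add: numeral_2_eq_2)
      also have "\<dots> < a" using closed y assms(1) by simp
      finally show "x \<le> a" by simp
    qed
    show "a \<le> b + a" using cord_add_mono_left[of 0 b a] by simp
  qed
qed

text \<open>In the k-fold sum of a n + b every b except the last is followed by a copy of a and
  absorbed by it, so a single b survives, and it is smaller than a. For n = 0 there is no copy of a
  that could absorb b; there closure gives the bound at once.\<close>

lemma mult_closed_remainder_bound:
  fixes a b :: cord
  assumes "b < a" and closed: "\<And>b n. b < a \<Longrightarrow> b * ord_of_nat n < a"
  shows "(a * ord_of_nat n + b) * ord_of_nat k \<le> a * ord_of_nat (n * k + 1)"
proof (cases n)
  case 0
  then show ?thesis using closed[OF assms(1), of k] by (simp add: order_less_imp_le)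
next
  case (Suc m)
  have absorb: "b + a * ord_of_nat n = a * ord_of_nat n"
    using add_absorb_if_mult_closed[OF assms] cord_mult_nat_add[of a 1 m]
    unfolding Suc by (simp flip: cord_add_assoc)
  have "(a * ord_of_nat n + b) * ord_of_nat k \<le> a * ord_of_nat (n * k) + b"
  proof (induction k)
    case (Suc k)
    have "(a * ord_of_nat n + b) * ord_of_nat (Suc k)
        \<le> (a * ord_of_nat (n * k) + b) + (a * ord_of_nat n + b)"
      using cord_add_mono_left[OF Suc] by simp
    also have "\<dots> = a * ord_of_nat (n * k) + (b + a * ord_of_nat n) + b"
      by (simp add: cord_add_assoc)
    also have "\<dots> = a * ord_of_nat (n * Suc k) + b"
      unfolding absorb by (simp add: add.commute[of n] flip: cord_mult_nat_add)
    finally show ?case .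
  qed simp
  also have "\<dots> \<le> a * ord_of_nat (n * k + 1)"
    using cord_add_mono[of b a] assms(1) by simp
  finally show ?thesis .
qed

section \<open>Convolutions and the Schreier classes\<close>

definition piece :: "nat set \<Rightarrow> nat set \<Rightarrow> nat \<Rightarrow> nat set"
  where "piece A F a = {x\<in>F. a \<le> x \<and> (\<forall>b\<in>A. b \<le> x \<longrightarrow> b \<le> a)}"

definition covers :: "nat set \<Rightarrow> nat set \<Rightarrow> bool"
  where "covers A F \<longleftrightarrow> (\<forall>x\<in>F. \<exists>a\<in>A. a \<le> x)"

text \<open>The convolution in terms of the set A of minima alone: a block is recovered as the part
  of F from one element of A up to the next, so no indexed sequence of blocks has to be carried
  along. As A is contained in F, each block starts at its element of A, and \<open>covers\<close>
  leaves nothing of F before the first block.\<close>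

definition conv :: "nat set set \<Rightarrow> nat set set \<Rightarrow> nat set set"
  where "conv \<F> \<G> =
    {F. finite F \<and> (\<exists>A\<in>\<F>. A \<subseteq> F \<and> covers A F \<and> (\<forall>a\<in>A. piece A F a \<in> \<G>))}"

lemma convI:
  assumes "A \<in> \<F>" "A \<subseteq> F" "covers A F" "\<And>a. a \<in> A \<Longrightarrow> piece A F a \<in> \<G>" "finite F"
  shows "F \<in> conv \<F> \<G>"
  using assms unfolding conv_def by auto

text \<open>The hereditary and spreading families. Spreading is stated for maps on F alone, which
  fits the later replacement of left end points by the minima of smaller sets. Members avoid 0
  because supports are numbered from 1.\<close>

definition regular_family :: "nat set set \<Rightarrow> bool"
  where "regular_family \<F> \<longleftrightarrow> (\<forall>F\<in>\<F>. finite F \<and> 0 \<notin> F) \<and> (\<forall>F\<in>\<F>. \<forall>G\<subseteq>F. G \<in> \<F>) \<and>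
    (\<forall>F\<in>\<F>. \<forall>h. strict_mono_on F h \<and> (\<forall>x\<in>F. x \<le> h x) \<longrightarrow> h ` F \<in> \<F>) \<and> (\<forall>n\<ge>1. {n} \<in> \<F>)"

lemma regularD:
  assumes "regular_family \<F>"
  shows "F \<in> \<F> \<Longrightarrow> finite F" "F \<in> \<F> \<Longrightarrow> 0 \<notin> F" "F \<in> \<F> \<Longrightarrow> G \<subseteq> F \<Longrightarrow> G \<in> \<F>"
    "F \<in> \<F> \<Longrightarrow> strict_mono_on F h \<Longrightarrow> (\<And>x. x \<in> F \<Longrightarrow> x \<le> h x) \<Longrightarrow> h ` F \<in> \<F>"
    "n \<ge> 1 \<Longrightarrow> {n} \<in> \<F>" "{} \<in> \<F>"
proof -
  note * = assms[unfolded regular_family_def]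
  show "F \<in> \<F> \<Longrightarrow> finite F" "F \<in> \<F> \<Longrightarrow> 0 \<notin> F" "n \<ge> 1 \<Longrightarrow> {n} \<in> \<F>"
    using * by simp_all
  show sub: "G \<in> \<F>" if "F \<in> \<F>" "G \<subseteq> F" for F G using * that by simp
  show "{} \<in> \<F>" using sub[of "{1}" "{}"] * by simp
  show "F \<in> \<F> \<Longrightarrow> strict_mono_on F h \<Longrightarrow> (\<And>x. x \<in> F \<Longrightarrow> x \<le> h x) \<Longrightarrow> h ` F \<in> \<F>"
    using * by simp
qed

lemma in_piece_unique: "a \<in> A \<Longrightarrow> b \<in> A \<Longrightarrow> x \<in> piece A F a \<Longrightarrow> x \<in> piece A F b \<Longrightarrow> a = b"
  unfolding piece_def by force

lemma in_pieceE:
  assumes "finite A" "covers A F" "x \<in> F"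
  obtains a where "a \<in> A" "x \<in> piece A F a"
proof -
  let ?B = "{b\<in>A. b \<le> x}"
  have "finite ?B" "?B \<noteq> {}" using assms unfolding covers_def by auto
  then have "Max ?B \<in> ?B" "\<forall>b\<in>?B. b \<le> Max ?B" by (rule Max_in, simp)
  then show ?thesis using that[of "Max ?B"] assms(3) unfolding piece_def by auto
qed

lemma in_own_piece: "a \<in> A \<Longrightarrow> a \<in> F \<Longrightarrow> a \<in> piece A F a"
  unfolding piece_def by auto

lemma piece_subset: "piece A F a \<subseteq> F"
  unfolding piece_def by auto

lemma image_piece:
  assumes "strict_mono_on F h" "A \<subseteq> F" "a \<in> A"
  shows "h ` piece A F a = piece (h ` A) (h ` F) (h a)"
proof -
  have le: "h x \<le> h y \<longleftrightarrow> x \<le> y" if "x \<in> F" "y \<in> F" for x y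
    using strict_mono_on_less_eq[OF assms(1)] that by blast
  then show ?thesis using assms(2,3) unfolding piece_def by (auto simp: subset_iff)
qed

lemma conv_spread:
  assumes "F \<in> conv \<F> \<G>" "strict_mono_on F h"
    and F: "\<And>A. A \<in> \<F> \<Longrightarrow> A \<subseteq> F \<Longrightarrow> h ` A \<in> \<F>'"
    and G: "\<And>A. A \<in> \<G> \<Longrightarrow> A \<subseteq> F \<Longrightarrow> h ` A \<in> \<G>'"
  shows "h ` F \<in> conv \<F>' \<G>'"
proof -
  obtain A where A: "A \<in> \<F>" "A \<subseteq> F" "covers A F" "\<forall>a\<in>A. piece A F a \<in> \<G>" "finite F"
    using assms(1) unfolding conv_def by auto
  have "covers (h ` A) (h ` F)" using A(2,3) strict_mono_on_less_eq[OF assms(2)]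
    unfolding covers_def by (metis (no_types, lifting) image_iff subsetD)
  moreover have "\<forall>a\<in>h ` A. piece (h ` A) (h ` F) a \<in> \<G>'"
    using image_piece[OF assms(2) A(2)] G A(4) piece_subset by fastforce
  ultimately show ?thesis
    by - (rule convI[of "h ` A"], use F[OF A(1,2)] A(2,5) in auto)
qed

text \<open>The minima of what G leaves of the blocks are the new left end points. They lie to the
  right of the old ones, so the outer family admits them by heredity and spreading, and the inner
  family admits the smaller blocks by heredity.\<close>

lemma conv_hereditary:
  assumes "regular_family \<F>" "regular_family \<G>" "F \<in> conv \<F> \<G>" "G \<subseteq> F"
  shows "G \<in> conv \<F> \<G>"
proof -
  obtain A where A: "A \<in> \<F>" "A \<subseteq> F" "covers A F" "\<forall>a\<in>A. piece A F a \<in> \<G>" "finite F"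
    using assms(3) unfolding conv_def by auto
  have finA: "finite A" using A regularD(1)[OF assms(1)] by blast
  have finG: "finite G" using A assms(4) finite_subset by blast
  define A0 where "A0 = {a\<in>A. piece A F a \<inter> G \<noteq> {}}"
  define h where "h a = Min (piece A F a \<inter> G)" for a
  have h_in: "h a \<in> piece A F a \<inter> G" if "a \<in> A0" for a
    unfolding h_def using that finG A0_def by (intro Min_in) auto
  have h_le: "h a \<le> x" if "x \<in> piece A F a" "x \<in> G" for a x
    unfolding h_def using that finG by (intro Min_le) auto
  have h_ge: "a \<le> h a" if "a \<in> A0" for a using h_in[OF that] by (auto simp: piece_def)
  have mono: "strict_mono_on A0 h"
  proof (rule strict_mono_onI)
    fix a b assume ab: "a \<in> A0" "b \<in> A0" "a < b"
    have "\<not> b \<le> h a" using h_in[OF ab(1)] ab A0_def by (auto simp: piece_def)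
    then show "h a < h b" using h_ge[OF ab(2)] by linarith
  qed
  have "A0 \<in> \<F>" using regularD(3)[OF assms(1) A(1)] A0_def by auto
  then have hA: "h ` A0 \<in> \<F>" using regularD(4)[OF assms(1)] mono h_ge by blast
  have ex: "\<exists>c\<in>A0. x \<in> piece A F c" if x: "x \<in> G" for x
  proof -
    obtain c where "c \<in> A" "x \<in> piece A F c"
      using in_pieceE[OF finA A(3), of x] \<open>G \<subseteq> F\<close> x by blast
    then show ?thesis using x unfolding A0_def by blast
  qed
  have "covers (h ` A0) G" unfolding covers_def using ex h_le by blast
  moreover have "piece (h ` A0) G (h a) \<subseteq> piece A F a" if a: "a \<in> A0" for a
  proof
    fix x assume x: "x \<in> piece (h ` A0) G (h a)"
    then have "x \<in> G" by (auto simp: piece_def)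
    then obtain c where c: "c \<in> A0" "x \<in> piece A F c" using ex by blast
    have "h c \<le> x" using h_le c(2) \<open>x \<in> G\<close> by blast
    then have "h c \<le> h a" using x c(1) by (auto simp: piece_def)
    then have "c \<le> a" using strict_mono_on_less_eq[OF mono c(1) a] by blast
    moreover have "a \<le> x" using x h_ge[OF a] by (auto simp: piece_def)
    then have "a \<le> c" using c(2) a A0_def by (auto simp: piece_def)
    ultimately show "x \<in> piece A F a" using c by simp
  qed
  then have "\<forall>a\<in>h ` A0. piece (h ` A0) G a \<in> \<G>"
    using A(4) regularD(3)[OF assms(2)] unfolding A0_def by blast
  moreover have "h ` A0 \<subseteq> G" using h_in by blast
  ultimately show ?thesis using hA finG by (intro convI[of "h ` A0"]) auto
qed

lemma regular_subset_conv:
  assumes "regular_family \<F>" "regular_family \<G>"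
  shows "\<G> \<subseteq> conv \<F> \<G>"
proof
  fix G assume G: "G \<in> \<G>"
  show "G \<in> conv \<F> \<G>"
  proof (cases "G = {}")
    case True
    then show ?thesis using regularD(6)[OF assms(1)] by (auto simp: conv_def covers_def)
  next
    case False
    then have m: "Min G \<in> G" "\<forall>x\<in>G. Min G \<le> x" using regularD(1)[OF assms(2) G] by auto
    then have "{Min G} \<in> \<F>" using regularD(5)[OF assms(1)] regularD(2)[OF assms(2) G]
      by (metis less_one linorder_not_less)
    moreover have "piece {Min G} G (Min G) = G" using m by (auto simp: piece_def)
    ultimately show ?thesis unfolding conv_def covers_def
      using m G regularD(1)[OF assms(2) G] by (auto intro!: bexI[of _ "{Min G}"])
  qed
qed

lemma regular_conv:
  assumes "regular_family \<F>" "regular_family \<G>"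
  shows "regular_family (conv \<F> \<G>)"
  unfolding regular_family_def
proof (intro conjI ballI allI impI)
  fix F assume F: "F \<in> conv \<F> \<G>"
  then show "finite F" by (auto simp: conv_def)
  show "0 \<notin> F"
  proof
    assume "0 \<in> F"
    then obtain A where "A \<in> \<F>" "0 \<in> A" using F by (auto simp: conv_def covers_def)
    then show False using regularD(2)[OF assms(1)] by blast
  qed
next
  fix F h assume "F \<in> conv \<F> \<G>" and h: "strict_mono_on F h \<and> (\<forall>x\<in>F. x \<le> h x)"
  then show "h ` F \<in> conv \<F> \<G>"
    by (intro conv_spread[of F \<F> \<G>])
      (auto intro!: regularD(4)[OF assms(1)] regularD(4)[OF assms(2)] intro: monotone_on_subset)
next
  fix n :: nat assume "1 \<le> n"
  then show "{n} \<in> conv \<F> \<G>"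
    using regular_subset_conv[OF assms] regularD(5)[OF assms(2)] by blast
qed (use conv_hereditary[OF assms] in blast)

text \<open>From left to right, the minima of the fine blocks inside all coarse blocks are collected
  into the intermediate set C. From right to left, the coarse blocks cut the given C into the sets
  of minima that belong to them.\<close>

lemma conv_assoc:
  assumes "\<And>F. F \<in> \<F> \<Longrightarrow> finite F" "\<And>F. F \<in> \<G> \<Longrightarrow> finite F"
  shows "conv \<F> (conv \<G> \<H>) = conv (conv \<F> \<G>) \<H>"
proof (intro equalityI subsetI)
  fix F assume "F \<in> conv \<F> (conv \<G> \<H>)"
  then obtain A where A: "A \<in> \<F>" "A \<subseteq> F" "covers A F" "finite F"
    and "\<forall>a\<in>A. piece A F a \<in> conv \<G> \<H>" unfolding conv_def by blast
  then have "\<forall>a\<in>A. \<exists>B. B \<in> \<G> \<and> B \<subseteq> piece A F a \<and> covers B (piece A F a) \<and>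
      (\<forall>b\<in>B. piece B (piece A F a) b \<in> \<H>)" unfolding conv_def by blast
  then obtain B where B: "\<And>a. a \<in> A \<Longrightarrow> B a \<in> \<G>" "\<And>a. a \<in> A \<Longrightarrow> B a \<subseteq> piece A F a"
      "\<And>a. a \<in> A \<Longrightarrow> covers (B a) (piece A F a)"
      "\<And>a b. a \<in> A \<Longrightarrow> b \<in> B a \<Longrightarrow> piece (B a) (piece A F a) b \<in> \<H>" by metis
  have finA: "finite A" using A finite_subset by blast
  define C where "C = (\<Union>a\<in>A. B a)"
  have AC: "A \<subseteq> C"
  proof
    fix a assume a: "a \<in> A"
    then have "a \<in> piece A F a" using A(2) in_own_piece by blast
    then obtain b where "b \<in> B a" "b \<le> a" using B(3)[OF a] unfolding covers_def by blast
    moreover from this have "a \<le> b" using B(2)[OF a] by (auto simp: piece_def)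
    ultimately show "a \<in> C" using a C_def by auto
  qed
  have CF: "C \<subseteq> F" using B(2) piece_subset C_def by fast
  have pc: "piece A C a = B a" if a: "a \<in> A" for a
  proof
    show "B a \<subseteq> piece A C a" using B(2)[OF a] a C_def by (auto simp: piece_def)
    show "piece A C a \<subseteq> B a"
    proof
      fix x assume x: "x \<in> piece A C a"
      then obtain a' where a': "a' \<in> A" "x \<in> B a'" using C_def by (auto simp: piece_def)
      then have "x \<in> piece A F a'" using B(2) by blast
      moreover have "x \<in> piece A F a" using x CF by (auto simp: piece_def)
      ultimately show "x \<in> B a" using in_piece_unique a a' by blast
    qed
  qed
  have "C \<in> conv \<F> \<G>"
    unfolding conv_def using A AC CF pc B(1) finite_subset[OF CF]
    by (auto simp: covers_def subset_iff intro!: bexI[of _ A])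
  moreover have "covers C F" using A(3) AC by (auto simp: covers_def)
  moreover have "piece C F b \<in> \<H>" if b: "b \<in> C" for b
  proof -
    obtain a where a: "a \<in> A" "b \<in> B a" using b unfolding C_def by auto
    have b: "b \<in> piece A F a" using B(2) a by blast
    have "piece C F b = piece (B a) (piece A F a) b"
    proof (intro equalityI subsetI)
      fix x assume x: "x \<in> piece C F b"
      then have "x \<in> piece A F a" using b AC unfolding piece_def by (auto dest!: subsetD)
      then show "x \<in> piece (B a) (piece A F a) b"
        using x a C_def by (auto simp: piece_def)
    next
      fix x assume x: "x \<in> piece (B a) (piece A F a) b"
      have "c \<le> b" if c: "c \<in> C" "c \<le> x" for c
      proof -
        obtain a' where a': "a' \<in> A" "c \<in> B a'" using c C_def by auto
        have c': "c \<in> piece A F a'" using B(2) a' by blast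
        then have "a' \<le> a" using c x a' by (auto simp: piece_def)
        show ?thesis
        proof (cases "a' = a")
          case True
          then show ?thesis using x a' c by (auto simp: piece_def)
        next
          case False
          then have "\<not> a \<le> c" using c' a \<open>a' \<le> a\<close> by (auto simp: piece_def)
          then show ?thesis using b by (auto simp: piece_def)
        qed
      qed
      then show "x \<in> piece C F b" using x by (auto simp: piece_def)
    qed
    then show ?thesis using B(4)[OF a] by simp
  qed
  ultimately show "F \<in> conv (conv \<F> \<G>) \<H>"
    by - (rule convI[of C], use CF A(4) in auto)
next
  fix F assume "F \<in> conv (conv \<F> \<G>) \<H>"
  then obtain C where C: "C \<in> conv \<F> \<G>" "C \<subseteq> F" "covers C F"
    "\<And>b. b \<in> C \<Longrightarrow> piece C F b \<in> \<H>" "finite F" unfolding conv_def by blast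
  from C(1) obtain A where A: "A \<in> \<F>" "A \<subseteq> C" "covers A C"
    "\<And>a. a \<in> A \<Longrightarrow> piece A C a \<in> \<G>" unfolding conv_def by blast
  have "covers A F" using C(3) A(3) unfolding covers_def by (meson order_trans)
  moreover have "piece A F a \<in> conv \<G> \<H>" if a: "a \<in> A" for a
  proof -
    have 1: "covers (piece A C a) (piece A F a)"
      unfolding covers_def
    proof
      fix x assume x: "x \<in> piece A F a"
      then show "\<exists>b\<in>piece A C a. b \<le> x" using a A(2) in_own_piece by (auto simp: piece_def)
    qed
    have 2: "piece (piece A C a) (piece A F a) b \<in> \<H>" if b: "b \<in> piece A C a" for b
    proof -
      have "piece (piece A C a) (piece A F a) b = piece C F b"
      proof (intro equalityI subsetI)
        fix x assume x: "x \<in> piece (piece A C a) (piece A F a) b"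
        have "c \<le> b" if "c \<in> C" "c \<le> x" for c
        proof (cases "a \<le> c")
          case True
          have "\<forall>a'\<in>A. a' \<le> c \<longrightarrow> a' \<le> a" using x that by (auto simp: piece_def)
          then have "c \<in> piece A C a" using True that by (auto simp: piece_def)
          then show ?thesis using x that by (auto simp: piece_def)
        qed (use b in \<open>auto simp: piece_def\<close>)
        then show "x \<in> piece C F b" using x by (auto simp: piece_def)
      next
        fix x assume x: "x \<in> piece C F b"
        have "a' \<le> a" if "a' \<in> A" "a' \<le> x" for a'
        proof -
          have "a' \<le> b" using x that A(2) by (auto simp: piece_def)
          then show ?thesis using b that by (auto simp: piece_def)
        qed
        moreover have "a \<le> x" using x b by (auto simp: piece_def)
        ultimately show "x \<in> piece (piece A C a) (piece A F a) b"
          using x by (auto simp: piece_def)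
      qed
      then show ?thesis using C(4) b piece_subset by (metis subsetD)
    qed
    have "piece A C a \<subseteq> piece A F a" using C(2) by (auto simp: piece_def)
    then show ?thesis
      using 1 2 A(4)[OF a] finite_subset[OF piece_subset C(5)] by (intro convI)
  qed
  ultimately show "F \<in> conv \<F> (conv \<G> \<H>)" by - (rule convI[of A], use A C in auto)
qed

text \<open>The sets may be empty and may miss their left end points. Dropping the empty ones and
  passing to minima moves A to the right, which regularity permits.\<close>

lemma conv_UnionI:
  assumes "regular_family \<F>" "regular_family \<G>" "A \<in> \<F>"
    and B: "\<And>a. a \<in> A \<Longrightarrow> B a \<in> \<G>" "\<And>a. a \<in> A \<Longrightarrow> B a \<subseteq> piece A UNIV a"
  shows "(\<Union>a\<in>A. B a) \<in> conv \<F> \<G>"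
proof -
  define A0 where "A0 = {a\<in>A. B a \<noteq> {}}"
  define h where "h a = Min (B a)" for a
  have finB: "finite (B a)" if "a \<in> A" for a using regularD(1)[OF assms(2)] B(1)[OF that] .
  have A0: "A0 \<subseteq> A" unfolding A0_def by auto
  have h: "h a \<in> B a" "x \<in> B a \<Longrightarrow> h a \<le> x" if "a \<in> A0" for a x
    using finB[of a] that unfolding A0_def h_def by auto
  have Bx: "a \<le> x" "c \<in> A \<Longrightarrow> c \<le> x \<Longrightarrow> c \<le> a" if "a \<in> A" "x \<in> B a" for a x c
    using B(2)[OF that(1)] that(2) unfolding piece_def by auto
  have mono: "strict_mono_on A0 h"
  proof (rule strict_mono_onI)
    fix a b assume ab: "a \<in> A0" "b \<in> A0" "a < b"
    then have "\<not> b \<le> h a" using h(1)[OF ab(1)] Bx(2)[of a "h a" b] A0 by auto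
    then show "h a < h b" using h(1)[OF ab(2)] Bx(1)[of b "h b"] ab A0 by fastforce
  qed
  have "A0 \<in> \<F>" using regularD(3)[OF assms(1,3) A0] .
  then have hA: "h ` A0 \<in> \<F>"
    by (rule regularD(4)[OF assms(1)]) (use mono h(1) Bx(1) A0 in blast)+
  show ?thesis
  proof (rule convI[OF hA])
    show "h ` A0 \<subseteq> (\<Union>a\<in>A. B a)" using h(1) A0 by blast
    show "covers (h ` A0) (\<Union>a\<in>A. B a)" using h(2) unfolding covers_def A0_def by blast
    show "finite (\<Union>a\<in>A. B a)" using finB regularD(1)[OF assms(1,3)] by blast
    fix y assume "y \<in> h ` A0"
    then obtain a where a: "a \<in> A0" "y = h a" by blast
    have "piece (h ` A0) (\<Union>a\<in>A. B a) (h a) \<subseteq> B a"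
    proof
      fix x assume x: "x \<in> piece (h ` A0) (\<Union>a\<in>A. B a) (h a)"
      then obtain b where b: "b \<in> A" "x \<in> B b" unfolding piece_def by blast
      then have b0: "b \<in> A0" unfolding A0_def by blast
      have "h b \<le> h a" using x h(2)[OF b0 b(2)] b0 unfolding piece_def by blast
      then have "b \<le> a" using strict_mono_on_less_eq[OF mono b0 a(1)] by blast
      moreover have "a \<le> h a" using Bx(1) h(1)[OF a(1)] a(1) A0 by blast
      then have "a \<le> x" using x unfolding piece_def by auto
      then have "a \<le> b" using Bx(2)[OF b] a(1) A0 by blast
      ultimately show "x \<in> B a" using b by simp
    qed
    then show "piece (h ` A0) (\<Union>a\<in>A. B a) y \<in> \<G>"
      using a A0 B(1) regularD(3)[OF assms(2)] by blast
  qed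
qed

section \<open>The Schreier classes as convolutions\<close>

lemma strict_sorted_enum:
  assumes "finite (A :: nat set)"
  obtains s where "strict_mono_on {..<card A} s" "s ` {..<card A} = A"
proof -
  let ?xs = "sorted_list_of_set A"
  have "strict_mono_on {..<card A} ((!) ?xs)"
    using strict_sorted_list_of_set[of A]
    by (intro strict_mono_onI) (simp add: sorted_wrt_nth_less)
  moreover have "(!) ?xs ` {..<card A} = A"
    using assms by (metis length_sorted_list_of_set lessThan_atLeast0 list.set_map map_nth set_sorted_list_of_set set_upt)
  ultimately show ?thesis using that by blast
qed

lemma schreier_conv_eq:
  assumes "\<And>F. F \<in> \<F> \<Longrightarrow> finite F" "\<And>F. F \<in> \<G> \<Longrightarrow> finite F"
  shows "schreier_conv \<F> \<G> = conv \<F> \<G>"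
proof (intro equalityI subsetI)
  fix F assume "F \<in> schreier_conv \<F> \<G>"
  then obtain n G where F: "F = (\<Union>i<n. G i)" and G: "\<And>i. i < n \<Longrightarrow> G i \<in> \<G> \<and> G i \<noteq> {}"
    and less: "\<And>i j :: nat. i < j \<Longrightarrow> j < n \<Longrightarrow> set_less (G i) (G j)"
    and A: "(\<lambda>i. Min (G i)) ` {..<n} \<in> \<F>"
    unfolding schreier_conv_def by blast
  let ?A = "(\<lambda>i. Min (G i)) ` {..<n}"
  have m: "Min (G i) \<in> G i" "\<And>x. x \<in> G i \<Longrightarrow> Min (G i) \<le> x" "\<And>x. x \<in> G i \<Longrightarrow> x \<le> Max (G i)"
    if "i < n" for i using G[OF that] assms(2) by auto
  have lt: "x < y" if "x \<in> G i" "y \<in> G j" "i < j" "j < n" for x y i j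
    using less[OF that(3,4)] G[of i] G[of j] m[of i] m[of j] that unfolding set_less_def
    by (meson order.strict_trans order.strict_trans1 order.strict_trans2)
  have "piece ?A F (Min (G i)) = G i" if i: "i < n" for i
  proof (intro equalityI subsetI)
    fix x assume x: "x \<in> piece ?A F (Min (G i))"
    then obtain j where j: "j < n" "x \<in> G j" using F by (auto simp: piece_def)
    have "Min (G j) \<le> Min (G i)" using x j m(2)[OF j(1)] by (auto simp: piece_def)
    then have "\<not> i < j" using lt[of "Min (G i)" i "Min (G j)" j] m(1) i j by fastforce
    moreover have "\<not> j < i" using lt[of x j "Min (G i)" i] m(1) i j x by (fastforce simp: piece_def)
    ultimately show "x \<in> G i" using j by (metis linorder_neqE_nat)
  next
    fix x assume x: "x \<in> G i"
    have "Min (G j) \<le> Min (G i)" if j: "j < n" "Min (G j) \<le> x" for j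
    proof -
      have "\<not> i < j" using lt[of x i "Min (G j)" j] x j m(1) by fastforce
      then show ?thesis using lt[of "Min (G j)" j "Min (G i)" i] m(1) i j
        by (cases "j = i") (auto intro: order_less_imp_le)
    qed
    then show "x \<in> piece ?A F (Min (G i))" using x i F m(2)[OF i] by (auto simp: piece_def)
  qed
  moreover have "covers ?A F" unfolding covers_def F using m(2) by fast
  moreover have "?A \<subseteq> F" using m(1) F by blast
  moreover have "finite F" using F G assms(2) by auto
  ultimately show "F \<in> conv \<F> \<G>" unfolding conv_def using A G by (auto intro!: bexI[of _ ?A])
next
  fix F assume "F \<in> conv \<F> \<G>"
  then obtain A where A: "A \<in> \<F>" "A \<subseteq> F" "covers A F" "\<And>a. a \<in> A \<Longrightarrow> piece A F a \<in> \<G>" "finite F"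
    unfolding conv_def by blast
  have finA: "finite A" using A assms by blast
  obtain s where s: "strict_mono_on {..<card A} s" "s ` {..<card A} = A"
    using strict_sorted_enum[OF finA] by blast
  let ?G = "\<lambda>i. piece A F (s i)"
  have fin: "finite (?G i)" for i using A(5) piece_subset finite_subset by metis
  have si: "s i \<in> A" if "i < card A" for i using s that by blast
  have min: "Min (?G i) = s i" if "i < card A" for i
    using fin si[OF that] A(2) by (intro Min_eqI) (auto simp: piece_def)
  have "F = (\<Union>i<card A. ?G i)"
  proof (intro equalityI subsetI)
    fix x assume "x \<in> F"
    then obtain a where "a \<in> A" "x \<in> piece A F a" using in_pieceE finA A by blast
    moreover from this obtain i where "i < card A" "a = s i" using s(2) by auto
    ultimately show "x \<in> (\<Union>i<card A. ?G i)" by auto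
  qed (auto simp: piece_def)
  moreover have "?G i \<in> \<G> \<and> ?G i \<noteq> {}" if "i < card A" for i
    using A si[OF that] in_own_piece by (metis empty_iff subsetD)
  moreover have "set_less (?G i) (?G j)" if "i < j" "j < card A" for i j
  proof -
    have "s i < s j" using s(1) that by (auto simp: strict_mono_on_def)
    then have "\<forall>x\<in>?G i. x < s j" using si that by (force simp: piece_def)
    moreover have "?G i \<noteq> {}" using si[of i] that A in_own_piece by (metis empty_iff order.strict_trans subsetD)
    ultimately show ?thesis unfolding set_less_def min[OF that(2)] using fin by simp
  qed
  moreover have "(\<lambda>i. Min (?G i)) ` {..<card A} = A" using s(2) min by (simp cong: image_cong_simp)
  ultimately show "F \<in> schreier_conv \<F> \<G>"
    unfolding schreier_conv_def using A(1) by (intro CollectI exI[of _ "card A"] exI[of _ ?G]) simp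
qed

lemma regular_schreier0: "regular_family schreier0"
  unfolding regular_family_def schreier0_def
  by (auto simp: subset_singleton_iff)

lemma regular_schreier1: "regular_family schreier1"
  unfolding regular_family_def
proof (intro conjI ballI allI impI)
  fix F assume F: "F \<in> schreier1"
  then show "finite F" by (auto simp: schreier1_def)
  show "0 \<notin> F"
  proof
    assume "0 \<in> F"
    then have fin: "finite F" "F \<noteq> {}" "card F \<le> Min F" using F by (auto simp: schreier1_def)
    then have "Min F \<le> 0" "card F > 0" using Min_le[of F 0] \<open>0 \<in> F\<close> by (auto simp: card_gt_0_iff)
    then show False using fin by simp
  qed
  fix G assume "G \<subseteq> F"
  show "G \<in> schreier1"
  proof (cases "G = {}")
    case False
    then have fin: "finite F" "card F \<le> Min F" using \<open>G \<subseteq> F\<close> F by (auto simp: schreier1_def)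
    then have "card G \<le> card F" "Min F \<le> Min G" "finite G"
      using card_mono[OF fin(1) \<open>G \<subseteq> F\<close>] Min_antimono[OF \<open>G \<subseteq> F\<close> False fin(1)]
        finite_subset[OF \<open>G \<subseteq> F\<close> fin(1)] by auto
    then show ?thesis using False fin by (auto simp: schreier1_def)
  qed (simp add: schreier1_def)
next
  fix F h assume F: "F \<in> schreier1" and h: "strict_mono_on F h \<and> (\<forall>x\<in>F. x \<le> h x)"
  show "h ` F \<in> schreier1"
  proof (cases "F = {}")
    case False
    then have "finite F" "card F \<le> Min F" using F by (auto simp: schreier1_def)
    moreover have "Min F \<le> h x" if "x \<in> F" for x
      using Min_le[OF \<open>finite F\<close> that] h that by (meson order_trans)
    moreover have "card (h ` F) \<le> card F" using \<open>finite F\<close> card_image_le by blast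
    ultimately have "\<forall>x\<in>F. card (h ` F) \<le> h x" by (meson order_trans)
    then show ?thesis using False \<open>finite F\<close> by (simp add: schreier1_def)
  qed (simp add: schreier1_def)
qed (auto simp: schreier1_def)

lemma conv_schreier0:
  assumes "regular_family \<G>"
  shows "conv schreier0 \<G> = \<G>"
proof
  show "\<G> \<subseteq> conv schreier0 \<G>" by (rule regular_subset_conv[OF regular_schreier0 assms])
  show "conv schreier0 \<G> \<subseteq> \<G>"
  proof
    fix F assume "F \<in> conv schreier0 \<G>"
    then obtain A where A: "A \<in> schreier0" "A \<subseteq> F" "covers A F" "\<And>a. a \<in> A \<Longrightarrow> piece A F a \<in> \<G>"
      unfolding conv_def by blast
    show "F \<in> \<G>"
    proof (cases "A = {}")
      case True
      then have "F = {}" using A by (auto simp: covers_def)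
      then show ?thesis using regularD(6)[OF assms] by simp
    next
      case False
      then obtain a where a: "A = {a}" using A(1) by (auto simp: schreier0_def)
      then have "piece A F a = F" using A(3) by (auto simp: piece_def covers_def)
      then show ?thesis using A(4) a by auto
    qed
  qed
qed

text \<open>The class of index 1 has a definition of its own; this identity makes it obey the
  successor rule, so that index 0 is no exception in the inductions to come.\<close>

lemma conv_schreier1_schreier0: "conv schreier1 schreier0 = schreier1"
proof (intro equalityI subsetI)
  fix F assume "F \<in> conv schreier1 schreier0"
  then obtain A where A: "A \<in> schreier1" "A \<subseteq> F" "covers A F"
    "\<And>a. a \<in> A \<Longrightarrow> piece A F a \<in> schreier0" "finite F"
    unfolding conv_def by blast
  have "F \<subseteq> A"
  proof
    fix x assume x: "x \<in> F"
    obtain a where a: "a \<in> A" "x \<in> piece A F a"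
      using in_pieceE[OF finite_subset[OF A(2,5)] A(3) x] by blast
    moreover have "a \<in> piece A F a" using a A(2) in_own_piece by blast
    ultimately have "x = a" using A(4)[OF a(1)] by (auto simp: schreier0_def)
    then show "x \<in> A" using a by simp
  qed
  then show "F \<in> schreier1" using A by (metis subset_antisym)
next
  fix F assume F: "F \<in> schreier1"
  show "F \<in> conv schreier1 schreier0"
  proof (rule convI[of F])
    fix a assume a: "a \<in> F"
    then have "piece F F a = {a}" by (auto simp: piece_def intro: order_antisym)
    moreover have "a \<ge> 1" using regularD(2)[OF regular_schreier1 F] a by (metis less_one linorder_not_less)
    ultimately show "piece F F a \<in> schreier0" by (auto simp: schreier0_def)
  qed (use F in \<open>auto simp: covers_def schreier1_def\<close>)
qed

text \<open>\<open>spreads \<F> \<G>\<close> replaces the inclusion of \<open>\<F>\<close> in \<open>\<G>\<close> up to passing to a subsequence.  Since \<open>\<G>\<close> will be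
  spreading, any faster growing \<open>m\<close> works as well; this makes diagonalisation possible.\<close>

definition spreads :: "nat set set \<Rightarrow> nat set set \<Rightarrow> bool"
  where "spreads \<F> \<G> \<longleftrightarrow> (\<exists>m :: nat \<Rightarrow> nat. strict_mono m \<and> (\<forall>F\<in>\<F>. m ` F \<in> \<G>))"

lemma spreads_trans: "spreads \<F> \<G> \<Longrightarrow> spreads \<G> \<H> \<Longrightarrow> spreads \<F> \<H>"
proof -
  assume "spreads \<F> \<G>" "spreads \<G> \<H>"
  then obtain m k where "strict_mono m" "\<forall>F\<in>\<F>. m ` F \<in> \<G>" "strict_mono k" "\<forall>F\<in>\<G>. k ` F \<in> \<H>"
    unfolding spreads_def by blast
  then have "strict_mono (k \<circ> m)" "\<forall>F\<in>\<F>. (k \<circ> m) ` F \<in> \<H>"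
    by (simp add: strict_mono_o, metis image_comp)
  then show ?thesis unfolding spreads_def by blast
qed

lemma spreads_subset: "\<F> \<subseteq> \<G> \<Longrightarrow> spreads \<F> \<G>"
  unfolding spreads_def by (rule exI[of _ "\<lambda>x. x"]) (auto simp: strict_mono_def)

lemma spreads_conv:
  assumes "regular_family \<F>" "spreads \<G> \<G>'"
  shows "spreads (conv \<F> \<G>) (conv \<F> \<G>')"
proof -
  obtain m where m: "strict_mono m" "\<And>F. F \<in> \<G> \<Longrightarrow> m ` F \<in> \<G>'"
    using assms(2) unfolding spreads_def by blast
  have "strict_mono_on F m" for F using m(1) by (auto simp: strict_mono_on_def strict_mono_def)
  then show ?thesis unfolding spreads_def
    using m strict_mono_imp_increasing[OF m(1)]
    by (intro exI[of _ m]) (auto intro!: conv_spread[of _ \<F> \<G>] regularD(4)[OF assms(1)])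
qed

text \<open>The set \<open>k\<close> F\<open>is a spread of\<close>m \<open>F\<close>, by the map k
  composed with the inverse of m.\<close>

lemma regular_spread_more:
  fixes m :: "nat \<Rightarrow> nat"
  assumes "regular_family \<G>" "m ` F \<in> \<G>" "strict_mono m" "strict_mono k" "\<And>x. x \<in> F \<Longrightarrow> m x \<le> k x"
  shows "k ` F \<in> \<G>"
proof -
  have inv: "inv m (m x) = x" for x by (simp add: assms(3) strict_mono_imp_inj_on)
  have "(k \<circ> inv m) ` (m ` F) \<in> \<G>"
    by (rule regularD(4)[OF assms(1,2)])
      (use assms in \<open>auto simp: strict_mono_on_def inv strict_mono_less\<close>)
  then show ?thesis by (simp add: image_comp o_def inv)
qed

text \<open>A set taken from the n-th family starts at n or later, so one map has to dominate the
  n-th map only from n on. The sum of the first i maps at the argument i does so; the added i makes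
  it strictly increasing.\<close>

lemma spreads_diagonal:
  assumes "regular_family \<G>"
    and "\<And>F. F \<in> \<F> \<Longrightarrow> \<exists>n\<ge>1. F \<in> \<F>' n \<and> (\<forall>x\<in>F. n \<le> x)"
    and "\<And>n::nat. n \<ge> 1 \<Longrightarrow> spreads (\<F>' n) \<G>"
  shows "spreads \<F> \<G>"
proof -
  have "\<forall>n\<in>{1..}. \<exists>m. strict_mono m \<and> (\<forall>F\<in>\<F>' n. m ` F \<in> \<G>)"
  proof
    fix n :: nat assume "n \<in> {1..}"
    then have "1 \<le> n" by simp
    from assms(3)[OF this] show "\<exists>m. strict_mono m \<and> (\<forall>F\<in>\<F>' n. m ` F \<in> \<G>)"
      unfolding spreads_def .
  qed
  from bchoice[OF this] obtain m where "\<forall>n\<in>{1..}. strict_mono (m n) \<and> (\<forall>F\<in>\<F>' n. m n ` F \<in> \<G>)" ..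
  then have m: "strict_mono (m n)" "F \<in> \<F>' n \<Longrightarrow> m n ` F \<in> \<G>" if "n \<ge> 1" for n F
    using that by auto
  define k where "k i = (\<Sum>n=1..i. m n i) + i" for i :: nat
  have mono: "strict_mono k"
  proof (rule strict_mono_Suc_iff[THEN iffD2], rule allI)
    fix i
    have "(\<Sum>n=1..i. m n i) \<le> (\<Sum>n=1..i. m n (Suc i))"
      using m(1) by (intro sum_mono) (auto simp: strict_mono_less_eq)
    also have "\<dots> \<le> (\<Sum>n=1..Suc i. m n (Suc i))" by simp
    finally show "k i < k (Suc i)" unfolding k_def by linarith
  qed
  have "k ` F \<in> \<G>" if "F \<in> \<F>" for F
  proof -
    obtain n where n: "n \<ge> 1" "F \<in> \<F>' n" "\<forall>x\<in>F. n \<le> x" using assms(2)[OF \<open>F \<in> \<F>\<close>] by blast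
    have "m n x \<le> k x" if "x \<in> F" for x
    proof -
      have "m n x \<le> (\<Sum>n=1..x. m n x)"
        by (rule member_le_sum[of n "{1..x}" "\<lambda>n. m n x"]) (use n that in auto)
      then show ?thesis by (simp add: k_def)
    qed
    then show ?thesis using regular_spread_more[OF assms(1) m(2)[OF n(1,2)] m(1)[OF n(1)] mono] by blast
  qed
  with mono show ?thesis unfolding spreads_def by blast
qed

section \<open>Schreier classes of sums and finite multiples\<close>

context
  fixes l :: "cord \<Rightarrow> nat \<Rightarrow> cord"
  assumes ladder: "ladder_system l"
begin

lemma ladder_less: "is_limit c \<Longrightarrow> 1 \<le> n \<Longrightarrow> l c n < c"
  using ladder unfolding ladder_system_def by blast

lemma ladder_cofinal:
  assumes "is_limit c" "a < c"
  obtains n where "1 \<le> n" "a < l c n"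
proof -
  have "a < osup (l c ` {1..})" using ladder assms unfolding ladder_system_def by simp
  then show ?thesis using that by (auto elim: less_osupE)
qed

text \<open>The two facts are intertwined: the successor rule for \<open>conv\<close> uses that
  members are finite, and regularity at a successor uses this rule.\<close>

lemma regular_schreier: "regular_family (schreier l a)"
  and schreier_osucc: "schreier l (osucc a) = conv schreier1 (schreier l a)"
proof -
  have osucc: "schreier l (osucc a) = conv schreier1 (schreier l a)"
    if "regular_family (schreier l a)" for a
  proof (cases "a = 0")
    case True
    then show ?thesis using schreier_rec(2)[of l] schreier_rec(1)[of l] conv_schreier1_schreier0
      by (simp add: one_cord_def)
  next
    case False
    then show ?thesis
      using schreier_rec(3) schreier_conv_eq regularD(1)[OF that] regularD(1)[OF regular_schreier1]
      by metis
  qed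
  have reg: "regular_family (schreier l a)" for a
  proof (induction a rule: cord_induct)
    case zero
    then show ?case by (simp add: schreier_rec regular_schreier0)
  next
    case (succ b)
    then show ?case
      unfolding osucc[OF succ] by (rule regular_conv[OF regular_schreier1])
  next
    case (limit c)
    have reg: "regular_family (schreier l (l c n))" if "n \<ge> 1" for n
      using limit ladder_less that by blast
    show ?case
      unfolding schreier_rec(4)[OF ladder limit(1)] regular_family_def
    proof (intro conjI ballI allI impI)
      fix F assume "F \<in> {F. \<exists>n\<ge>1. F \<in> schreier l (l c n) \<and> (\<forall>m\<in>F. n \<le> m)}"
      then obtain n where n: "n \<ge> 1" "F \<in> schreier l (l c n)" "\<forall>m\<in>F. n \<le> m" by blast
      note r = regularD[OF reg[OF n(1)]]
      show "finite F" "0 \<notin> F" using r n by blast+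
      show "G \<in> {F. \<exists>n\<ge>1. F \<in> schreier l (l c n) \<and> (\<forall>m\<in>F. n \<le> m)}" if "G \<subseteq> F" for G
        using r(3)[OF n(2) that] n that by blast
      show "h ` F \<in> {F. \<exists>n\<ge>1. F \<in> schreier l (l c n) \<and> (\<forall>m\<in>F. n \<le> m)}"
        if "strict_mono_on F h \<and> (\<forall>x\<in>F. x \<le> h x)" for h
        using r(4)[OF n(2), of h] n that by (auto intro!: exI[of _ n] intro: order_trans)
    next
      fix n :: nat assume "1 \<le> n"
      then show "{n} \<in> {F. \<exists>n\<ge>1. F \<in> schreier l (l c n) \<and> (\<forall>m\<in>F. n \<le> m)}"
        using regularD(5)[OF reg[of 1]] by auto
    qed
  qed
  show "regular_family (schreier l a)" by (rule reg)
  show "schreier l (osucc a) = conv schreier1 (schreier l a)" by (rule osucc[OF reg])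
qed

text \<open>A shift by n stays inside a spreading class and pushes every set beyond n, as the limit
  stage demands.\<close>

lemma spreads_ladder:
  assumes "is_limit c" "n \<ge> 1"
  shows "spreads (schreier l (l c n)) (schreier l c)"
  unfolding spreads_def
proof (intro exI[of _ "\<lambda>x. x + n"] conjI ballI)
  fix F assume "F \<in> schreier l (l c n)"
  then have "(\<lambda>x. x + n) ` F \<in> schreier l (l c n)"
    by (rule regularD(4)[OF regular_schreier]) (auto simp: strict_mono_on_def)
  then show "(\<lambda>x. x + n) ` F \<in> schreier l c"
    unfolding schreier_rec(4)[OF ladder assms(1)] using assms(2) by auto
qed (auto simp: strict_mono_def)

text \<open>Inclusion itself can fail at limits, for sets that start too early; the shift along a
  ladder repairs this.\<close>

lemma spreads_schreier_mono: "a \<le> b \<Longrightarrow> spreads (schreier l a) (schreier l b)"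
proof (induction b rule: cord_induct)
  case zero
  then have "a = 0" by (simp add: order_antisym)
  then show ?case by (auto intro: spreads_subset)
next
  case (succ b)
  show ?case
  proof (cases "a \<le> b")
    case True
    have "spreads (schreier l b) (schreier l (osucc b))"
      unfolding schreier_osucc
      by (rule spreads_subset[OF regular_subset_conv[OF regular_schreier1 regular_schreier]])
    then show ?thesis using succ(1)[OF True] spreads_trans by blast
  next
    case False
    then have "a = osucc b" using succ(2) by (metis leI order_antisym osucc_le_iff)
    then show ?thesis by (auto intro: spreads_subset)
  qed
next
  case (limit c)
  show ?case
  proof (cases "a = c")
    case False
    then obtain n where n: "1 \<le> n" "a < l c n" using ladder_cofinal limit(1,3) by (metis order_le_less)
    then show ?thesis using limit(2)[OF ladder_less[OF limit(1) n(1)]] spreads_ladder[OF limit(1) n(1)]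
      by (meson order_less_imp_le spreads_trans)
  qed (auto intro: spreads_subset)
qed

text \<open>The recursion acts on the outer class, hence the inner index is the left summand. At a
  limit a lower bound n of the set of minima is a lower bound of the whole set, since every element
  lies above some minimum; this is what the diagonal argument asks for.\<close>

lemma spreads_conv_add: "spreads (conv (schreier l a) (schreier l b)) (schreier l (b + a))"
proof (induction a rule: cord_induct)
  case zero
  show ?case by (auto simp: schreier_rec conv_schreier0[OF regular_schreier] intro: spreads_subset)
next
  case (succ a)
  have "conv (schreier l (osucc a)) (schreier l b) = conv schreier1 (conv (schreier l a) (schreier l b))"
    unfolding schreier_osucc
    by (rule conv_assoc[symmetric]) (use regularD(1) regular_schreier1 regular_schreier in blast)+
  then show ?case using spreads_conv[OF regular_schreier1 succ] by (simp add: schreier_osucc)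
next
  case (limit c)
  show ?case
  proof (rule spreads_diagonal[where \<F>' = "\<lambda>n. conv (schreier l (l c n)) (schreier l b)"])
    fix F assume "F \<in> conv (schreier l c) (schreier l b)"
    then obtain A where A: "A \<in> schreier l c" "A \<subseteq> F" "covers A F"
      "\<And>a. a \<in> A \<Longrightarrow> piece A F a \<in> schreier l b" "finite F"
      unfolding conv_def by blast
    obtain n where n: "n \<ge> 1" "A \<in> schreier l (l c n)" "\<forall>m\<in>A. n \<le> m"
      using A(1) unfolding schreier_rec(4)[OF ladder limit(1)] by blast
    have "\<forall>x\<in>F. n \<le> x" using n(3) A(3) unfolding covers_def by (meson order_trans)
    then show "\<exists>n\<ge>1. F \<in> conv (schreier l (l c n)) (schreier l b) \<and> (\<forall>x\<in>F. n \<le> x)"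
      using n convI[OF n(2) A(2-5)] by blast
  next
    fix n :: nat assume n: "1 \<le> n"
    have less: "l c n < c" using ladder_less[OF limit(1) n] .
    then have "b + l c n \<le> b + c" by (simp add: cord_add_mono order_less_imp_le)
    then show "spreads (conv (schreier l (l c n)) (schreier l b)) (schreier l (b + c))"
      using limit(2)[OF less] spreads_schreier_mono spreads_trans by blast
  qed (rule regular_schreier)
qed

text \<open>At a limit, rung n of the ladder of \<open>b + c\<close> lies below \<open>b + d\<close>
  for some d < c, hence below \<open>b + l c j\<close> for some j. From there the ladder of c takes
  over, after a shift by j.\<close>

lemma spreads_add_conv: "spreads (schreier l (b + a)) (conv (schreier l a) (schreier l b))"
proof (induction a rule: cord_induct)
  case zero
  show ?case by (auto simp: schreier_rec conv_schreier0[OF regular_schreier] intro: spreads_subset)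
next
  case (succ a)
  have "conv (schreier l (osucc a)) (schreier l b) = conv schreier1 (conv (schreier l a) (schreier l b))"
    unfolding schreier_osucc
    by (rule conv_assoc[symmetric]) (use regularD(1) regular_schreier1 regular_schreier in blast)+
  then show ?case using spreads_conv[OF regular_schreier1 succ] by (simp add: schreier_osucc)
next
  case (limit c)
  show ?case
  proof (rule spreads_diagonal[where \<F>' = "\<lambda>n. schreier l (l (b + c) n)"])
    show "regular_family (conv (schreier l c) (schreier l b))"
      by (intro regular_conv regular_schreier)
    show "\<exists>n\<ge>1. F \<in> schreier l (l (b + c) n) \<and> (\<forall>x\<in>F. n \<le> x)" if "F \<in> schreier l (b + c)" for F
      using that unfolding schreier_rec(4)[OF ladder limit_add[OF limit(1)]] by blast
  next
    fix n :: nat assume n: "1 \<le> n"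
    obtain d where d: "d < c" "l (b + c) n < b + d"
      using ladder_less[OF limit_add[OF limit(1)] n] less_add_limitE[OF limit(1)] by blast
    obtain j where j: "1 \<le> j" "d < l c j" using ladder_cofinal limit(1) d(1) by blast
    have less: "l c j < c" using ladder_less[OF limit(1) j(1)] .
    have "l (b + c) n \<le> b + l c j"
      using d(2) cord_add_mono[OF order_less_imp_le[OF j(2)], of b] by simp
    then have 1: "spreads (schreier l (l (b + c) n)) (conv (schreier l (l c j)) (schreier l b))"
      using limit(2)[OF less] spreads_schreier_mono spreads_trans by blast
    have "spreads (conv (schreier l (l c j)) (schreier l b)) (conv (schreier l c) (schreier l b))"
      unfolding spreads_def
    proof (intro exI[of _ "\<lambda>x. x + j"] conjI ballI)
      fix F assume F: "F \<in> conv (schreier l (l c j)) (schreier l b)"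
      show "(\<lambda>x. x + j) ` F \<in> conv (schreier l c) (schreier l b)"
      proof (rule conv_spread[OF F])
        fix A assume "A \<in> schreier l (l c j)"
        then have "(\<lambda>x. x + j) ` A \<in> schreier l (l c j)"
          by (rule regularD(4)[OF regular_schreier]) (auto simp: strict_mono_on_def)
        then show "(\<lambda>x. x + j) ` A \<in> schreier l c"
          unfolding schreier_rec(4)[OF ladder limit(1)] using j(1) by auto
      qed (auto simp: strict_mono_on_def intro!: regularD(4)[OF regular_schreier])
    qed (auto simp: strict_mono_def)
    then show "spreads (schreier l (l (b + c) n)) (conv (schreier l c) (schreier l b))"
      using 1 spreads_trans by blast
  qed
qed

text \<open>Stands for the class of index \<open>a * ord_of_nat k\<close>, but keeps the nested
  block structure visible, which both the iteration of estimates and the averaging work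
  with.\<close>

definition schreier_power :: "cord \<Rightarrow> nat \<Rightarrow> nat set set"
  where "schreier_power a k = (conv (schreier l a) ^^ k) schreier0"

lemma schreier_power_rec:
  "schreier_power a 0 = schreier0"
  "schreier_power a (Suc k) = conv (schreier l a) (schreier_power a k)"
  by (simp_all add: schreier_power_def)

lemma regular_schreier_power: "regular_family (schreier_power a k)"
  by (induction k) (simp_all add: schreier_power_rec regular_schreier0 regular_conv regular_schreier)

lemma spreads_power_mult: "spreads (schreier_power a k) (schreier l (a * ord_of_nat k))"
proof (induction k)
  case (Suc k)
  then show ?case
    using spreads_trans[OF spreads_conv[OF regular_schreier Suc] spreads_conv_add]
    by (simp add: schreier_power_rec)
qed (auto simp: schreier_power_rec schreier_rec intro: spreads_subset)

lemma spreads_mult_power: "spreads (schreier l (a * ord_of_nat k)) (schreier_power a k)"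
proof (induction k)
  case (Suc k)
  then show ?case
    using spreads_trans[OF spreads_add_conv spreads_conv[OF regular_schreier Suc]]
    by (simp add: schreier_power_rec)
qed (auto simp: schreier_power_rec schreier_rec intro: spreads_subset)

end

section \<open>Lower estimates in terms of coefficients\<close>

text \<open>Position 0 has to be empty: \<open>lin\<close> pairs entry j with
  \<open>x (j - 1)\<close>, and by truncated subtraction the positions 0 and 1 would meet the same
  vector.\<close>

definition fin_coeffs :: "(nat \<Rightarrow> real) set"
  where "fin_coeffs = {c. finite {j. c j \<noteq> 0} \<and> c 0 = 0}"

text \<open>Coefficients are indexed from 1, like supports; hence the predecessor.\<close>

definition lin :: "(nat \<Rightarrow> 'a::real_vector) \<Rightarrow> (nat \<Rightarrow> real) \<Rightarrow> 'a"
  where "lin x c = (\<Sum>j | c j \<noteq> 0. c j *\<^sub>R x (j - 1))"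

definition restr :: "(nat \<Rightarrow> real) \<Rightarrow> nat set \<Rightarrow> nat \<Rightarrow> real"
  where "restr c E = (\<lambda>j. if j \<in> E then c j else 0)"

text \<open>Stated for the sequence and not for its range, so that repeated vectors are excluded
  too.\<close>

definition lin_indep :: "(nat \<Rightarrow> 'a::real_vector) \<Rightarrow> bool"
  where "lin_indep x \<longleftrightarrow> (\<forall>c\<in>fin_coeffs. lin x c = 0 \<longrightarrow> c = (\<lambda>_. 0))"

lemma lin_eq_sum: "finite S \<Longrightarrow> {j. c j \<noteq> 0} \<subseteq> S \<Longrightarrow> lin x c = (\<Sum>j\<in>S. c j *\<^sub>R x (j - 1))"
  unfolding lin_def by (rule sum.mono_neutral_left) auto

lemma lin_zero [simp]: "lin x (\<lambda>_. 0) = 0"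
  by (simp add: lin_def)

lemma fin_coeffs_zero [simp]: "(\<lambda>_. 0) \<in> fin_coeffs"
  by (simp add: fin_coeffs_def)

lemma csupp_Suc:
  assumes "c \<in> fin_coeffs"
  shows "{j. c j \<noteq> 0} = Suc ` {i. c (Suc i) \<noteq> 0}"
proof (rule set_eqI)
  fix j
  show "j \<in> {j. c j \<noteq> 0} \<longleftrightarrow> j \<in> Suc ` {i. c (Suc i) \<noteq> 0}"
    using assms by (cases j) (auto simp: fin_coeffs_def)
qed

lemma fin_coeffs_restr: "c \<in> fin_coeffs \<Longrightarrow> restr c E \<in> fin_coeffs"
  unfolding fin_coeffs_def restr_def by (auto elim: rev_finite_subset)

lemma fin_coeffs_add: "c \<in> fin_coeffs \<Longrightarrow> d \<in> fin_coeffs \<Longrightarrow> (\<lambda>j. c j + d j) \<in> fin_coeffs"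
  unfolding fin_coeffs_def
  by (auto intro: finite_subset[of _ "{j. c j \<noteq> 0} \<union> {j. d j \<noteq> 0}"])

lemma fin_coeffs_scale: "c \<in> fin_coeffs \<Longrightarrow> (\<lambda>j. r * c j) \<in> fin_coeffs"
  unfolding fin_coeffs_def by (auto elim: rev_finite_subset)

lemma fin_coeffs_sum:
  "(\<And>i. i \<in> I \<Longrightarrow> c i \<in> fin_coeffs) \<Longrightarrow> (\<lambda>j. \<Sum>i\<in>I. c i j) \<in> fin_coeffs"
  by (induction I rule: infinite_finite_induct) (auto intro: fin_coeffs_add)

lemma lin_add:
  assumes "c \<in> fin_coeffs" "d \<in> fin_coeffs"
  shows "lin x (\<lambda>j. c j + d j) = lin x c + lin x d"
proof -
  let ?S = "{j. c j \<noteq> 0} \<union> {j. d j \<noteq> 0}"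
  have S: "finite ?S" using assms by (simp add: fin_coeffs_def)
  have "lin x (\<lambda>j. c j + d j) = (\<Sum>j\<in>?S. (c j + d j) *\<^sub>R x (j - 1))"
    by (rule lin_eq_sum[OF S]) auto
  moreover have "lin x c = (\<Sum>j\<in>?S. c j *\<^sub>R x (j - 1))"
    by (rule lin_eq_sum[OF S]) auto
  moreover have "lin x d = (\<Sum>j\<in>?S. d j *\<^sub>R x (j - 1))"
    by (rule lin_eq_sum[OF S]) auto
  ultimately show ?thesis by (simp add: scaleR_left_distrib sum.distrib)
qed

lemma lin_scale: "lin x (\<lambda>j. r * c j) = r *\<^sub>R lin x c"
  by (cases "r = 0") (simp_all add: lin_def scaleR_sum_right)

lemma lin_sum:
  "(\<And>i. i \<in> I \<Longrightarrow> c i \<in> fin_coeffs) \<Longrightarrow> lin x (\<lambda>j. \<Sum>i\<in>I. c i j) = (\<Sum>i\<in>I. lin x (c i))"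
proof (induction I rule: infinite_finite_induct)
  case (insert i I)
  have "lin x (\<lambda>j. c i j + (\<Sum>i\<in>I. c i j)) = lin x (c i) + lin x (\<lambda>j. \<Sum>i\<in>I. c i j)"
    by (intro lin_add fin_coeffs_sum insert(4)) auto
  with insert show ?case by simp
qed simp_all

lemma lin_in_span: "lin x c \<in> span (range x)"
  unfolding lin_def by (intro span_sum span_scale span_base) auto

lemma lin_indep_nonzero: "lin_indep x \<Longrightarrow> c \<in> fin_coeffs \<Longrightarrow> c j \<noteq> 0 \<Longrightarrow> lin x c \<noteq> 0"
  unfolding lin_indep_def by blast

section \<open>Coordinates and supports\<close>

lemma lin_indepD:
  assumes "lin_indep x"
  shows "inj x" "independent (range x)"
proof -
  show "inj x"
  proof (rule injI, rule ccontr)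
    fix i j assume eq: "x i = x j" and "i \<noteq> j"
    let ?c = "\<lambda>n. if n = Suc i then 1 else if n = Suc j then - 1 else 0 :: real"
    have "?c \<in> fin_coeffs" unfolding fin_coeffs_def
      by (auto intro: finite_subset[of _ "{Suc i, Suc j}"])
    moreover have "lin x ?c = (\<Sum>n\<in>{Suc i, Suc j}. ?c n *\<^sub>R x (n - 1))"
      by (rule lin_eq_sum) auto
    then have "lin x ?c = 0" using eq \<open>i \<noteq> j\<close> by simp
    ultimately show False using lin_indep_nonzero[OF assms, of ?c "Suc i"] by simp
  qed
  then have "y = x (inv x y)" if "y \<in> range x" for y using that by (simp add: f_inv_into_f)
  show "independent (range x)"
    unfolding independent_explicit_module
  proof (intro allI impI)
    fix t u v assume t: "finite t" "t \<subseteq> range x" "(\<Sum>v\<in>t. u v *\<^sub>R v) = 0" "v \<in> t"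
    define c where "c j = (if j \<in> Suc ` inv x ` t then u (x (j - 1)) else 0)" for j
    have inj: "inj_on (Suc \<circ> inv x) t"
      using t(2) by (intro comp_inj_on inj_on_inv_into) auto
    have c: "c \<in> fin_coeffs" unfolding fin_coeffs_def c_def using t(1)
      by (auto intro: finite_subset[of _ "Suc ` inv x ` t"])
    have "lin x c = (\<Sum>j\<in>Suc ` inv x ` t. c j *\<^sub>R x (j - 1))"
      by (rule lin_eq_sum) (use t(1) in \<open>auto simp: c_def\<close>)
    also have "\<dots> = (\<Sum>v\<in>t. u v *\<^sub>R v)"
      unfolding image_comp sum.reindex[OF inj]
      by (rule sum.cong) (use t(2) in \<open>auto simp: c_def f_inv_into_f subset_iff\<close>)
    finally have "lin x c = 0" using t(3) by simp
    then have "c (Suc (inv x v)) = 0" using assms c unfolding lin_indep_def by metis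
    then show "u v = 0" using t(2,4) by (auto simp: c_def f_inv_into_f subset_iff)
  qed
qed

lemma representation_lin:
  assumes "lin_indep x" "c \<in> fin_coeffs"
  shows "representation (range x) (lin x c) (x i) = c (Suc i)"
proof -
  note ind = lin_indepD[OF assms(1)]
  have fin: "finite {j. c j \<noteq> 0}" and c0: "c 0 = 0" using assms(2) by (auto simp: fin_coeffs_def)
  have "representation (range x) (lin x c) (x i)
      = (\<Sum>j | c j \<noteq> 0. representation (range x) (c j *\<^sub>R x (j - 1)) (x i))"
    unfolding lin_def by (subst representation_sum[OF ind(2)]) (auto intro: span_scale span_base)
  also have "\<dots> = (\<Sum>j | c j \<noteq> 0. if j = Suc i then c (Suc i) else 0)"
  proof (rule sum.cong[OF refl])
    fix j assume "j \<in> {j. c j \<noteq> 0}"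
    then obtain k where "j = Suc k" using c0 by (cases j) auto
    then show "representation (range x) (c j *\<^sub>R x (j - 1)) (x i) = (if j = Suc i then c (Suc i) else 0)"
      using ind by (auto simp: representation_scale representation_basis span_base inj_eq)
  qed
  also have "\<dots> = c (Suc i)" using fin by (simp add: sum.delta)
  finally show ?thesis .
qed

lemma supp_lin: "lin_indep x \<Longrightarrow> c \<in> fin_coeffs \<Longrightarrow> supp x (lin x c) = {j. c j \<noteq> 0}"
  unfolding supp_def by (auto simp: representation_lin csupp_Suc)

definition coeffs :: "(nat \<Rightarrow> 'a::real_vector) \<Rightarrow> 'a \<Rightarrow> nat \<Rightarrow> real"
  where "coeffs x v j = (if j = 0 then 0 else representation (range x) v (x (j - 1)))"

lemma coeffs_lin: "lin_indep x \<Longrightarrow> c \<in> fin_coeffs \<Longrightarrow> coeffs x (lin x c) = c"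
  by (rule ext) (auto simp: coeffs_def representation_lin fin_coeffs_def)

lemma span_eq_lin:
  assumes "lin_indep x" "v \<in> span (range x)"
  shows "coeffs x v \<in> fin_coeffs" "lin x (coeffs x v) = v"
proof -
  have "\<exists>c\<in>fin_coeffs. v = lin x c"
    using assms(2)
  proof (induction rule: span_induct_alt)
    case base
    show ?case by (rule bexI[of _ "\<lambda>_. 0"]) auto
  next
    case (step r y z)
    then obtain i c where i: "y = x i" "c \<in> fin_coeffs" "z = lin x c" by blast
    let ?d = "\<lambda>j. if j = Suc i then 1 else 0 :: real"
    have d: "?d \<in> fin_coeffs" by (auto simp: fin_coeffs_def)
    have "lin x ?d = x i" by (subst lin_eq_sum[of "{Suc i}"]) auto
    then have "r *\<^sub>R y + z = lin x (\<lambda>j. r * ?d j + c j)"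
      using i d by (subst lin_add) (auto simp: lin_scale intro: fin_coeffs_scale[OF d, of r])
    moreover have "(\<lambda>j. r * ?d j + c j) \<in> fin_coeffs"
      using i d fin_coeffs_add fin_coeffs_scale by blast
    ultimately show ?case by blast
  qed
  then obtain c where "c \<in> fin_coeffs" "v = lin x c" by blast
  then show "coeffs x v \<in> fin_coeffs" "lin x (coeffs x v) = v"
    using coeffs_lin[OF assms(1)] by auto
qed

lemma supp_eq_coeffs: "lin_indep x \<Longrightarrow> v \<in> span (range x) \<Longrightarrow> supp x v = {j. coeffs x v j \<noteq> 0}"
  using supp_lin[of x "coeffs x v"] span_eq_lin[of x v] by simp

text \<open>A vanishing finite combination is an expansion of 0, and so is the zero sequence;
  uniqueness identifies them.\<close>

lemma schauder_lin_indep: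
  assumes "schauder_basis e"
  shows "lin_indep e"
  unfolding lin_indep_def
proof (intro ballI impI)
  fix c assume c: "c \<in> fin_coeffs" "lin e c = 0"
  let ?b = "\<lambda>i. c (Suc i)"
  have eq: "{j. c j \<noteq> 0} = Suc ` {i. ?b i \<noteq> 0}"
    using csupp_Suc[OF c(1)] .
  then have "finite {i. ?b i \<noteq> 0}"
    using c(1) finite_imageD[of Suc "{i. ?b i \<noteq> 0}"] by (simp add: fin_coeffs_def)
  then have "(\<lambda>i. ?b i *\<^sub>R e i) sums (\<Sum>i | ?b i \<noteq> 0. ?b i *\<^sub>R e i)"
    by (intro sums_finite) auto
  also have "(\<Sum>i | ?b i \<noteq> 0. ?b i *\<^sub>R e i) = lin e c"
    unfolding lin_def eq by (subst sum.reindex) auto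
  finally have "(\<lambda>i. ?b i *\<^sub>R e i) sums 0" using c(2) by simp
  moreover have "(\<lambda>i. (0::real) *\<^sub>R e i) sums 0" by simp
  moreover have "\<exists>!b. (\<lambda>i. b i *\<^sub>R e i) sums 0"
    using assms unfolding schauder_basis_def by (rule spec)
  then obtain b where b: "\<And>d. (\<lambda>i. d i *\<^sub>R e i) sums 0 \<Longrightarrow> d = b" by (elim ex1E) metis
  ultimately have "?b = (\<lambda>_. 0)" using b[of ?b] b[of "\<lambda>_. 0"] by simp
  then have "c j = 0" for j
    using c(1) by (cases j) (auto simp: fin_coeffs_def dest: fun_cong)
  then show "c = (\<lambda>_. 0)" by auto
qed

lemma finite_supp: "lin_indep x \<Longrightarrow> v \<in> span (range x) \<Longrightarrow> finite (supp x v)"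
  using supp_eq_coeffs span_eq_lin(1) by (fastforce simp: fin_coeffs_def)

lemma supp_nonempty:
  assumes "lin_indep x" "v \<in> span (range x)" "v \<noteq> 0"
  shows "supp x v \<noteq> {}"
proof
  assume "supp x v = {}"
  then have "coeffs x v = (\<lambda>_. 0)" using supp_eq_coeffs[OF assms(1,2)] by auto
  then have "lin x (coeffs x v) = 0" by simp
  then show False using assms span_eq_lin(2) by metis
qed

lemma zero_notin_supp: "0 \<notin> supp x v"
  by (auto simp: supp_def)

lemma set_lessD: "set_less F G \<Longrightarrow> finite F \<Longrightarrow> finite G \<Longrightarrow> x \<in> F \<Longrightarrow> y \<in> G \<Longrightarrow> x < y"
  unfolding set_less_def by (metis Max_ge Min_le empty_iff order.strict_trans1 order.strict_trans2)

lemma set_lessI: "finite F \<Longrightarrow> finite G \<Longrightarrow> (\<And>x y. x \<in> F \<Longrightarrow> y \<in> G \<Longrightarrow> x < y) \<Longrightarrow> set_less F G"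
  unfolding set_less_def by (metis Max_in Min_in)

section \<open>Linear combinations of block bases\<close>

lemma coeffs_linear_comb:
  assumes e: "lin_indep e" and x: "\<And>i. x i \<in> span (range e)" and c: "c \<in> fin_coeffs"
  shows "coeffs e (lin x c) = (\<lambda>k. \<Sum>j | c j \<noteq> 0. c j * coeffs e (x (j - 1)) k)" (is "_ = ?d")
proof -
  have fin: "(\<lambda>k. c j * coeffs e (x (j - 1)) k) \<in> fin_coeffs" for j
    by (intro fin_coeffs_scale span_eq_lin(1)[OF e x])
  then have d: "?d \<in> fin_coeffs" by (rule fin_coeffs_sum)
  have "lin e ?d = (\<Sum>j | c j \<noteq> 0. lin e (\<lambda>k. c j * coeffs e (x (j - 1)) k))"
    by (rule lin_sum[OF fin])
  also have "\<dots> = lin x c"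
    unfolding lin_scale lin_def[of x] using span_eq_lin(2)[OF e x] by simp
  finally show ?thesis using coeffs_lin[OF e d] by simp
qed

lemma block_supp_less:
  assumes "lin_indep e" "block_basis UNIV e x" "i < j" "k \<in> supp e (x i)" "m \<in> supp e (x j)"
  shows "k < m"
proof -
  have "x i \<in> span (range e)" "x j \<in> span (range e)" "set_less (supp e (x i)) (supp e (x j))"
    using assms(2,3) unfolding block_basis_def by auto
  then show ?thesis using set_lessD finite_supp[OF assms(1)] assms(4,5) by blast
qed

text \<open>The supports of distinct block vectors are disjoint, so at each coordinate at most one
  summand is nonzero and nothing cancels.\<close>

lemma supp_block_lin:
  assumes "lin_indep e" "block_basis UNIV e x" "c \<in> fin_coeffs"
  shows "supp e (lin x c) = (\<Union>j\<in>{j. c j \<noteq> 0}. supp e (x (j - 1)))"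
proof -
  have x: "x i \<in> span (range e)" for i using assms(2) by (auto simp: block_basis_def)
  have "lin x c \<in> span (range e)" unfolding lin_def by (intro span_sum span_scale x)
  then have s: "supp e (lin x c) = {k. (\<Sum>j | c j \<noteq> 0. c j * coeffs e (x (j - 1)) k) \<noteq> 0}"
    using supp_eq_coeffs[OF assms(1)] coeffs_linear_comb[OF assms(1) x assms(3)] by simp
  have sx: "supp e (x i) = {k. coeffs e (x i) k \<noteq> 0}" for i by (rule supp_eq_coeffs[OF assms(1) x])
  have fin: "finite {j. c j \<noteq> 0}" "c 0 = 0" using assms(3) by (auto simp: fin_coeffs_def)
  have "(\<Sum>j | c j \<noteq> 0. c j * coeffs e (x (j - 1)) k) = c i * coeffs e (x (i - 1)) k"
    if i: "c i \<noteq> 0" "k \<in> supp e (x (i - 1))" for i k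
  proof -
    have "coeffs e (x (j - 1)) k = 0" if "c j \<noteq> 0" "j \<noteq> i" for j
    proof -
      \<comment> \<open>Position 0 carries no coefficient, hence distinct positions remain distinct
        after subtracting 1.\<close>
      have "j \<noteq> 0" "i \<noteq> 0" using that i fin(2) by metis+
      then have "j - 1 \<noteq> i - 1" using that(2) by simp
      then have "k \<notin> supp e (x (j - 1))"
        using i(2) block_supp_less[OF assms(1,2)] by (metis less_irrefl linorder_neqE_nat)
      then show ?thesis using sx by simp
    qed
    then have "(\<Sum>j | c j \<noteq> 0. c j * coeffs e (x (j - 1)) k)
        = (\<Sum>j\<in>{i}. c j * coeffs e (x (j - 1)) k)"
      by (intro sum.mono_neutral_right) (use fin i in auto)
    then show ?thesis by simp
  qed
  then have "k \<in> supp e (lin x c)" if "c i \<noteq> 0" "k \<in> supp e (x (i - 1))" for i k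
    using that s sx by auto
  moreover have "\<exists>i. c i \<noteq> 0 \<and> k \<in> supp e (x (i - 1))" if "k \<in> supp e (lin x c)" for k
  proof (rule ccontr)
    assume "\<not> ?thesis"
    then have "(\<Sum>j | c j \<noteq> 0. c j * coeffs e (x (j - 1)) k) = 0"
      using sx by (intro sum.neutral) auto
    then show False using that s by simp
  qed
  ultimately show ?thesis by blast
qed

lemma block_lin_indep:
  assumes "lin_indep e" "block_basis UNIV e x"
  shows "lin_indep x"
  unfolding lin_indep_def
proof (intro ballI impI)
  fix c assume c: "c \<in> fin_coeffs" "lin x c = 0"
  have "supp e (lin x c) = {}"
    using supp_eq_coeffs[OF assms(1), of 0] coeffs_lin[OF assms(1), of "\<lambda>_. 0"] c(2) span_zero by auto
  moreover have "supp e (x i) \<noteq> {}" for i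
    using supp_nonempty[OF assms(1)] assms(2) by (auto simp: block_basis_def)
  ultimately have "c j = 0" for j using supp_block_lin[OF assms c(1)] by fastforce
  then show "c = (\<lambda>_. 0)" by auto
qed

lemma block_subsequence:
  assumes "block_basis UNIV e x" "strict_mono k"
  shows "block_basis UNIV e (\<lambda>i. x (k i))"
  using assms unfolding block_basis_def by (auto simp: strict_mono_def)

lemma equivalent_normD:
  assumes "equivalent_norm N"
  shows "N (x + y) \<le> N x + N y" "N (r *\<^sub>R x) = \<bar>r\<bar> * N x" "N 0 = 0" "0 \<le> N x" "x \<noteq> 0 \<Longrightarrow> 0 < N x"
proof -
  show "N (x + y) \<le> N x + N y" and sc: "\<And>r x. N (r *\<^sub>R x) = \<bar>r\<bar> * N x"
    using assms unfolding equivalent_norm_def by blast+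
  show "N 0 = 0" using sc[of 0 0] by simp
  obtain c where c: "c > 0" "\<And>x. c * norm x \<le> N x"
    using assms unfolding equivalent_norm_def by blast
  have "0 \<le> c * norm x" using c(1) by simp
  then show "0 \<le> N x" using c(2)[of x] by linarith
  show "0 < N x" if "x \<noteq> 0"
  proof -
    have "0 < c * norm x" using c(1) that by simp
    then show ?thesis using c(2)[of x] by linarith
  qed
qed

text \<open>An admissible sequence is encoded by the coefficients c of its sum and a set A at which
  c is cut. Elements of A may carry no coefficient and pieces may vanish, so A serves for every c
  that it covers.\<close>

definition lower_est :: "nat set set \<Rightarrow> (nat \<Rightarrow> 'a::real_vector) \<Rightarrow> ('a \<Rightarrow> real) \<Rightarrow> real \<Rightarrow> bool"
  where "lower_est \<F> x N d \<longleftrightarrow> (\<forall>A\<in>\<F>. \<forall>c\<in>fin_coeffs. covers A {j. c j \<noteq> 0} \<longrightarrow>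
    d * (\<Sum>a\<in>A. N (lin x (restr c (piece A UNIV a)))) \<le> N (lin x c))"

lemma lower_estD:
  "lower_est \<F> x N d \<Longrightarrow> A \<in> \<F> \<Longrightarrow> c \<in> fin_coeffs \<Longrightarrow> covers A {j. c j \<noteq> 0} \<Longrightarrow>
    d * (\<Sum>a\<in>A. N (lin x (restr c (piece A UNIV a)))) \<le> N (lin x c)"
  unfolding lower_est_def by blast

lemma sum_restr_pieces:
  assumes "finite A" "covers A {j. c j \<noteq> 0}"
  shows "c = (\<lambda>j. \<Sum>a\<in>A. restr c (piece A UNIV a) j)"
proof
  fix j
  show "c j = (\<Sum>a\<in>A. restr c (piece A UNIV a) j)"
  proof (cases "c j = 0")
    case True
    then show ?thesis by (simp add: restr_def cong: if_cong)
  next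
    case False
    then obtain a where a: "a \<in> A" "j \<in> piece A {j. c j \<noteq> 0} a" using in_pieceE[OF assms, of j] by blast
    then have j: "j \<in> piece A UNIV a" unfolding piece_def by blast
    then have "j \<in> piece A UNIV b \<longleftrightarrow> b = a" if "b \<in> A" for b
      using in_piece_unique[OF a(1) that j] by blast
    then have "(\<Sum>a\<in>A. restr c (piece A UNIV a) j) = (\<Sum>b\<in>A. if b = a then c j else 0)"
      by (intro sum.cong) (simp_all add: restr_def)
    then show ?thesis using a(1) assms(1) by simp
  qed
qed

text \<open>Empty pieces of \<open>c\<close> vanish, and shrinking a piece to its support only moves its minimum to the right.\<close>

lemma delta_bound_imp_lower_est:
  assumes x: "lin_indep x" and reg: "regular_family (schreier l a)" and N0: "N 0 = 0"
    and adm: "\<And>k y. admissible l a x k y \<Longrightarrow> d * (\<Sum>i<k. N (y i)) \<le> N (\<Sum>i<k. y i)"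
  shows "lower_est (schreier l a) x N d"
  unfolding lower_est_def
proof (intro ballI impI)
  fix A c assume A: "A \<in> schreier l a" and c: "c \<in> fin_coeffs" and cov: "covers A {j. c j \<noteq> 0}"
  define T where "T b = {j. c j \<noteq> 0} \<inter> piece A UNIV b" for b
  define A0 where "A0 = {b\<in>A. T b \<noteq> {}}"
  define h where "h b = Min (T b)" for b
  have finA: "finite A" using regularD(1)[OF reg A] .
  have finT: "finite (T b)" for b using c by (auto simp: T_def fin_coeffs_def)
  have A0: "b \<in> A" and T0: "T b \<noteq> {}" if "b \<in> A0" for b using that by (auto simp: A0_def)
  have hT: "h b \<in> T b" if "b \<in> A0" for b unfolding h_def using finT T0[OF that] by simp
  have Tless: "i < j" if "b \<in> A0" "b' \<in> A0" "b < b'" "i \<in> T b" "j \<in> T b'" for b b' i j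
  proof (rule ccontr)
    assume "\<not> i < j"
    moreover have "b' \<le> j" "b' \<in> A" using that A0[OF that(2)] unfolding T_def piece_def by auto
    ultimately have "b' \<le> b" using that(4) unfolding T_def piece_def by auto
    then show False using that(3) by simp
  qed
  have mono: "strict_mono_on A0 h"
    by (rule strict_mono_onI) (rule Tless, assumption+, (rule hT, assumption)+)
  have "finite A0" using finA unfolding A0_def by simp
  then obtain s where s: "strict_mono_on {..<card A0} s" "s ` {..<card A0} = A0"
    using strict_sorted_enum by blast
  let ?c = "\<lambda>b. restr c (piece A UNIV b)"
  let ?y = "\<lambda>i. lin x (?c (s i))"
  have fc: "?c b \<in> fin_coeffs" for b using fin_coeffs_restr[OF c] .
  have su: "supp x (lin x (?c b)) = T b" for b
    unfolding supp_lin[OF x fc] by (auto simp: T_def restr_def)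
  have si: "s i \<in> A0" if "i < card A0" for i using s(2) that by blast
  have "block_basis {..<card A0} x ?y"
    unfolding block_basis_def su
  proof (intro conjI ballI impI)
    fix i assume i: "i \<in> {..<card A0}"
    show "?y i \<in> span (range x)" by (rule lin_in_span)
    obtain j where "j \<in> T (s i)" using T0 si i by blast
    then have "?c (s i) j \<noteq> 0" by (simp add: T_def restr_def)
    then show "?y i \<noteq> 0" using lin_indep_nonzero[OF x fc] by blast
    fix j assume j: "j \<in> {..<card A0}" "i < j"
    have "s i < s j" by (rule strict_mono_onD[OF s(1) i j])
    moreover have "s i \<in> A0" "s j \<in> A0" using si i j(1) by simp_all
    ultimately show "set_less (T (s i)) (T (s j))"
      by (intro set_lessI[OF finT finT]) (rule Tless)
  qed
  moreover have "(\<lambda>i. Min (supp x (?y i))) ` {..<card A0} \<in> schreier l a"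
  proof -
    have "(\<lambda>i. Min (supp x (?y i))) ` {..<card A0} = h ` s ` {..<card A0}"
      unfolding su h_def image_image by (rule refl)
    then have "(\<lambda>i. Min (supp x (?y i))) ` {..<card A0} = h ` A0" unfolding s(2) .
    moreover have "A0 \<in> schreier l a" using regularD(3)[OF reg A] A0_def by auto
    then have "h ` A0 \<in> schreier l a"
      by (rule regularD(4)[OF reg _ mono]) (use hT in \<open>simp add: T_def piece_def\<close>)
    ultimately show ?thesis by simp
  qed
  ultimately have "admissible l a x (card A0) ?y" unfolding admissible_def by blast
  then have bound: "d * (\<Sum>i<card A0. N (?y i)) \<le> N (\<Sum>i<card A0. ?y i)" by (rule adm)
  have inj: "inj_on s {..<card A0}" using s(1) by (rule strict_mono_on_imp_inj_on)
  have zero: "lin x (?c b) = 0" if "b \<in> A - A0" for b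
  proof -
    have "?c b = (\<lambda>_. 0)"
    proof
      fix j
      have "j \<notin> T b" using that unfolding A0_def by blast
      then show "?c b j = 0" by (auto simp: T_def restr_def)
    qed
    then show ?thesis by simp
  qed
  have re: "(\<Sum>i<card A0. g (lin x (?c (s i)))) = (\<Sum>b\<in>A. g (lin x (?c b)))"
    if "g 0 = 0" for g :: "'a \<Rightarrow> 'b::comm_monoid_add"
  proof -
    have "(\<Sum>i<card A0. g (lin x (?c (s i)))) = (\<Sum>b\<in>A0. g (lin x (?c b)))"
      using sum.reindex[OF inj, of "\<lambda>b. g (lin x (?c b))"] s(2) by simp
    also have "\<dots> = (\<Sum>b\<in>A. g (lin x (?c b)))"
      by (rule sum.mono_neutral_left) (use finA A0_def zero that in auto)
    finally show ?thesis .
  qed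
  have "(\<Sum>i<card A0. ?y i) = (\<Sum>b\<in>A. lin x (?c b))"
    using re[of "\<lambda>v. v"] by simp
  also have "\<dots> = lin x c"
    using lin_sum[of A ?c x] fc sum_restr_pieces[OF finA cov] by simp
  finally show "d * (\<Sum>b\<in>A. N (lin x (?c b))) \<le> N (lin x c)"
    using bound re[of N] N0 by simp
qed

text \<open>Let A consist of the minima of the supports. As the supports are successive, cutting the
  sum at A gives back the single vectors.\<close>

lemma lower_est_imp_delta_bound:
  assumes x: "lin_indep x" and lower_est: "lower_est (schreier l a) x N d" and adm: "admissible l a x k y"
  shows "d * (\<Sum>i<k. N (y i)) \<le> N (\<Sum>i<k. y i)"
proof -
  let ?c = "\<lambda>i. coeffs x (y i)"
  let ?S = "\<lambda>i. supp x (y i)"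
  define A where "A = (\<lambda>i. Min (?S i)) ` {..<k}"
  have sp: "y i \<in> span (range x)" "y i \<noteq> 0" if "i < k" for i
    using adm that by (auto simp: admissible_def block_basis_def)
  have sl: "set_less (?S i) (?S j)" if "i < j" "j < k" for i j
    using adm that by (auto simp: admissible_def block_basis_def)
  have fin: "finite (?S i)" if "i < k" for i using finite_supp[OF x sp(1)[OF that]] .
  have ne: "?S i \<noteq> {}" if "i < k" for i using supp_nonempty[OF x sp[OF that]] .
  have Sless: "p < q" if "i < j" "j < k" "p \<in> ?S i" "q \<in> ?S j" for i j p q
    using set_lessD[OF sl[OF that(1,2)]] fin that by simp
  have mn: "Min (?S i) \<in> ?S i" "p \<in> ?S i \<Longrightarrow> Min (?S i) \<le> p" if "i < k" for i p
    using fin ne that by auto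
  have c: "?c i \<in> fin_coeffs" "lin x (?c i) = y i" "?S i = {j. ?c i j \<noteq> 0}" if "i < k" for i
    using span_eq_lin[OF x sp(1)] supp_eq_coeffs[OF x sp(1)] that by auto
  define C where "C j = (\<Sum>i<k. ?c i j)" for j
  have Cf: "C \<in> fin_coeffs" unfolding C_def by (rule fin_coeffs_sum) (use c in auto)
  have linC: "lin x C = (\<Sum>i<k. y i)"
    unfolding C_def by (subst lin_sum) (use c in auto)
  have C_eq: "C j = ?c i j" if "i < k" "j \<in> ?S i" for i j
  proof -
    have "?c i' j = 0" if "i' < k" "i' \<noteq> i" for i'
    proof -
      have "j \<notin> ?S i'" using Sless[of i i' j j] Sless[of i' i j j] that \<open>i < k\<close> \<open>j \<in> ?S i\<close>
        by (metis less_irrefl linorder_neqE_nat)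
      then show ?thesis using c(3) that by simp
    qed
    then have "C j = (\<Sum>i\<in>{i}. ?c i j)"
      unfolding C_def by (intro sum.mono_neutral_right) (use that in auto)
    then show ?thesis by simp
  qed
  have C_supp: "\<exists>i<k. j \<in> ?S i" if "C j \<noteq> 0" for j
    using that c(3) unfolding C_def by (metis (mono_tags, lifting) lessThan_iff mem_Collect_eq sum.neutral)
  have A: "A \<in> schreier l a" using adm unfolding A_def admissible_def by blast
  have cov: "covers A {j. C j \<noteq> 0}"
    unfolding covers_def A_def using C_supp mn(2) by blast
  have restr: "restr C (piece A UNIV (Min (?S i))) = ?c i" if i: "i < k" for i
  proof
    fix j
    show "restr C (piece A UNIV (Min (?S i))) j = ?c i j"
    proof (cases "j \<in> ?S i")
      case True
      have "Min (?S m) \<le> Min (?S i)" if m: "m < k" "Min (?S m) \<le> j" for m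
      proof -
        have "\<not> i < m" using Sless[OF _ m(1) True mn(1)[OF m(1)]] m(2) by auto
        then show ?thesis using Sless[OF _ i mn(1)[OF m(1)] mn(1)[OF i]] by (cases "m = i") auto
      qed
      then have "j \<in> piece A UNIV (Min (?S i))" using mn(2)[OF i True] by (auto simp: piece_def A_def)
      then show ?thesis using C_eq[OF i True] by (simp add: restr_def)
    next
      case False
      have "C j = 0" if j: "j \<in> piece A UNIV (Min (?S i))"
      proof (rule ccontr)
        assume "C j \<noteq> 0"
        then obtain m where m: "m < k" "j \<in> ?S m" using C_supp by blast
        have "m \<noteq> i" using m False by blast
        moreover have "Min (?S m) \<le> Min (?S i)" using j mn(2)[OF m] m by (auto simp: piece_def A_def)
        then have "\<not> i < m" using Sless[OF _ m(1) mn(1)[OF i] mn(1)[OF m(1)]] by auto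
        moreover have "\<not> m < i" using Sless[OF _ i m(2) mn(1)[OF i]] j by (auto simp: piece_def)
        ultimately show False by linarith
      qed
      then show ?thesis using False c(3)[OF i] by (simp add: restr_def)
    qed
  qed
  have inj: "inj_on (\<lambda>i. Min (?S i)) {..<k}"
  proof (rule linorder_inj_onI)
    fix i j assume "i < j" "i \<in> {..<k}" "j \<in> {..<k}"
    then show "Min (?S i) \<noteq> Min (?S j)" using Sless[of i j "Min (?S i)" "Min (?S j)"] mn(1) by auto
  qed auto
  have "(\<Sum>b\<in>A. N (lin x (restr C (piece A UNIV b)))) = (\<Sum>i<k. N (y i))"
    unfolding A_def sum.reindex[OF inj] by (rule sum.cong) (use restr c(2) in \<open>auto simp: A_def\<close>)
  then show ?thesis using lower_estD[OF lower_est A Cf cov] linC by simp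
qed

lemma restr_restr: "restr (restr c E) F = restr c (E \<inter> F)"
  by (auto simp: restr_def)

lemma restr_cong: "(\<And>j. c j \<noteq> 0 \<Longrightarrow> j \<in> E \<longleftrightarrow> j \<in> F) \<Longrightarrow> restr c E = restr c F"
  unfolding restr_def by (rule ext) metis

lemma restr_id: "(\<And>j. c j \<noteq> 0 \<Longrightarrow> j \<in> E) \<Longrightarrow> restr c E = c"
  unfolding restr_def by (rule ext) metis

lemma piece_piece:
  assumes "A \<subseteq> B" "a \<in> A" "b \<in> piece A B a"
  shows "piece A UNIV a \<inter> piece (piece A B a) UNIV b = piece B UNIV b"
proof (intro equalityI subsetI)
  fix j assume j: "j \<in> piece A UNIV a \<inter> piece (piece A B a) UNIV b"
  have "c \<le> b" if c: "c \<in> B" "c \<le> j" for c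
  proof (cases "a \<le> c")
    case True
    have "\<forall>a'\<in>A. a' \<le> c \<longrightarrow> a' \<le> a" using j c(2) by (auto simp: piece_def)
    then have "c \<in> piece A B a" using True c(1) by (simp add: piece_def)
    then show ?thesis using j c(2) by (simp add: piece_def)
  next
    case False
    then show ?thesis using assms(3) by (auto simp: piece_def)
  qed
  then show "j \<in> piece B UNIV b" using j by (simp add: piece_def)
next
  fix j assume j: "j \<in> piece B UNIV b"
  have "a' \<le> a" if "a' \<in> A" "a' \<le> j" for a'
  proof -
    have "a' \<le> b" using j that assms(1) by (auto simp: piece_def)
    then show ?thesis using assms(3) that by (auto simp: piece_def)
  qed
  moreover have "a \<le> j" using j assms(3) by (auto simp: piece_def)
  moreover have "\<forall>c\<in>piece A B a. c \<le> j \<longrightarrow> c \<le> b" using j by (auto simp: piece_def)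
  ultimately show "j \<in> piece A UNIV a \<inter> piece (piece A B a) UNIV b"
    using j by (simp add: piece_def)
qed

text \<open>The outer estimate is applied to the cut at A, the inner one to each piece; by
  \<open>piece_piece\<close>, cutting the pieces again produces exactly the pieces of B.\<close>

lemma lower_est_conv:
  assumes "lower_est \<F> x N d" "lower_est \<G> x N d'" "0 \<le> d"
  shows "lower_est (conv \<F> \<G>) x N (d * d')"
  unfolding lower_est_def
proof (intro ballI impI)
  fix B c assume "B \<in> conv \<F> \<G>" and c: "c \<in> fin_coeffs" and cov: "covers B {j. c j \<noteq> 0}"
  then obtain A where A: "A \<in> \<F>" "A \<subseteq> B" "covers A B"
    "\<And>a. a \<in> A \<Longrightarrow> piece A B a \<in> \<G>" "finite B" unfolding conv_def by blast
  let ?c = "\<lambda>a. restr c (piece A UNIV a)"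
  let ?n = "\<lambda>b. N (lin x (restr c (piece B UNIV b)))"
  have finA: "finite A" using A finite_subset by blast
  have covA: "covers A {j. c j \<noteq> 0}" using cov A(3) unfolding covers_def by (meson order_trans)
  have each: "d' * (\<Sum>b\<in>piece A B a. ?n b) \<le> N (lin x (?c a))" if a: "a \<in> A" for a
  proof -
    have "a \<in> piece A B a" using in_own_piece a A(2) by blast
    then have "covers (piece A B a) {j. ?c a j \<noteq> 0}"
      unfolding covers_def by (auto simp: restr_def piece_def split: if_splits)
    then have "d' * (\<Sum>b\<in>piece A B a. N (lin x (restr (?c a) (piece (piece A B a) UNIV b)))) \<le> N (lin x (?c a))"
      by (intro lower_estD[OF assms(2) A(4)[OF a] fin_coeffs_restr[OF c]])
    moreover have "restr (?c a) (piece (piece A B a) UNIV b) = restr c (piece B UNIV b)"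
      if "b \<in> piece A B a" for b
      using piece_piece[OF A(2) a that] by (simp add: restr_restr)
    ultimately show ?thesis by simp
  qed
  have B: "B = (\<Union>a\<in>A. piece A B a)"
  proof (intro equalityI subsetI)
    fix b assume "b \<in> B"
    then obtain a where "a \<in> A" "b \<in> piece A B a" using in_pieceE[OF finA A(3)] by blast
    then show "b \<in> (\<Union>a\<in>A. piece A B a)" by blast
  qed (auto simp: piece_def)
  have "(\<Sum>b\<in>B. ?n b) = (\<Sum>b\<in>(\<Union>a\<in>A. piece A B a). ?n b)" using B by simp
  also have "\<dots> = (\<Sum>a\<in>A. \<Sum>b\<in>piece A B a. ?n b)"
  proof (rule sum.UNION_disjoint[OF finA])
    show "\<forall>a\<in>A. finite (piece A B a)" using A(5) by (simp add: piece_def)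
    show "\<forall>a\<in>A. \<forall>b\<in>A. a \<noteq> b \<longrightarrow> piece A B a \<inter> piece A B b = {}"
      using in_piece_unique by blast
  qed
  finally have "d * d' * (\<Sum>b\<in>B. ?n b) = d * (\<Sum>a\<in>A. d' * (\<Sum>b\<in>piece A B a. ?n b))"
    by (simp add: sum_distrib_left mult.assoc)
  also have "\<dots> \<le> d * (\<Sum>a\<in>A. N (lin x (?c a)))"
    by (intro mult_left_mono sum_mono each assms(3))
  also have "\<dots> \<le> N (lin x c)" by (rule lower_estD[OF assms(1) A(1) c covA])
  finally show "d * d' * (\<Sum>b\<in>B. ?n b) \<le> N (lin x c)" .
qed

lemma lower_est_schreier0:
  assumes "N 0 = 0"
  shows "lower_est schreier0 x N 1"
  unfolding lower_est_def
proof (intro ballI impI)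
  fix A c assume A: "A \<in> schreier0" and c: "c \<in> fin_coeffs" and cov: "covers A {j. c j \<noteq> 0}"
  show "1 * (\<Sum>a\<in>A. N (lin x (restr c (piece A UNIV a)))) \<le> N (lin x c)"
  proof (cases "A = {}")
    case True
    then have "c = (\<lambda>_. 0)" using cov by (auto simp: covers_def)
    then show ?thesis using True assms by simp
  next
    case False
    then obtain n where n: "A = {n}" using A by (auto simp: schreier0_def)
    then have "restr c (piece A UNIV n) = c"
      using cov by (intro restr_id) (auto simp: covers_def piece_def)
    then show ?thesis using n by simp
  qed
qed

lemma lower_est_spread:
  assumes m: "strict_mono m" and F: "\<And>F. F \<in> \<F> \<Longrightarrow> m ` F \<in> \<G>" and lower_est: "lower_est \<G> x N d"
  shows "lower_est \<F> (\<lambda>i. x (m (Suc i) - 1)) N d"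
  unfolding lower_est_def
proof (intro ballI impI)
  let ?z = "\<lambda>i. x (m (Suc i) - 1)"
  fix A c assume A: "A \<in> \<F>" and c: "c \<in> fin_coeffs" and cov: "covers A {j. c j \<noteq> 0}"
  define push where "push c i = (if i \<in> range m then c (inv m i) else 0)" for c :: "nat \<Rightarrow> real" and i
  have inj: "inj m" using m by (rule strict_mono_imp_inj_on)
  have push_m: "push c (m j) = c j" for c j unfolding push_def using inj by simp
  have push_supp: "{i. push c i \<noteq> 0} = m ` {j. c j \<noteq> 0}" for c
  proof (intro equalityI subsetI)
    fix i assume i: "i \<in> {i. push c i \<noteq> 0}"
    then obtain j where "i = m j" unfolding push_def by (auto split: if_splits)
    then show "i \<in> m ` {j. c j \<noteq> 0}" using i push_m by auto
  qed (auto simp: push_m)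
  have lin: "lin x (push c) = lin ?z c" if c0: "c 0 = 0" for c
  proof -
    have "lin x (push c) = (\<Sum>j | c j \<noteq> 0. push c (m j) *\<^sub>R x (m j - 1))"
      unfolding lin_def push_supp by (subst sum.reindex) (auto intro: inj_on_subset[OF inj])
    also have "\<dots> = lin ?z c"
      unfolding lin_def push_m
    proof (rule sum.cong[OF refl])
      fix j assume "j \<in> {j. c j \<noteq> 0}"
      then obtain k where "j = Suc k" using c0 by (cases j) auto
      then show "c j *\<^sub>R x (m j - 1) = c j *\<^sub>R ?z (j - 1)" by simp
    qed
    finally show ?thesis .
  qed
  have pc: "push c \<in> fin_coeffs" using c unfolding fin_coeffs_def mem_Collect_eq push_supp
  proof (intro conjI)
    show "push c 0 = 0"
    proof (rule ccontr)
      assume "push c 0 \<noteq> 0"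
      then have "0 \<in> m ` {j. c j \<noteq> 0}" using push_supp by blast
      then obtain j where "m j = 0" "c j \<noteq> 0" by auto
      moreover have "j \<le> m j" using strict_mono_imp_increasing[OF m] .
      ultimately show False using c by (simp add: fin_coeffs_def)
    qed
  qed simp
  have "covers (m ` A) {i. push c i \<noteq> 0}"
    using cov unfolding push_supp covers_def by (auto simp: strict_mono_less_eq[OF m])
  then have "d * (\<Sum>a\<in>m ` A. N (lin x (restr (push c) (piece (m ` A) UNIV a)))) \<le> N (lin x (push c))"
    by (rule lower_estD[OF lower_est F[OF A] pc])
  also have "lin x (push c) = lin ?z c" using lin c by (simp add: fin_coeffs_def)
  also have "(\<Sum>a\<in>m ` A. N (lin x (restr (push c) (piece (m ` A) UNIV a))))
      = (\<Sum>a\<in>A. N (lin x (restr (push c) (piece (m ` A) UNIV (m a)))))"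
    by (subst sum.reindex) (auto intro: inj_on_subset[OF inj])
  also have "\<dots> = (\<Sum>a\<in>A. N (lin ?z (restr c (piece A UNIV a))))"
  proof (rule sum.cong[OF refl])
    fix a assume "a \<in> A"
    have "restr (push c) (piece (m ` A) UNIV (m a)) = push (restr c (piece A UNIV a))"
    proof
      fix i
      show "restr (push c) (piece (m ` A) UNIV (m a)) i = push (restr c (piece A UNIV a)) i"
      proof (cases "i \<in> range m")
        case True
        then obtain j where j: "i = m j" by blast
        have "m j \<in> piece (m ` A) UNIV (m a) \<longleftrightarrow> j \<in> piece A UNIV a"
          by (simp add: piece_def strict_mono_less_eq[OF m])
        then show ?thesis unfolding j push_m by (simp add: restr_def push_m)
      next
        case False
        then show ?thesis by (simp add: restr_def push_def)
      qed
    qed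
    then show "N (lin x (restr (push c) (piece (m ` A) UNIV (m a)))) = N (lin ?z (restr c (piece A UNIV a)))"
      using lin[of "restr c (piece A UNIV a)"] c by (simp add: fin_coeffs_def restr_def)
  qed
  finally show "d * (\<Sum>a\<in>A. N (lin ?z (restr c (piece A UNIV a)))) \<le> N (lin ?z c)" .
qed

lemma strict_mono_pred_Suc:
  assumes "strict_mono (m :: nat \<Rightarrow> nat)"
  shows "strict_mono (\<lambda>i. m (Suc i) - 1)"
proof (rule strict_monoI)
  fix i j :: nat assume "i < j"
  then have "m (Suc i) < m (Suc j)" using assms by (simp add: strict_mono_less)
  moreover have "Suc i \<le> m (Suc i)" by (rule strict_mono_imp_increasing[OF assms])
  ultimately show "m (Suc i) - 1 < m (Suc j) - 1" by linarith
qed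

text \<open>The extension is the infimal convolution of p with C times the norm; as p is at most C
  times the norm on Y, it does not fall below p there. It is called for because the moduli refer to
  norms on the whole space, while the averaged norm lives on the span of a block basis.\<close>

lemma extend_norm:
  fixes Y :: "'a::real_normed_vector set"
  assumes Y: "subspace Y"
    and tri: "\<And>u v. u \<in> Y \<Longrightarrow> v \<in> Y \<Longrightarrow> p (u + v) \<le> p u + p v"
    and hom: "\<And>r u. u \<in> Y \<Longrightarrow> p (r *\<^sub>R u) = \<bar>r\<bar> * p u"
    and bnd: "0 < c" "0 < C" "\<And>u. u \<in> Y \<Longrightarrow> c * norm u \<le> p u" "\<And>u. u \<in> Y \<Longrightarrow> p u \<le> C * norm u"
  obtains N where "equivalent_norm N" "\<And>u. u \<in> Y \<Longrightarrow> N u = p u"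
proof -
  define N where "N u = (INF y\<in>Y. p y + C * norm (u - y))" for u
  have Y0: "0 \<in> Y" and Yne: "Y \<noteq> {}" using subspace_0[OF Y] by auto
  have p0: "0 \<le> p y" if "y \<in> Y" for y
    using bnd(3)[OF that] bnd(1) by (meson mult_nonneg_nonneg norm_ge_zero order_less_imp_le order_trans)
  have bdd: "bdd_below ((\<lambda>y. p y + C * norm (u - y)) ` Y)" for u
    by (rule bdd_belowI2[of _ 0]) (use p0 bnd(2) in simp)
  have le: "N u \<le> p y + C * norm (u - y)" if "y \<in> Y" for u y
    unfolding N_def by (rule cINF_lower[OF bdd that])
  have ge: "r \<le> N u" if "\<And>y. y \<in> Y \<Longrightarrow> r \<le> p y + C * norm (u - y)" for r u
    unfolding N_def by (rule cINF_greatest[OF Yne that])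
  have pz: "p 0 = 0" using hom[OF Y0, of 0] by simp
  have eq: "N u = p u" if u: "u \<in> Y" for u
  proof (rule antisym)
    show "N u \<le> p u" using le[OF u, of u] by simp
    show "p u \<le> N u"
    proof (rule ge)
      fix y assume y: "y \<in> Y"
      have uy: "u - y \<in> Y" using subspace_diff[OF Y u y] .
      have "p u \<le> p y + p (u - y)" using tri[OF y uy] by simp
      also have "\<dots> \<le> p y + C * norm (u - y)" using bnd(4)[OF uy] by simp
      finally show "p u \<le> p y + C * norm (u - y)" .
    qed
  qed
  have N_tri: "N (u + v) \<le> N u + N v" for u v
  proof -
    have "N (u + v) - (p z + C * norm (v - z)) \<le> N u" if z: "z \<in> Y" for z
    proof (rule ge)
      fix y assume y: "y \<in> Y"
      have "N (u + v) \<le> p (y + z) + C * norm (u + v - (y + z))" by (rule le[OF subspace_add[OF Y y z]])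
      also have "\<dots> \<le> (p y + p z) + C * (norm (u - y) + norm (v - z))"
      proof (rule add_mono[OF tri[OF y z] mult_left_mono])
        show "norm (u + v - (y + z)) \<le> norm (u - y) + norm (v - z)"
          using norm_triangle_ineq[of "u - y" "v - z"] by (simp add: algebra_simps)
      qed (use bnd(2) in simp)
      finally show "N (u + v) - (p z + C * norm (v - z)) \<le> p y + C * norm (u - y)"
        by (simp add: algebra_simps)
    qed
    then have "N (u + v) - N u \<le> N v" by (intro ge) (simp add: algebra_simps)
    then show ?thesis by simp
  qed
  have N_le: "N (r *\<^sub>R u) \<le> \<bar>r\<bar> * N u" if "r \<noteq> 0" for r u
  proof -
    have "N (r *\<^sub>R u) / \<bar>r\<bar> \<le> N u"
    proof (rule ge)
      fix y assume y: "y \<in> Y"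
      have "N (r *\<^sub>R u) \<le> p (r *\<^sub>R y) + C * norm (r *\<^sub>R u - r *\<^sub>R y)" by (rule le[OF subspace_scale[OF Y y]])
      also have "\<dots> = \<bar>r\<bar> * (p y + C * norm (u - y))"
        by (simp add: hom[OF y] algebra_simps flip: scaleR_diff_right)
      finally show "N (r *\<^sub>R u) / \<bar>r\<bar> \<le> p y + C * norm (u - y)"
        using that by (simp add: field_simps)
    qed
    then show ?thesis using that by (simp add: field_simps)
  qed
  have N_hom: "N (r *\<^sub>R u) = \<bar>r\<bar> * N u" for r u
  proof (cases "r = 0")
    case True
    then show ?thesis using eq[OF Y0] pz by simp
  next
    case False
    have "N u \<le> \<bar>inverse r\<bar> * N (r *\<^sub>R u)" using N_le[of "inverse r" "r *\<^sub>R u"] False by simp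
    then have "\<bar>r\<bar> * N u \<le> N (r *\<^sub>R u)" using False by (simp add: field_simps)
    then show ?thesis using N_le[OF False, of u] by simp
  qed
  have upper: "N u \<le> C * norm u" for u using le[OF Y0, of u] pz by simp
  have lower: "min c C * norm u \<le> N u" for u
  proof (rule ge)
    fix y assume y: "y \<in> Y"
    have "min c C * norm u \<le> min c C * (norm y + norm (u - y))"
      using norm_triangle_ineq[of y "u - y"] bnd(1,2) by (intro mult_left_mono) simp_all
    also have "\<dots> \<le> c * norm y + C * norm (u - y)"
      unfolding distrib_left by (intro add_mono mult_right_mono) simp_all
    also have "\<dots> \<le> p y + C * norm (u - y)" using bnd(3)[OF y] by simp
    finally show "min c C * norm u \<le> p y + C * norm (u - y)" .
  qed
  have "equivalent_norm N" unfolding equivalent_norm_def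
    using N_tri N_hom upper lower bnd(1,2)
    by (intro conjI allI exI[of _ "min c C"] exI[of _ C]) auto
  then show ?thesis using eq that by blast
qed

lemma sum_Sup_le:
  fixes S :: "'b \<Rightarrow> real set"
  assumes "finite A" "\<And>a. a \<in> A \<Longrightarrow> S a \<noteq> {}"
    and le: "\<And>v. (\<And>a. a \<in> A \<Longrightarrow> v a \<in> S a) \<Longrightarrow> sum v A \<le> R"
  shows "(\<Sum>a\<in>A. Sup (S a)) \<le> R"
proof (rule field_le_epsilon)
  fix r :: real assume r: "0 < r"
  \<comment> \<open>The added 1 keeps the quotient defined for empty A; all errors together stay
    below r.\<close>
  let ?d = "r / (card A + 1)"
  have d: "0 < ?d" using r by simp
  have "\<exists>v\<in>S a. Sup (S a) - ?d < v" if "a \<in> A" for a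
  proof (rule ccontr)
    assume "\<not> ?thesis"
    then have "\<forall>v\<in>S a. v \<le> Sup (S a) - ?d" by (auto simp: not_less)
    then have "Sup (S a) \<le> Sup (S a) - ?d" by (intro cSup_least[OF assms(2)[OF that]]) blast
    then show False using d by simp
  qed
  then have "\<forall>a\<in>A. \<exists>v. v \<in> S a \<and> Sup (S a) - ?d < v" by blast
  from bchoice[OF this] obtain v where v: "\<forall>a\<in>A. v a \<in> S a \<and> Sup (S a) - ?d < v a" ..
  have "(\<Sum>a\<in>A. Sup (S a)) \<le> (\<Sum>a\<in>A. v a + ?d)"
    using v by (intro sum_mono) (auto simp: less_eq_real_def diff_less_eq)
  also have "\<dots> = sum v A + card A * ?d" by (simp add: sum.distrib)
  also have "\<dots> \<le> R + r"
  proof (rule add_mono)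
    show "sum v A \<le> R" by (rule le) (use v in blast)
    have "card A * ?d = r * (card A / (card A + 1))" by simp
    also have "\<dots> \<le> r * 1" using r by (intro mult_left_mono) simp_all
    finally show "card A * ?d \<le> r" by simp
  qed
  finally show "(\<Sum>a\<in>A. Sup (S a)) \<le> R + r" .
qed

section \<open>Renorming\<close>

text \<open>The intervals \<open>{a..q a}\<close>, \<open>a \<in> A\<close>, may leave gaps.  This is what makes families of intervals
  inside successive blocks combine to one family, at the price of a factor depending only on the norms of the
  interval projections.\<close>

definition gaps :: "nat set \<Rightarrow> (nat \<Rightarrow> nat) \<Rightarrow> bool"
  where "gaps A q \<longleftrightarrow> (\<forall>a\<in>A. \<forall>b\<in>A. a < b \<longrightarrow> q a < b)"

definition gap_sum :: "('a::real_vector \<Rightarrow> real) \<Rightarrow> (nat \<Rightarrow> 'a) \<Rightarrow> (nat \<Rightarrow> real) \<Rightarrow> nat set \<Rightarrow> (nat \<Rightarrow> nat) \<Rightarrow> real"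
  where "gap_sum N x c A q = (\<Sum>a\<in>A. N (lin x (restr c {a..q a})))"

definition gap_sums :: "nat set set \<Rightarrow> ('a::real_vector \<Rightarrow> real) \<Rightarrow> (nat \<Rightarrow> 'a) \<Rightarrow> (nat \<Rightarrow> real) \<Rightarrow> real set"
  where "gap_sums \<F> N x c = {gap_sum N x c A q | A q. A \<in> \<F> \<and> gaps A q}"

definition gap_norm :: "nat set set \<Rightarrow> ('a::real_vector \<Rightarrow> real) \<Rightarrow> (nat \<Rightarrow> 'a) \<Rightarrow> (nat \<Rightarrow> real) \<Rightarrow> real"
  where "gap_norm \<F> N x c = Sup (gap_sums \<F> N x c)"

lemma piece_convex: "i \<in> piece A UNIV a \<Longrightarrow> k \<in> piece A UNIV a \<Longrightarrow> i \<le> j \<Longrightarrow> j \<le> k \<Longrightarrow> j \<in> piece A UNIV a"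
  unfolding piece_def by auto

text \<open>An interval meets the order-convex set E and the support of c in a set whose hull lies
  in E and can replace the interval. Intervals that lose everything are dropped; the left end points
  move to the right, which regularity permits.\<close>

lemma gap_trim:
  assumes reg: "regular_family \<F>" and B: "B \<in> \<F>" "gaps B q" and c: "c \<in> fin_coeffs"
    and E: "\<And>i j k. i \<in> E \<Longrightarrow> k \<in> E \<Longrightarrow> i \<le> j \<Longrightarrow> j \<le> k \<Longrightarrow> j \<in> E" and N0: "N 0 = 0"
  shows "\<exists>B' q'. B' \<in> \<F> \<and> gaps B' q' \<and> B' \<subseteq> E \<and> q' ` B' \<subseteq> E \<and>
    gap_sum N x (restr c E) B q = gap_sum N x c B' q'"
proof -
  define T where "T b = {j. c j \<noteq> 0} \<inter> (E \<inter> {b..q b})" for b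
  define B0 where "B0 = {b\<in>B. T b \<noteq> {}}"
  define h where "h b = Min (T b)" for b
  define k where "k b = Max (T b)" for b
  have fin: "finite (T b)" for b using c by (simp add: T_def fin_coeffs_def)
  have B0: "b \<in> B" "T b \<noteq> {}" if "b \<in> B0" for b using that by (simp_all add: B0_def)
  have h: "h b \<in> T b" and k: "k b \<in> T b" if "b \<in> B0" for b
    using Min_in[OF fin B0(2)[OF that]] Max_in[OF fin B0(2)[OF that]] by (simp_all add: h_def k_def)
  have hk: "h b \<le> j" "j \<le> k b" if "j \<in> T b" for b j
    using Min_le[OF fin that] Max_ge[OF fin that] by (simp_all add: h_def k_def)
  have T_less: "i < j" if "b \<in> B0" "b' \<in> B0" "b < b'" "i \<in> T b" "j \<in> T b'" for b b' i j
  proof -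
    have "q b < b'" using B(2) B0(1)[OF that(1)] B0(1)[OF that(2)] that(3) by (simp add: gaps_def)
    then show ?thesis using that(4,5) by (simp add: T_def)
  qed
  have mono: "strict_mono_on B0 h"
    by (rule strict_mono_onI) (rule T_less, assumption+, (rule h, assumption)+)
  have inj: "inj_on h B0" using mono by (rule strict_mono_on_imp_inj_on)
  define q' where "q' y = k (inv_into B0 h y)" for y
  have q': "q' (h b) = k b" if "b \<in> B0" for b unfolding q'_def using inv_into_f_f[OF inj that] by simp
  have "B0 \<in> \<F>" by (rule regularD(3)[OF reg B(1)]) (auto simp: B0_def)
  then have 1: "h ` B0 \<in> \<F>"
    by (rule regularD(4)[OF reg _ mono]) (use h in \<open>simp add: T_def\<close>)
  have 2: "gaps (h ` B0) q'"
    unfolding gaps_def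
  proof (intro ballI impI)
    fix y z assume "y \<in> h ` B0" "z \<in> h ` B0" "y < z"
    then obtain b b' where b: "b \<in> B0" "b' \<in> B0" "y = h b" "z = h b'" "h b < h b'" by blast
    then have "b < b'" using strict_mono_on_less[OF mono] by blast
    then show "q' y < z" unfolding b(3,4) q'[OF b(1)] using T_less[OF b(1,2)] k[OF b(1)] h[OF b(2)] by blast
  qed
  have 3: "h ` B0 \<subseteq> E" using h unfolding T_def by blast
  have 4: "q' ` h ` B0 \<subseteq> E"
  proof
    fix y assume "y \<in> q' ` h ` B0"
    then obtain b where "b \<in> B0" "y = k b" using q' by auto
    then show "y \<in> E" using k[of b] by (simp add: T_def)
  qed
  have "gap_sum N x c (h ` B0) q' = (\<Sum>b\<in>B0. N (lin x (restr c {h b..q' (h b)})))"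
    unfolding gap_sum_def by (subst sum.reindex[OF inj]) simp
  also have "\<dots> = (\<Sum>b\<in>B0. N (lin x (restr (restr c E) {b..q b})))"
  proof (rule sum.cong[OF refl])
    fix b assume b: "b \<in> B0"
    have "restr c {h b..k b} = restr c (E \<inter> {b..q b})"
    proof (rule restr_cong)
      fix j assume cj: "c j \<noteq> 0"
      show "j \<in> {h b..k b} \<longleftrightarrow> j \<in> E \<inter> {b..q b}"
      proof
        assume j: "j \<in> {h b..k b}"
        have "h b \<in> E" "k b \<in> E" "b \<le> h b" "k b \<le> q b" using h[OF b] k[OF b] by (simp_all add: T_def)
        then show "j \<in> E \<inter> {b..q b}" using j E[of "h b" "k b" j] by simp
      next
        assume "j \<in> E \<inter> {b..q b}"
        then have "j \<in> T b" using cj by (simp add: T_def)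
        then show "j \<in> {h b..k b}" using hk by simp
      qed
    qed
    then show "N (lin x (restr c {h b..q' (h b)})) = N (lin x (restr (restr c E) {b..q b}))"
      unfolding q'[OF b] by (simp add: restr_restr)
  qed
  also have "\<dots> = gap_sum N x (restr c E) B q"
    unfolding gap_sum_def
  proof (rule sum.mono_neutral_left)
    show "finite B" by (rule regularD(1)[OF reg B(1)])
    show "\<forall>b\<in>B - B0. N (lin x (restr (restr c E) {b..q b})) = 0"
    proof
      fix b assume "b \<in> B - B0"
      then have "T b = {}" by (simp add: B0_def)
      then have "c j = 0" if "j \<in> E \<inter> {b..q b}" for j using that unfolding T_def by blast
      then have "restr c (E \<inter> {b..q b}) = (\<lambda>_. 0)" by (auto simp: restr_def)
      then show "N (lin x (restr (restr c E) {b..q b})) = 0" by (simp add: restr_restr N0)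
    qed
  qed (auto simp: B0_def)
  finally show ?thesis using 1 2 3 4 by (intro exI[of _ "h ` B0"] exI[of _ q']) simp
qed

text \<open>The right end points lie in the piece of their left end points, so intervals from
  different pieces stay apart.\<close>

lemma gap_join:
  assumes reg: "regular_family \<A>" "regular_family \<F>" and A: "A \<in> \<A>"
    and B: "\<And>a. a \<in> A \<Longrightarrow> B a \<in> \<F>" "\<And>a. a \<in> A \<Longrightarrow> gaps (B a) (q a)"
      "\<And>a. a \<in> A \<Longrightarrow> B a \<subseteq> piece A UNIV a" "\<And>a. a \<in> A \<Longrightarrow> q a ` B a \<subseteq> piece A UNIV a"
  shows "\<exists>C r. C \<in> conv \<A> \<F> \<and> gaps C r \<and> gap_sum N x c C r = (\<Sum>a\<in>A. gap_sum N x c (B a) (q a))"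
proof -
  define C where "C = (\<Union>a\<in>A. B a)"
  \<comment> \<open>A point lies in only one piece, so the choice is forced and the right end points
    of the joined family are well defined.\<close>
  define own where "own b = (SOME a. a \<in> A \<and> b \<in> B a)" for b
  have own: "own b = a" if "a \<in> A" "b \<in> B a" for a b
  proof -
    have "own b \<in> A \<and> b \<in> B (own b)" unfolding own_def by (rule someI[of _ a]) (use that in simp)
    then show ?thesis using in_piece_unique[of "own b" A a b UNIV] B(3) that by blast
  qed
  define r where "r b = q (own b) b" for b
  have r: "r b = q a b" if "a \<in> A" "b \<in> B a" for a b using own[OF that] by (simp add: r_def)
  have "C \<in> conv \<A> \<F>" unfolding C_def by (rule conv_UnionI[OF reg A B(1,3)])
  moreover have "gaps C r"
    unfolding gaps_def
  proof (intro ballI impI)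
    fix b b' assume "b \<in> C" "b' \<in> C" and less: "b < b'"
    then obtain a a' where a: "a \<in> A" "b \<in> B a" "a' \<in> A" "b' \<in> B a'" unfolding C_def by blast
    have b: "b \<in> piece A UNIV a" "b' \<in> piece A UNIV a'" "q a b \<in> piece A UNIV a"
      using B(3,4)[OF a(1)] B(3)[OF a(3)] a(2,4) by blast+
    have aa: "a \<le> a'" using b a less by (auto simp: piece_def)
    show "r b < b'"
    proof (cases "a = a'")
      case True
      then show ?thesis using r[OF a(1,2)] B(2)[OF a(1)] a less by (simp add: gaps_def)
    next
      case False
      have "q a b < a'"
      proof (rule ccontr)
        assume "\<not> q a b < a'"
        then have "a' \<le> a" using b(3) a(3) by (simp add: piece_def)
        then show False using aa False by simp
      qed
      then show ?thesis using r[OF a(1,2)] b(2) by (simp add: piece_def)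
    qed
  qed
  moreover have "gap_sum N x c C r = (\<Sum>a\<in>A. gap_sum N x c (B a) (q a))"
  proof -
    have "gap_sum N x c C r = (\<Sum>a\<in>A. \<Sum>b\<in>B a. N (lin x (restr c {b..r b})))"
      unfolding gap_sum_def C_def
    proof (rule sum.UNION_disjoint)
      show "finite A" by (rule regularD(1)[OF reg(1) A])
      show "\<forall>a\<in>A. finite (B a)" using regularD(1)[OF reg(2) B(1)] by blast
      show "\<forall>a\<in>A. \<forall>b\<in>A. a \<noteq> b \<longrightarrow> B a \<inter> B b = {}" using own by blast
    qed
    also have "\<dots> = (\<Sum>a\<in>A. gap_sum N x c (B a) (q a))"
      unfolding gap_sum_def by (intro sum.cong refl) (simp add: r)
    finally show ?thesis .
  qed
  ultimately show ?thesis by blast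
qed

lemma gap_sums_nonempty: "regular_family \<F> \<Longrightarrow> gap_sums \<F> N x c \<noteq> {}"
  unfolding gap_sums_def gaps_def using regularD(6) by blast

lemma gap_norm_upper:
  "bdd_above (gap_sums \<F> N x c) \<Longrightarrow> A \<in> \<F> \<Longrightarrow> gaps A q \<Longrightarrow> gap_sum N x c A q \<le> gap_norm \<F> N x c"
  unfolding gap_norm_def by (rule cSup_upper) (auto simp: gap_sums_def)

lemma gap_norm_least:
  assumes "regular_family \<F>" "\<And>A q. A \<in> \<F> \<Longrightarrow> gaps A q \<Longrightarrow> gap_sum N x c A q \<le> r"
  shows "gap_norm \<F> N x c \<le> r"
  unfolding gap_norm_def by (rule cSup_least[OF gap_sums_nonempty[OF assms(1)]])
    (use assms(2) in \<open>auto simp: gap_sums_def\<close>)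

text \<open>The superadditivity behind the averaging: nearly optimal families for the single pieces
  are trimmed to these pieces and joined, at the price of one more convolution.\<close>

lemma gap_norm_pieces:
  assumes reg: "regular_family \<A>" "regular_family \<F>" and A: "A \<in> \<A>" and c: "c \<in> fin_coeffs"
    and N0: "N 0 = 0" and bdd: "bdd_above (gap_sums (conv \<A> \<F>) N x c)"
  shows "(\<Sum>a\<in>A. gap_norm \<F> N x (restr c (piece A UNIV a))) \<le> gap_norm (conv \<A> \<F>) N x c"
  unfolding gap_norm_def[of \<F>]
proof (rule sum_Sup_le)
  show "finite A" by (rule regularD(1)[OF reg(1) A])
  show "gap_sums \<F> N x (restr c (piece A UNIV a)) \<noteq> {}" for a by (rule gap_sums_nonempty[OF reg(2)])
  fix v assume v: "\<And>a. a \<in> A \<Longrightarrow> v a \<in> gap_sums \<F> N x (restr c (piece A UNIV a))"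
  have "\<exists>Bq. fst Bq \<in> \<F> \<and> gaps (fst Bq) (snd Bq) \<and> fst Bq \<subseteq> piece A UNIV a \<and>
      snd Bq ` fst Bq \<subseteq> piece A UNIV a \<and> v a = gap_sum N x c (fst Bq) (snd Bq)" if a: "a \<in> A" for a
  proof -
    obtain B q where B: "B \<in> \<F>" "gaps B q" and va: "v a = gap_sum N x (restr c (piece A UNIV a)) B q"
      using v[OF a] unfolding gap_sums_def by blast
    have "\<exists>B' q'. B' \<in> \<F> \<and> gaps B' q' \<and> B' \<subseteq> piece A UNIV a \<and> q' ` B' \<subseteq> piece A UNIV a \<and>
        v a = gap_sum N x c B' q'"
      unfolding va by (rule gap_trim[where N = N, OF reg(2) B c _ N0]) (rule piece_convex)
    then obtain B' q' where "B' \<in> \<F>" "gaps B' q'" "B' \<subseteq> piece A UNIV a" "q' ` B' \<subseteq> piece A UNIV a"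
      "v a = gap_sum N x c B' q'" by blast
    then show ?thesis by (intro exI[of _ "(B', q')"]) simp
  qed
  then have "\<forall>a\<in>A. \<exists>Bq. fst Bq \<in> \<F> \<and> gaps (fst Bq) (snd Bq) \<and> fst Bq \<subseteq> piece A UNIV a \<and>
      snd Bq ` fst Bq \<subseteq> piece A UNIV a \<and> v a = gap_sum N x c (fst Bq) (snd Bq)" by blast
  from bchoice[OF this] obtain Bq where Bq: "\<forall>a\<in>A. fst (Bq a) \<in> \<F> \<and> gaps (fst (Bq a)) (snd (Bq a)) \<and>
      fst (Bq a) \<subseteq> piece A UNIV a \<and> snd (Bq a) ` fst (Bq a) \<subseteq> piece A UNIV a \<and>
      v a = gap_sum N x c (fst (Bq a)) (snd (Bq a))" ..
  have "\<exists>C r. C \<in> conv \<A> \<F> \<and> gaps C r \<and>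
      gap_sum N x c C r = (\<Sum>a\<in>A. gap_sum N x c (fst (Bq a)) (snd (Bq a)))"
    by (rule gap_join[OF reg A]) (use Bq in blast)+
  then obtain C r where C: "C \<in> conv \<A> \<F>" "gaps C r"
    "gap_sum N x c C r = (\<Sum>a\<in>A. gap_sum N x c (fst (Bq a)) (snd (Bq a)))" by blast
  have "sum v A = gap_sum N x c C r" unfolding C(3) by (rule sum.cong[OF refl]) (use Bq in blast)
  then show "sum v A \<le> gap_norm (conv \<A> \<F>) N x c" using gap_norm_upper[OF bdd C(1,2)] by simp
qed

lemma gap_norm_add:
  assumes reg: "regular_family \<F>" and N: "equivalent_norm N" and cd: "c \<in> fin_coeffs" "d \<in> fin_coeffs"
    and bdd: "bdd_above (gap_sums \<F> N x c)" "bdd_above (gap_sums \<F> N x d)"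
  shows "gap_norm \<F> N x (\<lambda>j. c j + d j) \<le> gap_norm \<F> N x c + gap_norm \<F> N x d"
proof (rule gap_norm_least[OF reg])
  fix A q assume A: "A \<in> \<F>" "gaps A q"
  have "gap_sum N x (\<lambda>j. c j + d j) A q \<le> gap_sum N x c A q + gap_sum N x d A q"
    unfolding gap_sum_def sum.distrib[symmetric]
  proof (rule sum_mono)
    fix a
    have "restr (\<lambda>j. c j + d j) {a..q a} = (\<lambda>j. restr c {a..q a} j + restr d {a..q a} j)"
      by (auto simp: restr_def)
    then have "lin x (restr (\<lambda>j. c j + d j) {a..q a}) = lin x (restr c {a..q a}) + lin x (restr d {a..q a})"
      by (simp add: lin_add fin_coeffs_restr cd)
    then show "N (lin x (restr (\<lambda>j. c j + d j) {a..q a})) \<le> N (lin x (restr c {a..q a})) + N (lin x (restr d {a..q a}))"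
      using equivalent_normD(1)[OF N] by simp
  qed
  also have "\<dots> \<le> gap_norm \<F> N x c + gap_norm \<F> N x d"
    by (intro add_mono gap_norm_upper bdd A)
  finally show "gap_sum N x (\<lambda>j. c j + d j) A q \<le> gap_norm \<F> N x c + gap_norm \<F> N x d" .
qed

lemma gap_norm_scale:
  assumes reg: "regular_family \<F>" and N: "equivalent_norm N"
    and bdd: "\<And>r. bdd_above (gap_sums \<F> N x (\<lambda>j. r * c j))"
  shows "gap_norm \<F> N x (\<lambda>j. r * c j) = \<bar>r\<bar> * gap_norm \<F> N x c"
proof -
  have sc: "gap_sum N x (\<lambda>j. r * c j) A q = \<bar>r\<bar> * gap_sum N x c A q" for r c A q
  proof -
    have "restr (\<lambda>j. r * c j) {a..q a} = (\<lambda>j. r * restr c {a..q a} j)" for a by (auto simp: restr_def)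
    then show ?thesis by (simp add: gap_sum_def lin_scale equivalent_normD(2)[OF N] sum_distrib_left)
  qed
  have le: "gap_norm \<F> N x (\<lambda>j. r * c j) \<le> \<bar>r\<bar> * gap_norm \<F> N x c"
    if "bdd_above (gap_sums \<F> N x c)" for r c
    by (rule gap_norm_least[OF reg]) (simp add: sc mult_left_mono gap_norm_upper[OF that])
  have bc: "bdd_above (gap_sums \<F> N x c)" using bdd[of 1] by simp
  show ?thesis
  proof (cases "r = 0")
    case True
    have "gap_sum N x (\<lambda>j. r * c j) {} undefined \<le> gap_norm \<F> N x (\<lambda>j. r * c j)"
      by (rule gap_norm_upper[OF bdd regularD(6)[OF reg]]) (simp add: gaps_def)
    then have "0 \<le> gap_norm \<F> N x (\<lambda>j. r * c j)" by (simp add: gap_sum_def)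
    then show ?thesis using le[OF bc, of r] True by simp
  next
    case False
    have "gap_norm \<F> N x (\<lambda>j. inverse r * (r * c j)) \<le> \<bar>inverse r\<bar> * gap_norm \<F> N x (\<lambda>j. r * c j)"
      by (rule le[OF bdd])
    moreover have "(\<lambda>j. inverse r * (r * c j)) = c" using False by (simp add: fun_eq_iff)
    ultimately have "gap_norm \<F> N x c \<le> \<bar>inverse r\<bar> * gap_norm \<F> N x (\<lambda>j. r * c j)" by simp
    then have "\<bar>r\<bar> * gap_norm \<F> N x c \<le> gap_norm \<F> N x (\<lambda>j. r * c j)" using False by (simp add: field_simps)
    then show ?thesis using le[OF bc, of r] by simp
  qed
qed

text \<open>Averaging over the iterated convolutions: passing from the pieces to the whole vector moves the \<open>j\<close>-th summand into
  the next one, and the last into the first because of the lower bound for the \<open>K\<close>-fold convolution.\<close>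

lemma renorm:
  fixes x :: "nat \<Rightarrow> 'a::real_normed_vector"
  assumes N: "equivalent_norm N" and x: "lin_indep x" and regA: "regular_family \<A>"
    and r: "0 < \<rho>" and K: "1 \<le> K"
    and bnd: "\<And>A q c. A \<in> (conv \<A> ^^ K) schreier0 \<Longrightarrow> gaps A q \<Longrightarrow> c \<in> fin_coeffs \<Longrightarrow>
      \<rho> ^ K * gap_sum N x c A q \<le> N (lin x c)"
  shows "\<exists>N'. equivalent_norm N' \<and> lower_est \<A> x N' \<rho>"
proof -
  define F where "F j = (conv \<A> ^^ j) schreier0" for j
  have F_rec: "F 0 = schreier0" "F (Suc j) = conv \<A> (F j)" for j by (simp_all add: F_def)
  have regF: "regular_family (F j)" for j
    by (induction j) (simp_all add: F_rec regular_schreier0 regular_conv regA)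
  have F_mono: "F j \<subseteq> F K" if "j \<le> K" for j
    using that
  proof (induction rule: inc_induct)
    case (step n)
    then show ?case using regular_subset_conv[OF regA regF[of n]] by (simp add: F_rec)
  qed simp
  have bnd': "gap_sum N x c A q \<le> N (lin x c) / \<rho> ^ K"
    if "j \<le> K" "A \<in> F j" "gaps A q" "c \<in> fin_coeffs" for j A q c
    using bnd[of A q c] F_mono[OF that(1)] that r unfolding F_def[symmetric] by (auto simp: field_simps)
  have bdd: "bdd_above (gap_sums (F j) N x c)" if "j \<le> K" "c \<in> fin_coeffs" for j c
    by (rule bdd_aboveI[of _ "N (lin x c) / \<rho> ^ K"]) (use bnd' that in \<open>auto simp: gap_sums_def\<close>)
  let ?g = "\<lambda>j c. gap_norm (F j) N x c"
  have g_le: "?g j c \<le> N (lin x c) / \<rho> ^ K" if "j \<le> K" "c \<in> fin_coeffs" for j c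
    by (rule gap_norm_least[OF regF]) (use bnd' that in blast)
  have g_ge: "0 \<le> ?g j c" if "j \<le> K" "c \<in> fin_coeffs" for j c
  proof -
    have "gap_sum N x c {} undefined \<le> ?g j c"
      by (rule gap_norm_upper[OF bdd[OF that] regularD(6)[OF regF]]) (simp add: gaps_def)
    then show ?thesis by (simp add: gap_sum_def)
  qed
  have g0: "N (lin x c) \<le> ?g 0 c" if c: "c \<in> fin_coeffs" for c
  proof -
    have fin: "finite {j. c j \<noteq> 0}" and c0: "c 0 = 0" using c by (simp_all add: fin_coeffs_def)
    obtain n where n: "\<forall>j\<in>{j. c j \<noteq> 0}. j \<le> n" using finite_nat_set_iff_bounded_le[THEN iffD1, OF fin] by blast
    have "restr c {1..n} = c"
    proof (rule restr_id)
      fix j assume cj: "c j \<noteq> 0"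
      then have "j \<noteq> 0" using c0 by metis
      then show "j \<in> {1..n}" using n cj by simp
    qed
    \<comment> \<open>One interval from 1 to n catches all of c, so already the singletons yield a
      norm above N.\<close>
    then have "N (lin x c) = gap_sum N x c {1} (\<lambda>_. n)" by (simp add: gap_sum_def)
    also have "\<dots> \<le> ?g 0 c"
      by (rule gap_norm_upper[OF bdd[OF _ c]]) (simp_all add: F_rec schreier0_def gaps_def)
    finally show ?thesis .
  qed
  define P where "P c = (\<Sum>j<K. \<rho> ^ j * ?g j c)" for c
  \<comment> \<open>M depends on K, which does no harm: the new norm only has to be equivalent to
    N.\<close>
  define M where "M = (\<Sum>j<K. \<rho> ^ j / \<rho> ^ K)"
  have M: "0 < M" unfolding M_def by (rule sum_pos) (use r K in \<open>auto simp: lessThan_empty_iff\<close>)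
  have P_ge: "N (lin x c) \<le> P c" if c: "c \<in> fin_coeffs" for c
  proof -
    have "\<rho> ^ 0 * ?g 0 c \<le> P c"
      unfolding P_def by (rule member_le_sum[of 0 "{..<K}" "\<lambda>j. \<rho> ^ j * ?g j c"])
        (use K g_ge c r in auto)
    then show ?thesis using g0[OF c] by simp
  qed
  have P_le: "P c \<le> M * N (lin x c)" if c: "c \<in> fin_coeffs" for c
  proof -
    have "P c \<le> (\<Sum>j<K. \<rho> ^ j * (N (lin x c) / \<rho> ^ K))"
      unfolding P_def by (intro sum_mono mult_left_mono g_le[OF _ c]) (use r in auto)
    then show ?thesis by (simp add: M_def sum_distrib_right)
  qed
  have P_add: "P (\<lambda>j. c j + d j) \<le> P c + P d" if c: "c \<in> fin_coeffs" and d: "d \<in> fin_coeffs" for c d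
    unfolding P_def sum.distrib[symmetric] distrib_left[symmetric]
  proof (intro sum_mono mult_left_mono)
    fix j assume "j \<in> {..<K}"
    then have j: "j \<le> K" by simp
    show "?g j (\<lambda>j. c j + d j) \<le> ?g j c + ?g j d"
      by (rule gap_norm_add[OF regF N c d bdd[OF j c] bdd[OF j d]])
  qed (use r in simp)
  have P_scale: "P (\<lambda>j. s * c j) = \<bar>s\<bar> * P c" if c: "c \<in> fin_coeffs" for s c
    unfolding P_def sum_distrib_left
  proof (rule sum.cong[OF refl])
    fix j assume "j \<in> {..<K}"
    then have j: "j \<le> K" by simp
    have "?g j (\<lambda>j. s * c j) = \<bar>s\<bar> * ?g j c"
      by (rule gap_norm_scale[OF regF N]) (rule bdd[OF j fin_coeffs_scale[OF c]])
    then show "\<rho> ^ j * ?g j (\<lambda>j. s * c j) = \<bar>s\<bar> * (\<rho> ^ j * ?g j c)" by simp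
  qed
  have P_low: "\<rho> * (\<Sum>a\<in>A. P (restr c (piece A UNIV a))) \<le> P c"
    if A: "A \<in> \<A>" and c: "c \<in> fin_coeffs" and cov: "covers A {j. c j \<noteq> 0}" for A c
  proof -
    let ?G = "\<lambda>j. \<Sum>a\<in>A. ?g j (restr c (piece A UNIV a))"
    have step: "?G j \<le> ?g (Suc j) c" if "Suc j \<le> K" for j
      unfolding F_rec by (rule gap_norm_pieces[where N = N, OF regA regF A c equivalent_normD(3)[OF N]])
        (use bdd[OF that c] in \<open>simp add: F_rec\<close>)
    obtain k where k: "K = Suc k" using K by (cases K) auto
    have "\<rho> * (\<Sum>a\<in>A. P (restr c (piece A UNIV a))) = (\<Sum>j<K. \<rho> ^ Suc j * ?G j)"
      unfolding P_def by (subst sum.swap) (simp add: sum_distrib_left mult.assoc)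
    also have "\<dots> = \<rho> ^ K * ?G k + (\<Sum>j<k. \<rho> ^ Suc j * ?G j)" by (simp add: k)
    also have "\<dots> \<le> ?g 0 c + (\<Sum>j<k. \<rho> ^ Suc j * ?g (Suc j) c)"
    proof (intro add_mono sum_mono mult_left_mono)
      have "\<rho> ^ K * ?G k \<le> \<rho> ^ K * ?g K c" using step[of k] k r by (intro mult_left_mono) simp_all
      also have "\<dots> \<le> N (lin x c)" using g_le[OF order_refl c] r by (simp add: field_simps)
      also have "\<dots> \<le> ?g 0 c" by (rule g0[OF c])
      finally show "\<rho> ^ K * ?G k \<le> ?g 0 c" .
    qed (use step k r in auto)
    also have "\<dots> = P c" unfolding P_def k by (subst sum.lessThan_Suc_shift) simp
    finally show ?thesis .
  qed
  obtain c0 C0 where c0: "c0 > 0" "C0 > 0" "\<And>u. c0 * norm u \<le> N u" "\<And>u. N u \<le> C0 * norm u"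
    using N unfolding equivalent_norm_def by blast
  let ?Y = "span (range x)"
  note sp = span_eq_lin[OF x]
  have add: "coeffs x (u + v) = (\<lambda>j. coeffs x u j + coeffs x v j)" if "u \<in> ?Y" "v \<in> ?Y" for u v
    using coeffs_lin[OF x fin_coeffs_add[OF sp(1)[OF that(1)] sp(1)[OF that(2)]]]
      lin_add[OF sp(1)[OF that(1)] sp(1)[OF that(2)], of x] sp(2) that by simp
  have scale: "coeffs x (s *\<^sub>R u) = (\<lambda>j. s * coeffs x u j)" if "u \<in> ?Y" for s u
    using coeffs_lin[OF x fin_coeffs_scale[OF sp(1)[OF that]], of s] lin_scale[of x s "coeffs x u"] sp(2)[OF that]
    by simp
  obtain N' where N': "equivalent_norm N'" "\<And>u. u \<in> ?Y \<Longrightarrow> N' u = P (coeffs x u)"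
  proof (rule extend_norm[of ?Y "\<lambda>u. P (coeffs x u)" c0 "M * C0"])
    fix u v assume u: "u \<in> ?Y"
    note cu = sp[OF u]
    show "P (coeffs x (u + v)) \<le> P (coeffs x u) + P (coeffs x v)" if v: "v \<in> ?Y"
      unfolding add[OF u v] by (rule P_add[OF cu(1) sp(1)[OF v]])
    show "P (coeffs x (s *\<^sub>R u)) = \<bar>s\<bar> * P (coeffs x u)" for s
      unfolding scale[OF u] by (rule P_scale[OF cu(1)])
    show "c0 * norm u \<le> P (coeffs x u)"
      using c0(3)[of u] P_ge[OF cu(1)] unfolding cu(2) by linarith
    have "P (coeffs x u) \<le> M * N u" using P_le[OF cu(1)] unfolding cu(2) .
    also have "\<dots> \<le> M * (C0 * norm u)" using c0(4)[of u] M by (intro mult_left_mono) simp_all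
    finally show "P (coeffs x u) \<le> M * C0 * norm u" by (simp add: mult.assoc)
  qed (use c0 M in simp_all)
  have "N' (lin x c) = P c" if "c \<in> fin_coeffs" for c
    using N'(2)[OF lin_in_span] coeffs_lin[OF x that] by simp
  then have "lower_est \<A> x N' \<rho>" unfolding lower_est_def using P_low fin_coeffs_restr by simp
  then show ?thesis using N'(1) by blast
qed

section \<open>Powers of the moduli\<close>

definition admits_lower_est :: "(nat \<Rightarrow> 'a::real_normed_vector) \<Rightarrow> nat set set \<Rightarrow> real \<Rightarrow> bool"
  where "admits_lower_est e \<F> d \<longleftrightarrow> (\<exists>N x. equivalent_norm N \<and> block_basis UNIV e x \<and> lower_est \<F> x N d)"

text \<open>A singleton A and one basis vector force this. The bound makes the suprema in the
  definition of the moduli meaningful.\<close>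

lemma lower_est_le_1:
  assumes N: "equivalent_norm N" and x: "lin_indep x" and reg: "regular_family \<F>" and lower_est: "lower_est \<F> x N d"
  shows "d \<le> 1"
proof -
  let ?c = "\<lambda>j. if j = 1 then 1 else 0 :: real"
  have c: "?c \<in> fin_coeffs" by (auto simp: fin_coeffs_def)
  have "lin x ?c \<noteq> 0" by (rule lin_indep_nonzero[OF x c, of 1]) simp
  then have pos: "0 < N (lin x ?c)" by (rule equivalent_normD(5)[OF N])
  have "restr ?c (piece {1} UNIV 1) = ?c" by (rule restr_id) (auto simp: piece_def split: if_splits)
  moreover have "d * (\<Sum>a\<in>{1}. N (lin x (restr ?c (piece {1} UNIV a)))) \<le> N (lin x ?c)"
    by (rule lower_estD[OF lower_est regularD(5)[OF reg] c]) (auto simp: covers_def split: if_splits)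
  ultimately have "d * N (lin x ?c) \<le> 1 * N (lin x ?c)" by simp
  then show ?thesis using pos by (simp only: mult_le_cancel_right_pos)
qed

lemma lower_est_0: "equivalent_norm N \<Longrightarrow> lower_est \<F> x N 0"
  unfolding lower_est_def by (simp add: equivalent_normD(4))

lemma equivalent_norm_norm: "equivalent_norm norm"
  unfolding equivalent_norm_def by (auto simp: norm_triangle_ineq intro!: exI[of _ 1])

lemma block_basis_self:
  assumes "lin_indep e"
  shows "block_basis UNIV e e"
proof -
  have e: "lin e (\<lambda>j. if j = Suc i then 1 else 0) = e i" for i
    by (subst lin_eq_sum[of "{Suc i}"]) auto
  have c: "(\<lambda>j. if j = Suc i then 1 else 0 :: real) \<in> fin_coeffs" for i
    by (auto simp: fin_coeffs_def)
  have "supp e (e i) = {Suc i}" for i using supp_lin[OF assms c[of i]] unfolding e by auto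
  moreover have "e i \<noteq> 0" for i using lin_indep_nonzero[OF assms c[of i], of "Suc i"] unfolding e by simp
  ultimately show ?thesis unfolding block_basis_def set_less_def by (auto intro: span_base)
qed

context
  fixes l :: "cord \<Rightarrow> nat \<Rightarrow> cord" and e :: "nat \<Rightarrow> 'a::real_normed_vector"
  assumes ladder: "ladder_system l" and e: "lin_indep e"
begin

text \<open>The three nested suprema collapse to one: every nonnegative constant strictly below the
  modulus is realised by some norm and block basis, and no realised constant exceeds it. The
  supremum itself may not be attained, hence the intermediate numbers in later arguments.\<close>

lemma delta_ddot_bounds:
  shows "admits_lower_est e (schreier l a) d \<Longrightarrow> d \<le> delta_ddot l a e"
    and "0 \<le> d \<Longrightarrow> d < delta_ddot l a e \<Longrightarrow> admits_lower_est e (schreier l a) d"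
    and "0 \<le> delta_ddot l a e" "delta_ddot l a e \<le> 1"
proof -
  note reg = regular_schreier[OF ladder, of a]
  let ?S = "\<lambda>x N. {d. 0 \<le> d \<and> lower_est (schreier l a) x N d}"
  let ?D = "\<lambda>N. {delta l a x N | x. block_basis UNIV e x}"
  let ?DD = "{delta_dot l a e N | N. equivalent_norm N}"
  have delta: "delta l a x N = Sup (?S x N)"
    if "equivalent_norm N" "block_basis UNIV e x" for x and N :: "'a \<Rightarrow> real"
  proof -
    note x = block_lin_indep[OF e that(2)]
    have "(\<forall>k y. admissible l a x k y \<longrightarrow> d * (\<Sum>i<k. N (y i)) \<le> N (\<Sum>i<k. y i)) \<longleftrightarrow> lower_est (schreier l a) x N d" for d
      using delta_bound_imp_lower_est[where N = N, OF x reg equivalent_normD(3)[OF that(1)]] lower_est_imp_delta_bound[OF x] by blast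
    then show ?thesis unfolding delta_def by simp
  qed
  have S1: "d \<le> 1" if "equivalent_norm N" "block_basis UNIV e x" "d \<in> ?S x N" for x d and N :: "'a \<Rightarrow> real"
    using lower_est_le_1[OF that(1) block_lin_indep[OF e that(2)] reg] that(3) by blast
  have S0: "0 \<in> ?S x N" if "equivalent_norm N" for x and N :: "'a \<Rightarrow> real" using lower_est_0[OF that] by simp
  have bS: "bdd_above (?S x N)" if "equivalent_norm N" "block_basis UNIV e x" for x and N :: "'a \<Rightarrow> real"
    by (rule bdd_aboveI[of _ 1]) (rule S1[OF that])
  have d0: "0 \<le> delta l a x N" and d1: "delta l a x N \<le> 1" and dS: "d \<in> ?S x N \<Longrightarrow> d \<le> delta l a x N"
    if "equivalent_norm N" "block_basis UNIV e x" for x d and N :: "'a \<Rightarrow> real"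
    unfolding delta[OF that]
    by (rule cSup_upper[OF S0[OF that(1)] bS[OF that]], rule cSup_least, use S0[OF that(1)] in blast,
        rule S1[OF that], assumption, rule cSup_upper[OF _ bS[OF that]], assumption)
  have D_ne: "?D N \<noteq> {}" for N using block_basis_self[OF e] by blast
  have bD: "bdd_above (?D N)" if "equivalent_norm N" for N
    by (rule bdd_aboveI[of _ 1]) (use d1[OF that] in blast)
  have dd: "delta l a x N \<le> delta_dot l a e N" if "equivalent_norm N" "block_basis UNIV e x" for x N
    unfolding delta_dot_def by (rule cSup_upper[OF _ bD[OF that(1)]]) (use that(2) in blast)
  have dd1: "delta_dot l a e N \<le> 1" if "equivalent_norm N" for N
    unfolding delta_dot_def by (rule cSup_least[OF D_ne]) (use d1[OF that] in blast)
  have DD_ne: "?DD \<noteq> {}" using equivalent_norm_norm by blast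
  have bDD: "bdd_above ?DD" by (rule bdd_aboveI[of _ 1]) (use dd1 in blast)
  have ddd: "delta_dot l a e N \<le> delta_ddot l a e" if "equivalent_norm N" for N
    unfolding delta_ddot_def by (rule cSup_upper[OF _ bDD]) (use that in blast)
  show ge0: "0 \<le> delta_ddot l a e"
    using d0[OF equivalent_norm_norm block_basis_self[OF e]] dd[OF equivalent_norm_norm block_basis_self[OF e]]
      ddd[OF equivalent_norm_norm] by linarith
  show "delta_ddot l a e \<le> 1"
    unfolding delta_ddot_def by (rule cSup_least[OF DD_ne]) (use dd1 in blast)
  show "d \<le> delta_ddot l a e" if g: "admits_lower_est e (schreier l a) d"
  proof (cases "0 \<le> d")
    case True
    obtain N x where Nx: "equivalent_norm N" "block_basis UNIV e x" "lower_est (schreier l a) x N d"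
      using g unfolding admits_lower_est_def by blast
    then have "d \<le> delta l a x N" using dS True by blast
    then show ?thesis using dd[OF Nx(1,2)] ddd[OF Nx(1)] by linarith
  qed (use ge0 in simp)
  show "admits_lower_est e (schreier l a) d" if d: "0 \<le> d" "d < delta_ddot l a e"
  proof -
    obtain N where N: "equivalent_norm N" "d < delta_dot l a e N"
      using less_cSupE[OF d(2)[unfolded delta_ddot_def] DD_ne] by blast
    obtain x where x: "block_basis UNIV e x" "d < delta l a x N"
      using less_cSupE[OF N(2)[unfolded delta_dot_def] D_ne] by blast
    have "?S x N \<noteq> {}" using S0[OF N(1)] by blast
    then obtain d' where d': "lower_est (schreier l a) x N d'" "d < d'"
      using less_cSupE[OF x(2)[unfolded delta[OF N(1) x(1)]]] by blast
    have "lower_est (schreier l a) x N d"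
      unfolding lower_est_def
    proof (intro ballI impI)
      fix A c assume Ac: "A \<in> schreier l a" "c \<in> fin_coeffs" "covers A {j. c j \<noteq> 0}"
      have "d * (\<Sum>a\<in>A. N (lin x (restr c (piece A UNIV a)))) \<le> d' * (\<Sum>a\<in>A. N (lin x (restr c (piece A UNIV a))))"
        using d'(2) by (intro mult_right_mono sum_nonneg equivalent_normD(4)[OF N(1)]) simp
      also have "\<dots> \<le> N (lin x c)" by (rule lower_estD[OF d'(1) Ac])
      finally show "d * (\<Sum>a\<in>A. N (lin x (restr c (piece A UNIV a)))) \<le> N (lin x c)" .
    qed
    then show ?thesis unfolding admits_lower_est_def using N(1) x(1) by blast
  qed
qed

text \<open>A subsequence of a block basis is again a block basis, and the norm is kept.\<close>

lemma admits_lower_est_spreads: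
  assumes "admits_lower_est e \<G> d" "spreads \<F> \<G>"
  shows "admits_lower_est e \<F> d"
proof -
  obtain N x where Nx: "equivalent_norm N" "block_basis UNIV e x" "lower_est \<G> x N d"
    using assms(1) unfolding admits_lower_est_def by blast
  obtain m :: "nat \<Rightarrow> nat" where m: "strict_mono m" "\<forall>F\<in>\<F>. m ` F \<in> \<G>"
    using assms(2) unfolding spreads_def by blast
  have "lower_est \<F> (\<lambda>i. x (m (Suc i) - 1)) N d"
    by (rule lower_est_spread[OF m(1) _ Nx(3)]) (use m(2) in blast)
  moreover have "block_basis UNIV e (\<lambda>i. x (m (Suc i) - 1))"
    by (rule block_subsequence[OF Nx(2) strict_mono_pred_Suc[OF m(1)]])
  ultimately show ?thesis unfolding admits_lower_est_def using Nx(1) by blast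
qed

lemma delta_ddot_antimono:
  assumes "a \<le> b"
  shows "delta_ddot l b e \<le> delta_ddot l a e"
proof (rule ccontr)
  assume "\<not> ?thesis"
  then obtain d where d: "delta_ddot l a e < d" "d < delta_ddot l b e" using dense by (auto simp: not_le)
  have "0 \<le> d" using d(1) delta_ddot_bounds(3)[of a] by linarith
  then have "admits_lower_est e (schreier l b) d" using delta_ddot_bounds(2) d(2) by blast
  then have "admits_lower_est e (schreier l a) d" using admits_lower_est_spreads spreads_schreier_mono[OF ladder assms] by blast
  then show False using delta_ddot_bounds(1)[of a d] d(1) by simp
qed

lemma lower_est_schreier_power:
  assumes "lower_est (schreier l a) x N d" "0 \<le> d" "N 0 = 0"
  shows "lower_est (schreier_power l a k) x N (d ^ k)"
proof (induction k)
  case 0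
  then show ?case using lower_est_schreier0[of N x] assms(3) by (simp add: schreier_power_rec[OF ladder])
next
  case (Suc k)
  show ?case using lower_est_conv[OF assms(1) Suc assms(2)] by (simp add: schreier_power_rec[OF ladder])
qed

lemma admits_lower_est_mult_nat:
  assumes "admits_lower_est e (schreier l a) d" "0 \<le> d"
  shows "admits_lower_est e (schreier l (a * ord_of_nat k)) (d ^ k)"
proof -
  obtain N x where Nx: "equivalent_norm N" "block_basis UNIV e x" "lower_est (schreier l a) x N d"
    using assms(1) unfolding admits_lower_est_def by blast
  then have "admits_lower_est e (schreier_power l a k) (d ^ k)"
    using lower_est_schreier_power[OF Nx(3) assms(2) equivalent_normD(3)[OF Nx(1)]] unfolding admits_lower_est_def by blast
  then show ?thesis using admits_lower_est_spreads spreads_mult_power[OF ladder] by blast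
qed

text \<open>Only pairs of vectors are needed from the asymptotic \<open>\<ell>\<^sub>1\<close> property: it bounds the initial and
  final projections uniformly over all block bases starting after the first basis vector.\<close>

lemma projections_bounded:
  assumes asy: "asymptotic_l1 e" and N: "equivalent_norm N"
  obtains C where "1 \<le> C"
    "\<And>x c n. block_basis UNIV e x \<Longrightarrow> (\<And>i. \<forall>j\<in>supp e (x i). 2 \<le> j) \<Longrightarrow> c \<in> fin_coeffs \<Longrightarrow>
      N (lin x (restr c {..<n})) \<le> C * N (lin x c) \<and> N (lin x (restr c {n..})) \<le> C * N (lin x c)"
proof -
  obtain C where C: "0 < C" "\<And>n y. 1 \<le> n \<Longrightarrow> block_basis {..<n} e y \<Longrightarrow> n \<le> Min (supp e (y 0)) \<Longrightarrow>
      (1 / C) * (\<Sum>i<n. norm (y i)) \<le> norm (\<Sum>i<n. y i)"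
    using asy unfolding asymptotic_l1_def by blast
  obtain c0 C0 where c0: "c0 > 0" "C0 > 0" "\<And>u. c0 * norm u \<le> N u" "\<And>u. N u \<le> C0 * norm u"
    using N unfolding equivalent_norm_def by blast
  \<comment> \<open>The quotient comes from changing to the original norm and back. The maximum with
    1 covers the case that u or v is zero, in which they do not form a block sequence.\<close>
  define D where "D = max 1 (C0 * C / c0)"
  have pair: "N u \<le> D * N (u + v)" "N v \<le> D * N (u + v)"
    if uv: "u \<in> span (range e)" "v \<in> span (range e)" "\<And>i j. i \<in> supp e u \<Longrightarrow> j \<in> supp e v \<Longrightarrow> i < j"
      "\<And>i. i \<in> supp e u \<Longrightarrow> 2 \<le> i" for u v
  proof -
    have triv: "N w \<le> D * N w" for w
      using mult_right_mono[of 1 D "N w"] equivalent_normD(4)[OF N] by (simp add: D_def)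
    have nn: "0 \<le> D * N w" for w using equivalent_normD(4)[OF N, of w] by (simp add: D_def)
    have "N u \<le> D * N (u + v) \<and> N v \<le> D * N (u + v)"
    proof (cases "u = 0 \<or> v = 0")
      case True
      then show ?thesis using triv nn equivalent_normD(3)[OF N] by auto
    next
      case False
      define y where "y i = (if i = 0 then u else v)" for i :: nat
      have lt2: "i = 0 \<or> i = 1" if "i < 2" for i :: nat using that by auto
      have fin: "finite (supp e u)" "finite (supp e v)" using finite_supp[OF e] uv(1,2) by blast+
      have "block_basis {..<2} e y"
        unfolding block_basis_def
      proof (intro conjI ballI impI)
        fix i j :: nat assume "i \<in> {..<2}" "j \<in> {..<2}" "i < j"
        then have "i = 0" "j = 1" by auto
        then show "set_less (supp e (y i)) (supp e (y j))"
          using set_lessI[OF fin uv(3)] by (simp add: y_def)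
      qed (use uv False in \<open>auto simp: y_def\<close>)
      moreover have "2 \<le> Min (supp e (y 0))"
        using fin supp_nonempty[OF e uv(1)] uv(4) False by (simp add: y_def)
      ultimately have "(1 / C) * (\<Sum>i<2. norm (y i)) \<le> norm (\<Sum>i<2. y i)" by (intro C(2)) simp_all
      then have "(norm u + norm v) / C \<le> norm (u + v)" by (simp add: y_def numeral_2_eq_2)
      then have sum: "norm u + norm v \<le> C * norm (u + v)" using C(1) by (simp add: field_simps)
      have "N w \<le> D * N (u + v)" if "norm w \<le> C * norm (u + v)" for w
      proof -
        have le: "norm (u + v) \<le> N (u + v) / c0" using c0(1) c0(3)[of "u + v"] by (simp add: field_simps)
        have "N w \<le> C0 * (C * norm (u + v))"
          using c0(4)[of w] mult_left_mono[OF that, of C0] c0(2) by linarith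
        also have "\<dots> \<le> C0 * (C * (N (u + v) / c0))"
          using c0(2) C(1) by (intro mult_left_mono le) simp_all
        also have "\<dots> = C0 * C / c0 * N (u + v)" by simp
        also have "\<dots> \<le> D * N (u + v)"
          using equivalent_normD(4)[OF N, of "u + v"] by (intro mult_right_mono) (simp_all add: D_def)
        finally show ?thesis .
      qed
      then show ?thesis using sum norm_ge_zero[of u] norm_ge_zero[of v] by (simp del: norm_ge_zero)
    qed
    then show "N u \<le> D * N (u + v)" "N v \<le> D * N (u + v)" by blast+
  qed
  have main: "N (lin x (restr c {..<n})) \<le> D * N (lin x c) \<and> N (lin x (restr c {n..})) \<le> D * N (lin x c)"
    if x: "block_basis UNIV e x" and x2: "\<And>i. \<forall>j\<in>supp e (x i). 2 \<le> j" and c: "c \<in> fin_coeffs" for x c n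
  proof -
    let ?u = "lin x (restr c {..<n})" and ?v = "lin x (restr c {n..})"
    have "x i \<in> span (range e)" for i using x by (simp add: block_basis_def)
    then have sp: "lin x d \<in> span (range e)" for d unfolding lin_def by (intro span_sum span_scale)
    have su: "supp e (lin x (restr c E)) = (\<Union>j\<in>{j. restr c E j \<noteq> 0}. supp e (x (j - 1)))" for E
      by (rule supp_block_lin[OF e x fin_coeffs_restr[OF c]])
    have c0: "c 0 = 0" using c by (simp add: fin_coeffs_def)
    have "c = (\<lambda>j. restr c {..<n} j + restr c {n..} j)" by (auto simp: restr_def)
    then have eq: "?u + ?v = lin x c"
      using lin_add[OF fin_coeffs_restr[OF c, of "{..<n}"] fin_coeffs_restr[OF c, of "{n..}"], of x] by simp
    have less: "k < m" if "k \<in> supp e ?u" "m \<in> supp e ?v" for k m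
    proof -
      obtain i where i: "restr c {..<n} i \<noteq> 0" "k \<in> supp e (x (i - 1))" using \<open>k \<in> _\<close> su by blast
      obtain j where j: "restr c {n..} j \<noteq> 0" "m \<in> supp e (x (j - 1))" using \<open>m \<in> _\<close> su by blast
      have "i < n" "c i \<noteq> 0" using i(1) by (auto simp: restr_def split: if_splits)
      moreover have "n \<le> j" using j(1) by (auto simp: restr_def split: if_splits)
      moreover have "i \<noteq> 0" using \<open>c i \<noteq> 0\<close> c0 by metis
      ultimately have "i - 1 < j - 1" by linarith
      then show ?thesis by (rule block_supp_less[OF e x _ i(2) j(2)])
    qed
    have two: "2 \<le> k" if "k \<in> supp e ?u" for k using that su x2 by blast
    have "N ?u \<le> D * N (?u + ?v)" "N ?v \<le> D * N (?u + ?v)"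
      by (rule pair[OF sp sp], erule (1) less, erule two)+
    then show ?thesis unfolding eq by (rule conjI)
  qed
  show ?thesis by (rule that[of D]) (simp add: D_def, rule main)
qed

text \<open>The norm and the block basis are fixed first, so that the constant \<open>C\<^sup>2\<close> lost in the renorming disappears in the limit of large powers.\<close>

lemma admits_lower_est_root:
  assumes asy: "asymptotic_l1 e" and k: "1 \<le> k"
    and admits_lower_est: "admits_lower_est e (schreier l (a * ord_of_nat k)) (\<eta> ^ k)" and \<rho>: "0 < \<rho>" "\<rho> < \<eta>"
  shows "admits_lower_est e (schreier l a) \<rho>"
proof -
  let ?b = "a * ord_of_nat k"
  obtain N x where N: "equivalent_norm N" and x: "block_basis UNIV e x" and lower_est: "lower_est (schreier l ?b) x N (\<eta> ^ k)"
    using admits_lower_est unfolding admits_lower_est_def by blast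
  obtain C where C: "1 \<le> C"
    "\<And>x c n. block_basis UNIV e x \<Longrightarrow> (\<And>i. \<forall>j\<in>supp e (x i). 2 \<le> j) \<Longrightarrow> c \<in> fin_coeffs \<Longrightarrow>
      N (lin x (restr c {..<n})) \<le> C * N (lin x c) \<and> N (lin x (restr c {n..})) \<le> C * N (lin x c)"
    using projections_bounded[OF asy N] by metis
  have "1 < \<eta> / \<rho>" using \<rho> by simp
  \<comment> \<open>One factor C will pay for cutting intervals out of pieces, the other for
    discarding the coefficients before the first interval. The powers of the quotient outgrow
    both.\<close>
  then obtain m0 where "C ^ 2 < (\<eta> / \<rho>) ^ m0" using real_arch_pow by blast
  \<comment> \<open>The successor keeps m, and with it K, positive: the average needs at least one
    term.\<close>
  define m where "m = Suc m0"
  define K where "K = k * m"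
  have "1 * m \<le> k * m" by (rule mult_right_mono[OF k]) simp
  then have "m0 \<le> K" "1 \<le> K" by (simp_all add: K_def m_def)
  then have "(\<eta> / \<rho>) ^ m0 \<le> (\<eta> / \<rho>) ^ K" using \<open>1 < \<eta> / \<rho>\<close> by (intro power_increasing) simp_all
  then have "C ^ 2 \<le> (\<eta> / \<rho>) ^ K" using \<open>C ^ 2 < _\<close> by simp
  then have C2: "C ^ 2 * \<rho> ^ K \<le> \<eta> ^ K" using \<rho> by (simp add: power_divide field_simps)
  \<comment> \<open>The K-fold convolution of the small class and the m-fold one of the large class
    belong to the same index, so the first spreads into the second.\<close>
  have "spreads (schreier_power l a K) (schreier l (a * ord_of_nat K))" by (rule spreads_power_mult[OF ladder])
  moreover have "a * ord_of_nat K = ?b * ord_of_nat m" unfolding K_def cord_mult_nat_assoc ..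
  ultimately have "spreads (schreier_power l a K) (schreier_power l ?b m)"
    using spreads_mult_power[OF ladder, of ?b m] spreads_trans by simp
  then obtain s :: "nat \<Rightarrow> nat" where s: "strict_mono s" "\<And>F. F \<in> schreier_power l a K \<Longrightarrow> s ` F \<in> schreier_power l ?b m"
    unfolding spreads_def by blast
  \<comment> \<open>The shift by one skips the first vector of x. All supports of z then lie at 2 or
    beyond, where the projections are bounded.\<close>
  define t where "t i = Suc (s i)" for i
  have t: "strict_mono t" using s(1) by (simp add: t_def strict_mono_def)
  have tF: "t ` F \<in> schreier_power l ?b m" if "F \<in> schreier_power l a K" for F
    by (rule regular_spread_more[OF regular_schreier_power[OF ladder] s(2)[OF that] s(1) t]) (simp add: t_def)
  define z where "z i = x (t (Suc i) - 1)" for i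
  have z: "block_basis UNIV e z"
    unfolding z_def by (rule block_subsequence[OF x strict_mono_pred_Suc[OF t]])
  have z2: "\<forall>j\<in>supp e (z i). 2 \<le> j" for i
  proof
    fix j assume j: "j \<in> supp e (z i)"
    have x0: "x 0 \<in> span (range e)" "x 0 \<noteq> 0" using x by (simp_all add: block_basis_def)
    obtain j0 where j0: "j0 \<in> supp e (x 0)" using supp_nonempty[OF e x0] by blast
    have "Suc i \<le> s (Suc i)" by (rule strict_mono_imp_increasing[OF s(1)])
    then have "0 < t (Suc i) - 1" by (simp add: t_def)
    then have "j0 < j" by (rule block_supp_less[OF e x _ j0 j[unfolded z_def]])
    moreover have "j0 \<noteq> 0" using j0 zero_notin_supp by metis
    ultimately show "2 \<le> j" by simp
  qed
  have "lower_est (schreier_power l ?b m) x N ((\<eta> ^ k) ^ m)"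
    by (rule lower_est_schreier_power[OF lower_est _ equivalent_normD(3)[OF N]]) (use \<rho> in simp)
  then have lowz: "lower_est (schreier_power l a K) z N (\<eta> ^ K)"
    unfolding z_def by (intro lower_est_spread[OF t tF]) (simp_all add: K_def power_mult)
  note zi = block_lin_indep[OF e z]
  note reg = regular_schreier_power[OF ladder, of a K]
  have "\<exists>N'. equivalent_norm N' \<and> lower_est (schreier l a) z N' \<rho>"
  proof (rule renorm[OF N zi regular_schreier[OF ladder] \<rho>(1) \<open>1 \<le> K\<close>])
    fix A q c assume "A \<in> (conv (schreier l a) ^^ K) schreier0" and q: "gaps A q" and c: "c \<in> fin_coeffs"
    then have A: "A \<in> schreier_power l a K" by (simp add: schreier_power_def[OF ladder])
    show "\<rho> ^ K * gap_sum N z c A q \<le> N (lin z c)"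
    proof (cases "A = {}")
      case True
      then show ?thesis using equivalent_normD(4)[OF N] by (simp add: gap_sum_def)
    next
      case False
      have finA: "finite A" by (rule regularD(1)[OF reg A])
      \<comment> \<open>A need not cover the support of c; without the coefficients before
        \<open>Min A\<close> the lower estimate becomes applicable.\<close>
      let ?c = "restr c {Min A..}"
      have pc: "restr ?c (piece A UNIV a) = restr c (piece A UNIV a)" if "a \<in> A" for a
        unfolding restr_restr
      proof (rule restr_cong)
        fix j
        have "Min A \<le> a" using finA that by simp
        then show "j \<in> {Min A..} \<inter> piece A UNIV a \<longleftrightarrow> j \<in> piece A UNIV a"
          by (auto simp: piece_def)
      qed
      \<comment> \<open>Within its piece the interval is an initial segment, so a single initial
        projection cuts it out.\<close>
      have iv: "restr c {a..q a} = restr (restr c (piece A UNIV a)) {..<Suc (q a)}" if a: "a \<in> A" for a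
        unfolding restr_restr
      proof (rule restr_cong)
        fix j
        have "b \<le> a" if "b \<in> A" "b \<le> j" "j \<le> q a" for b
        proof (rule ccontr)
          assume "\<not> b \<le> a"
          then have "q a < b" using q a that(1) by (simp add: gaps_def)
          then show False using that by simp
        qed
        then show "j \<in> {a..q a} \<longleftrightarrow> j \<in> piece A UNIV a \<inter> {..<Suc (q a)}" by (auto simp: piece_def)
      qed
      have "gap_sum N z c A q \<le> (\<Sum>a\<in>A. C * N (lin z (restr ?c (piece A UNIV a))))"
        unfolding gap_sum_def
      proof (rule sum_mono)
        fix a assume a: "a \<in> A"
        show "N (lin z (restr c {a..q a})) \<le> C * N (lin z (restr ?c (piece A UNIV a)))"
          unfolding iv[OF a] pc[OF a] using C(2)[OF z z2 fin_coeffs_restr[OF c]] by blast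
      qed
      then have 1: "gap_sum N z c A q \<le> C * (\<Sum>a\<in>A. N (lin z (restr ?c (piece A UNIV a))))" (is "_ \<le> C * ?s")
        by (simp add: sum_distrib_left)
      have "covers A {j. ?c j \<noteq> 0}"
        unfolding covers_def using Min_in[OF finA False] by (auto simp: restr_def split: if_splits)
      then have 2: "\<eta> ^ K * ?s \<le> N (lin z ?c)" by (rule lower_estD[OF lowz A fin_coeffs_restr[OF c]])
      have 3: "N (lin z ?c) \<le> C * N (lin z c)" using C(2)[OF z z2 c] by blast
      have s0: "0 \<le> ?s" by (intro sum_nonneg equivalent_normD(4)[OF N])
      have "C * (\<rho> ^ K * gap_sum N z c A q) \<le> C * (\<rho> ^ K * (C * ?s))"
        using 1 C(1) \<rho> by (intro mult_left_mono) simp_all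
      also have "\<dots> = C ^ 2 * \<rho> ^ K * ?s" by (simp add: power2_eq_square)
      also have "\<dots> \<le> \<eta> ^ K * ?s" by (rule mult_right_mono[OF C2 s0])
      also have "\<dots> \<le> C * N (lin z c)" using 2 3 by linarith
      finally show ?thesis using C(1) by simp
    qed
  qed
  then show ?thesis unfolding admits_lower_est_def using z by blast
qed

text \<open>As suprema may not be attained, both inequalities are proved with smaller constants. For
  the upper one two numbers are placed between f(a) and the k-th root, because
  \<open>admits_lower_est_root\<close> loses a little; for the lower one the k-th power is
  continuous.\<close>

lemma delta_ddot_mult_nat:
  assumes "asymptotic_l1 e"
  shows "delta_ddot l (a * ord_of_nat k) e = delta_ddot l a e ^ k"
proof (rule antisym)
  let ?f = "\<lambda>a. delta_ddot l a e"
  have f0: "0 \<le> ?f a" for a by (rule delta_ddot_bounds(3))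
  show "?f (a * ord_of_nat k) \<le> ?f a ^ k"
  proof (cases "k = 0")
    case True
    then show ?thesis using delta_ddot_bounds(4) by simp
  next
    case False
    show ?thesis
    proof (rule ccontr)
      assume "\<not> ?thesis"
      then have less: "?f a ^ k < ?f (a * ord_of_nat k)" by simp
      define t where "t = root k (?f (a * ord_of_nat k))"
      have t: "t ^ k = ?f (a * ord_of_nat k)" using False f0 by (simp add: t_def)
      have t0: "0 \<le> t" unfolding t_def by (rule real_root_ge_zero[OF f0])
      have "?f a < t" using less t t0 by (metis power_less_imp_less_base)
      then obtain \<rho> where \<rho>: "?f a < \<rho>" "\<rho> < t" using dense by blast
      then obtain \<eta> where \<eta>: "\<rho> < \<eta>" "\<eta> < t" using dense by blast
      have pos: "0 < \<rho>" "0 < \<eta>" using \<rho> \<eta> f0[of a] by linarith+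
      have "\<eta> ^ k < ?f (a * ord_of_nat k)"
        unfolding t[symmetric] using \<eta>(2) pos False by (intro power_strict_mono) simp_all
      then have "admits_lower_est e (schreier l (a * ord_of_nat k)) (\<eta> ^ k)"
        using delta_ddot_bounds(2) pos by simp
      moreover have "1 \<le> k" using False by simp
      ultimately have "admits_lower_est e (schreier l a) \<rho>" using admits_lower_est_root[OF assms _ _ pos(1) \<eta>(1), of k a] by blast
      then have "\<rho> \<le> ?f a" by (rule delta_ddot_bounds(1))
      then show False using \<rho>(1) by simp
    qed
  qed
  show "?f a ^ k \<le> ?f (a * ord_of_nat k)"
  proof (rule ccontr)
    assume "\<not> ?thesis"
    then have less: "?f (a * ord_of_nat k) < ?f a ^ k" by simp
    have "((\<lambda>d. d ^ k) \<longlongrightarrow> ?f a ^ k) (at_left (?f a))" by (intro tendsto_intros)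
    then have ev: "eventually (\<lambda>d. ?f (a * ord_of_nat k) < d ^ k) (at_left (?f a))"
      using less by (rule order_tendstoD(1))
    show False
    \<comment> \<open>At 0 there is no smaller nonnegative constant; there the constant 0, which is
      always realised, is used itself.\<close>
    proof (cases "?f a = 0")
      case True
      have "admits_lower_est e (schreier l a) 0"
        unfolding admits_lower_est_def using lower_est_0[OF equivalent_norm_norm] block_basis_self[OF e] equivalent_norm_norm by blast
      then have "0 ^ k \<le> ?f (a * ord_of_nat k)"
        using admits_lower_est_mult_nat[of a 0 k] delta_ddot_bounds(1) by simp
      then show False using less True by simp
    next
      case False
      then have "eventually (\<lambda>d. d \<in> {0<..<?f a}) (at_left (?f a))"
        using f0[of a] by (intro eventually_at_leftI[of 0]) auto
      with ev have "eventually (\<lambda>d. ?f (a * ord_of_nat k) < d ^ k \<and> d \<in> {0<..<?f a}) (at_left (?f a))"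
        by (rule eventually_conj)
      then obtain d where d: "?f (a * ord_of_nat k) < d ^ k" "0 < d" "d < ?f a"
        using eventually_happens'[OF trivial_limit_at_left_real] by fastforce
      have "admits_lower_est e (schreier l (a * ord_of_nat k)) (d ^ k)"
        using admits_lower_est_mult_nat delta_ddot_bounds(2) d by simp
      then have "d ^ k \<le> ?f (a * ord_of_nat k)" by (rule delta_ddot_bounds(1))
      then show False using d(1) by simp
    qed
  qed
qed

end

section \<open>Bourgain's index argument\<close>

text \<open>\<open>rank_ge D T a s\<close>: the tree \<open>T\<close> of finite sequences in \<open>D\<close> has rank at least \<open>a\<close> at the node \<open>s\<close>.\<close>

inductive rank_ge :: "'a set \<Rightarrow> ('a list \<Rightarrow> bool) \<Rightarrow> cord \<Rightarrow> 'a list \<Rightarrow> bool"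
  for D T where
  rank_geI: "T s \<Longrightarrow> (\<And>b. b < a \<Longrightarrow> \<exists>d\<in>D. rank_ge D T b (s @ [d])) \<Longrightarrow> rank_ge D T a s"

lemma rank_geD:
  assumes "rank_ge D T a s"
  shows "T s" "b < a \<Longrightarrow> \<exists>d\<in>D. rank_ge D T b (s @ [d])"
  using assms by (auto elim: rank_ge.cases)

lemma rank_ge_mono:
  assumes "rank_ge D T a s" "b \<le> a"
  shows "rank_ge D T b s"
proof (rule rank_geI)
  show "T s" by (rule rank_geD(1)[OF assms(1)])
  show "\<exists>d\<in>D. rank_ge D T c (s @ [d])" if "c < b" for c
    by (rule rank_geD(2)[OF assms(1)]) (use that assms(2) in simp)
qed

text \<open>If the rank of every extension were bounded, the countably many bounds would lie below
  one countable ordinal b, although the rank at s is at least the successor of b.\<close>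

lemma rank_unbounded_extend:
  assumes "countable D" "\<And>a. rank_ge D T a s"
  shows "\<exists>d\<in>D. \<forall>a. rank_ge D T a (s @ [d])"
proof (rule ccontr)
  assume "\<not> ?thesis"
  then have "\<forall>d\<in>D. \<exists>a. \<not> rank_ge D T a (s @ [d])" by blast
  from bchoice[OF this] obtain r where r: "\<forall>d\<in>D. \<not> rank_ge D T (r d) (s @ [d])" ..
  obtain b where b: "\<forall>a\<in>r ` D. a < b"
    using countable_bounded[OF countable_image[OF assms(1)]] by blast
  obtain d where d: "d \<in> D" "rank_ge D T b (s @ [d])"
    using rank_geD(2)[OF assms(2) osucc_greater] by blast
  have "r d \<le> b" using b d(1) by auto
  then show False using rank_ge_mono[OF d(2)] r d(1) by blast
qed

lemma rank_unbounded_branch: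
  assumes "countable D" "\<And>a. rank_ge D T a []"
  obtains u where "\<And>n. T (map u [0..<n])"
proof -
  have "\<exists>f. \<forall>n. (\<forall>a. rank_ge D T a (f n)) \<and> (\<exists>d. f (Suc n) = f n @ [d]) \<and> (n = 0 \<longrightarrow> f n = [])"
  proof -
    let ?step = "\<lambda>s. s @ [SOME d. \<forall>a. rank_ge D T a (s @ [d])]"
    let ?f = "rec_nat [] (\<lambda>_. ?step)"
    have "\<forall>a. rank_ge D T a (?f n)" for n
    proof (induction n)
      case (Suc n)
      then have "\<exists>d. \<forall>a. rank_ge D T a (?f n @ [d])" using rank_unbounded_extend[OF assms(1), of T "?f n"] by blast
      from someI_ex[OF this] show ?case by simp
    qed (simp add: assms(2))
    then show ?thesis by (intro exI[of _ ?f]) simp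
  qed
  then obtain f where f: "\<And>n a. rank_ge D T a (f n)" "\<And>n. \<exists>d. f (Suc n) = f n @ [d]" "f 0 = []" by blast
  define u where "u n = last (f (Suc n))" for n
  have "f n = map u [0..<n]" for n
  proof (induction n)
    case (Suc n)
    obtain d where d: "f (Suc n) = f n @ [d]" using f(2) by blast
    then have "u n = d" by (simp add: u_def)
    then show ?case using d Suc by simp
  qed (simp add: f(3))
  then have "T (map u [0..<n])" for n using rank_geD(1)[OF f(1)[of _ n]] by simp
  then show ?thesis by (rule that)
qed

lemma sorted_list_of_set_insert_least:
  fixes k :: nat
  assumes "finite F" "\<forall>x\<in>F. k < x"
  shows "sorted_list_of_set (insert k F) = k # sorted_list_of_set F"
proof -
  have "k \<notin> F" using assms(2) by auto
  then have "sorted_list_of_set (insert k F) = insort k (sorted_list_of_set F)"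
    using assms(1) by (simp add: sorted_list_of_set_insert_remove)
  also have "\<dots> = k # sorted_list_of_set F" using assms by (intro insort_is_Cons) (simp add: less_imp_le)
  finally show ?thesis .
qed

text \<open>The Schreier sets of index a, ordered by end extension, form a tree of rank at least a:
  putting one element in front of sets of index a leads to index a + 1. The bound m lets the
  induction restart beyond the elements already used.\<close>

lemma rank_ge_schreier:
  assumes ladder: "ladder_system l" and d: "\<And>j. d j \<in> D"
    and T: "\<And>F. F \<in> schreier l a \<Longrightarrow> \<forall>x\<in>F. m \<le> x \<Longrightarrow> T (s @ map d (sorted_list_of_set F))"
  shows "rank_ge D T a s"
  using T
proof (induction a arbitrary: m s rule: cord_induct)
  case zero
  have "T s" using zero[OF regularD(6)[OF regular_schreier[OF ladder]]] by simp
  then show ?case by (rule rank_geI) (use zero_le_cord leD in blast)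
next
  case (succ a)
  have "T s" using succ(2)[OF regularD(6)[OF regular_schreier[OF ladder]]] by simp
  moreover have "\<exists>x\<in>D. rank_ge D T b (s @ [x])" if b: "b < osucc a" for b
  proof -
    \<comment> \<open>From 2 on, \<open>schreier1\<close> admits two minima, here those of the
      blocks {k} and F.\<close>
    define k where "k = max m 2"
    have "rank_ge D T a (s @ [d k])"
    proof (rule succ(1)[of "Suc k"])
      fix F assume F: "F \<in> schreier l a" and Fk: "\<forall>x\<in>F. Suc k \<le> x"
      have fin: "finite F" by (rule regularD(1)[OF regular_schreier[OF ladder] F])
      have k1: "{k} \<in> schreier l a" by (rule regularD(5)[OF regular_schreier[OF ladder]]) (simp add: k_def)
      have "insert k F \<in> conv schreier1 (schreier l a)"
      proof (cases "F = {}")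
        case True
        then show ?thesis
          using regular_subset_conv[OF regular_schreier1 regular_schreier[OF ladder]] k1 by auto
      next
        case False
        have mF: "Min F \<in> F" "\<And>x. x \<in> F \<Longrightarrow> Min F \<le> x" using fin False by simp_all
        have kF: "k < Min F" using Fk mF(1) by auto
        have p1: "piece {k, Min F} (insert k F) k = {k}"
          using kF mF(2) Fk by (force simp: piece_def)
        have p2: "piece {k, Min F} (insert k F) (Min F) = F"
          using kF mF(2) Fk by (force simp: piece_def)
        show ?thesis
        proof (rule convI[of "{k, Min F}"])
          have "2 \<le> k" by (simp add: k_def)
          then have "card {k, Min F} \<le> k" by (simp add: card_insert_if)
          then show "{k, Min F} \<in> schreier1" using kF by (simp add: schreier1_def)
          show "covers {k, Min F} (insert k F)" using mF(2) by (auto simp: covers_def)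
          show "piece {k, Min F} (insert k F) x \<in> schreier l a" if "x \<in> {k, Min F}" for x
            using that p1 p2 k1 F by auto
        qed (use mF fin in auto)
      qed
      then have "insert k F \<in> schreier l (osucc a)" unfolding schreier_osucc[OF ladder] .
      moreover have "\<forall>x\<in>insert k F. m \<le> x" using Fk by (auto simp: k_def)
      ultimately have "T (s @ map d (sorted_list_of_set (insert k F)))" by (rule succ(2))
      moreover have "sorted_list_of_set (insert k F) = k # sorted_list_of_set F"
        by (rule sorted_list_of_set_insert_least[OF fin]) (use Fk in auto)
      ultimately show "T ((s @ [d k]) @ map d (sorted_list_of_set F))" by simp
    qed
    then have "rank_ge D T b (s @ [d k])" by (rule rank_ge_mono) (use b in \<open>simp add: less_osucc_iff\<close>)
    then show ?thesis using d by blast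
  qed
  ultimately show ?case by (rule rank_geI)
next
  case (limit c)
  have "T s" using limit(3)[OF regularD(6)[OF regular_schreier[OF ladder]]] by simp
  moreover have "\<exists>x\<in>D. rank_ge D T b (s @ [x])" if b: "b < c" for b
  proof -
    obtain n where n: "1 \<le> n" "b < l c n" using ladder_cofinal[OF ladder limit(1) b] by blast
    have "rank_ge D T (l c n) s"
    proof (rule limit(2)[OF ladder_less[OF ladder limit(1) n(1)], of "max m n"])
      fix F assume F: "F \<in> schreier l (l c n)" and Fm: "\<forall>x\<in>F. max m n \<le> x"
      then have "F \<in> schreier l c" unfolding schreier_rec(4)[OF ladder limit(1)] using n(1) by auto
      then show "T (s @ map d (sorted_list_of_set F))" by (rule limit(3)) (use Fm in auto)
    qed
    then show ?thesis by (rule rank_geD(2)) (rule n(2))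
  qed
  ultimately show ?case by (rule rank_geI)
qed

text \<open>Completeness makes the series converge for coefficients in l1, and the estimate for
  finite sums passes to the limit.\<close>

lemma contains_l1I:
  fixes u :: "nat \<Rightarrow> 'a::banach"
  assumes \<rho>: "0 < \<rho>" and M: "0 < M" "\<And>i. norm (u i) \<le> M"
    and lower_est: "\<And>n a. \<rho> * (\<Sum>i<n. \<bar>a i\<bar>) \<le> norm (\<Sum>i<n. a i *\<^sub>R u i)"
  shows "contains_l1 TYPE('a)"
proof -
  define T where "T a = (\<Sum>i. a i *\<^sub>R u i)" for a :: "nat \<Rightarrow> real"
  have le: "norm (a i *\<^sub>R u i) \<le> M * \<bar>a i\<bar>" for a i
    using mult_left_mono[OF M(2)[of i], of "\<bar>a i\<bar>"] by (simp add: mult.commute)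
  have sm: "summable (\<lambda>i. M * \<bar>a i\<bar>)" if "a \<in> l1" for a using that by (simp add: l1_def summable_mult)
  have sn: "summable (\<lambda>i. norm (a i *\<^sub>R u i))" if "a \<in> l1" for a
    by (rule summable_comparison_test'[OF sm[OF that], of 0]) (use le in simp)
  have s: "summable (\<lambda>i. a i *\<^sub>R u i)" if "a \<in> l1" for a by (rule summable_norm_cancel[OF sn[OF that]])
  have add: "T (\<lambda>i. a i + b i) = T a + T b" if "a \<in> l1" "b \<in> l1" for a b
    unfolding T_def scaleR_left_distrib by (rule suminf_add[OF s[OF that(1)] s[OF that(2)], symmetric])
  have scale: "T (\<lambda>i. r * a i) = r *\<^sub>R T a" if "a \<in> l1" for r a
    unfolding T_def using suminf_scaleR_right[OF s[OF that], of r] by simp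
  have upper: "norm (T a) \<le> M * l1_norm a" if a: "a \<in> l1" for a
  proof -
    have "norm (T a) \<le> (\<Sum>i. norm (a i *\<^sub>R u i))" unfolding T_def by (rule summable_norm[OF sn[OF a]])
    also have "\<dots> \<le> (\<Sum>i. M * \<bar>a i\<bar>)" by (intro suminf_le le sn sm a)
    also have "\<dots> = M * l1_norm a" unfolding l1_norm_def using a by (intro suminf_mult) (simp add: l1_def)
    finally show ?thesis .
  qed
  have lower: "\<rho> * l1_norm a \<le> norm (T a)" if a: "a \<in> l1" for a
  proof (rule LIMSEQ_le)
    show "(\<lambda>n. \<rho> * (\<Sum>i<n. \<bar>a i\<bar>)) \<longlonglongrightarrow> \<rho> * l1_norm a"
      unfolding l1_norm_def using a by (intro tendsto_intros summable_LIMSEQ) (simp add: l1_def)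
    show "(\<lambda>n. norm (\<Sum>i<n. a i *\<^sub>R u i)) \<longlonglongrightarrow> norm (T a)"
      unfolding T_def by (intro tendsto_intros summable_LIMSEQ s a)
    show "\<exists>N. \<forall>n\<ge>N. \<rho> * (\<Sum>i<n. \<bar>a i\<bar>) \<le> norm (\<Sum>i<n. a i *\<^sub>R u i)" using lower_est by blast
  qed
  show ?thesis unfolding contains_l1_def
    by (intro exI[of _ T] exI[of _ \<rho>] exI[of _ M] conjI ballI allI add scale upper lower \<rho> M(1))
qed

text \<open>The tree argument needs a countable alphabet; rational combinations provide it.\<close>

lemma span_range_countable_dense:
  fixes e :: "nat \<Rightarrow> 'a::real_normed_vector"
  obtains D where "countable D" "\<And>v \<epsilon>. v \<in> span (range e) \<Longrightarrow> 0 < \<epsilon> \<Longrightarrow> \<exists>d\<in>D. norm (d - v) < \<epsilon>"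
proof -
  define g where "g xs = (\<Sum>(q, i)\<leftarrow>xs. of_rat q *\<^sub>R e i)" for xs :: "(rat \<times> nat) list"
  have "\<exists>xs. norm (g xs - v) < \<epsilon>" if "v \<in> span (range e)" "0 < \<epsilon>" for v \<epsilon>
    using that
  proof (induction arbitrary: \<epsilon> rule: span_induct_alt)
    case base
    then show ?case by (intro exI[of _ "[]"]) (simp add: g_def)
  next
    case (step r y z)
    then obtain i where i: "y = e i" by blast
    obtain xs where xs: "norm (g xs - z) < \<epsilon> / 2" using step(2)[of "\<epsilon> / 2"] step(3) by auto
    \<comment> \<open>The added 1 avoids a division by zero if \<open>e i\<close> vanishes.\<close>
    have "r < r + \<epsilon> / (2 * (norm (e i) + 1))" using step(3) by (simp add: add_nonneg_pos)
    then obtain q where q: "r < of_rat q" "of_rat q < r + \<epsilon> / (2 * (norm (e i) + 1))"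
      using of_rat_dense by blast
    have "norm (of_rat q *\<^sub>R e i - r *\<^sub>R e i) = (of_rat q - r) * norm (e i)"
      using q(1) by (simp flip: scaleR_diff_left)
    also have "\<dots> \<le> \<epsilon> / (2 * (norm (e i) + 1)) * (norm (e i) + 1)"
      using q step(3) by (intro mult_mono) (auto simp: add_nonneg_pos)
    also have "\<dots> = \<epsilon> / 2" using norm_ge_zero[of "e i"] by (simp add: field_simps add_nonneg_eq_0_iff)
    finally have 1: "norm (of_rat q *\<^sub>R e i - r *\<^sub>R e i) \<le> \<epsilon> / 2" .
    have eq: "g ((q, i) # xs) - (r *\<^sub>R y + z) = (of_rat q *\<^sub>R e i - r *\<^sub>R e i) + (g xs - z)"
      by (simp add: g_def i)
    have "norm (g ((q, i) # xs) - (r *\<^sub>R y + z))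
        \<le> norm (of_rat q *\<^sub>R e i - r *\<^sub>R e i) + norm (g xs - z)"
      unfolding eq by (rule norm_triangle_ineq)
    then have "norm (g ((q, i) # xs) - (r *\<^sub>R y + z)) < \<epsilon>" using 1 xs by linarith
    then show ?case by blast
  qed
  then show ?thesis by (intro that[of "range g"]) (auto intro: countable_image)
qed

text \<open>Unlike in \<open>lin\<close>, the vectors are numbered so that the members of A index
  them directly.\<close>

definition l1_below :: "real \<Rightarrow> cord \<Rightarrow> (cord \<Rightarrow> nat \<Rightarrow> cord) \<Rightarrow> (nat \<Rightarrow> 'a::real_normed_vector) \<Rightarrow> bool"
  where "l1_below \<rho> a l z \<longleftrightarrow> (\<forall>A\<in>schreier l a. \<forall>t :: nat \<Rightarrow> real.
    \<rho> * (\<Sum>j\<in>A. \<bar>t j\<bar>) \<le> norm (\<Sum>j\<in>A. t j *\<^sub>R z j))"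

text \<open>Single vectors taken as blocks turn the lower estimate into an l1-estimate. Changing
  from N to the original norm leaves c0 / (2 C0), which is rounded down to the reciprocal of an
  integer, so that only countably many constants occur.\<close>

lemma admits_lower_est_imp_l1_below:
  assumes ladder: "ladder_system l" and e: "lin_indep e" and admits_lower_est: "admits_lower_est e (schreier l a) (1 / 2)"
  shows "\<exists>n z. (\<forall>j. z j \<in> span (range e) \<and> norm (z j) = 1) \<and> l1_below (inverse (real (Suc n))) a l z"
proof -
  obtain N x where N: "equivalent_norm N" and x: "block_basis UNIV e x" and lower_est: "lower_est (schreier l a) x N (1 / 2)"
    using admits_lower_est unfolding admits_lower_est_def by blast
  obtain c0 C0 where c0: "c0 > 0" "C0 > 0" "\<And>u. c0 * norm u \<le> N u" "\<And>u. N u \<le> C0 * norm u"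
    using N unfolding equivalent_norm_def by blast
  define z where "z j = inverse (norm (x (j - 1))) *\<^sub>R x (j - 1)" for j
  have xs: "x i \<in> span (range e)" "x i \<noteq> 0" for i using x by (simp_all add: block_basis_def)
  have z1: "norm (z j) = 1" for j using xs(2) by (simp add: z_def)
  have zs: "z j \<in> span (range e)" for j unfolding z_def by (rule span_scale[OF xs(1)])
  have "0 < c0 / (2 * C0)" using c0 by simp
  then obtain n where n: "inverse (real (Suc n)) < c0 / (2 * C0)" using reals_Archimedean by blast
  have "l1_below (inverse (real (Suc n))) a l z"
    unfolding l1_below_def
  proof (intro ballI allI)
    fix A and t :: "nat \<Rightarrow> real" assume A: "A \<in> schreier l a"
    note reg = regular_schreier[OF ladder, of a]
    have fin: "finite A" and A0: "0 \<notin> A" using regularD(1,2)[OF reg A] by simp_all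
    define c where "c j = (if j \<in> A then t j * inverse (norm (x (j - 1))) else 0)" for j
    have c: "c \<in> fin_coeffs" using fin A0 by (auto simp: fin_coeffs_def c_def)
    have lin: "lin x (restr c E) = (\<Sum>j\<in>A \<inter> E. t j *\<^sub>R z j)" for E
    proof -
      have "lin x (restr c E) = (\<Sum>j\<in>A \<inter> E. restr c E j *\<^sub>R x (j - 1))"
        by (rule lin_eq_sum) (use fin in \<open>auto simp: restr_def c_def split: if_splits\<close>)
      also have "\<dots> = (\<Sum>j\<in>A \<inter> E. t j *\<^sub>R z j)" by (rule sum.cong) (auto simp: restr_def c_def z_def)
      finally show ?thesis .
    qed
    have "restr c UNIV = c" by (simp add: restr_def)
    then have linc: "lin x c = (\<Sum>j\<in>A. t j *\<^sub>R z j)" using lin[of UNIV] by simp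
    have single: "A \<inter> piece A UNIV b = {b}" if "b \<in> A" for b using that by (auto simp: piece_def intro: order_antisym)
    have "covers A {j. c j \<noteq> 0}" by (auto simp: covers_def c_def split: if_splits)
    then have "(1 / 2) * (\<Sum>b\<in>A. N (lin x (restr c (piece A UNIV b)))) \<le> N (lin x c)"
      by (rule lower_estD[OF lower_est A c])
    moreover have "(\<Sum>b\<in>A. N (lin x (restr c (piece A UNIV b)))) = (\<Sum>b\<in>A. \<bar>t b\<bar> * N (z b))"
      by (rule sum.cong) (simp_all add: lin single equivalent_normD(2)[OF N])
    moreover have "c0 * (\<Sum>b\<in>A. \<bar>t b\<bar>) \<le> (\<Sum>b\<in>A. \<bar>t b\<bar> * N (z b))"
      unfolding sum_distrib_left
    proof (rule sum_mono)
      fix b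
      have "c0 \<le> N (z b)" using c0(3)[of "z b"] z1[of b] by simp
      then show "c0 * \<bar>t b\<bar> \<le> \<bar>t b\<bar> * N (z b)" by (subst mult.commute) (rule mult_left_mono, simp_all)
    qed
    ultimately have "(1 / 2) * (c0 * (\<Sum>b\<in>A. \<bar>t b\<bar>)) \<le> N (lin x c)" by linarith
    also have "\<dots> \<le> C0 * norm (\<Sum>j\<in>A. t j *\<^sub>R z j)" unfolding linc by (rule c0(4))
    finally have "c0 / (2 * C0) * (\<Sum>b\<in>A. \<bar>t b\<bar>) \<le> norm (\<Sum>j\<in>A. t j *\<^sub>R z j)"
      using c0(2) by (simp add: field_simps)
    moreover have "inverse (real (Suc n)) * (\<Sum>b\<in>A. \<bar>t b\<bar>) \<le> c0 / (2 * C0) * (\<Sum>b\<in>A. \<bar>t b\<bar>)"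
      using n by (intro mult_right_mono sum_nonneg) simp_all
    ultimately show "inverse (real (Suc n)) * (\<Sum>j\<in>A. \<bar>t j\<bar>) \<le> norm (\<Sum>j\<in>A. t j *\<^sub>R z j)" by linarith
  qed
  then show ?thesis using z1 zs by blast
qed

text \<open>Bourgain's argument: if the index were \<open>\<omega>\<^sub>1\<close>, the tree of finite \<open>\<ell>\<^sub>1\<close>-sequences in a countable dense set
  would have uncountable rank, hence an infinite branch.\<close>

lemma delta_ddot_less_1:
  fixes e :: "nat \<Rightarrow> 'a::banach"
  assumes ladder: "ladder_system l" and e: "lin_indep e" and no_l1: "\<not> contains_l1 TYPE('a)"
  shows "\<exists>a. delta_ddot l a e < 1"
proof (rule ccontr)
  assume "\<not> ?thesis"
  then have not_less: "\<not> delta_ddot l a e < 1" for a by blast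
  have "(1 / 2 :: real) < delta_ddot l a e" for a using not_less[of a] by linarith
  then have admits_lower_est: "admits_lower_est e (schreier l a) (1 / 2)" for a
    by (intro delta_ddot_bounds(2)[OF ladder e]) simp_all
  let ?Q = "\<lambda>n a. \<exists>z. (\<forall>j. z j \<in> span (range e) \<and> norm (z j) = 1) \<and> l1_below (inverse (real (Suc n))) a l z"
  \<comment> \<open>Countably many constants face uncountably many indices: if every n failed from
    some b n on, no constant would be left at a common upper bound of the b n.\<close>
  have "\<exists>n. \<forall>b. \<exists>a\<ge>b. ?Q n a"
  proof (rule ccontr)
    assume "\<not> ?thesis"
    then have "\<forall>n. \<exists>b. \<forall>a\<ge>b. \<not> ?Q n a" by blast
    from choice[OF this] obtain b where b: "\<forall>n. \<forall>a\<ge>b n. \<not> ?Q n a" ..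
    obtain c where c: "\<forall>a\<in>range b. a < c" using countable_bounded[of "range b"] by auto
    obtain n where "?Q n c" using admits_lower_est_imp_l1_below[OF ladder e admits_lower_est] by blast
    moreover have "b n \<le> c" using c by (simp add: order_less_imp_le)
    ultimately show False using b by blast
  qed
  then obtain n where n: "\<And>b. \<exists>a\<ge>b. ?Q n a" by blast
  define \<rho> where "\<rho> = inverse (real (Suc n))"
  have \<rho>: "0 < \<rho>" "\<rho> \<le> 1" by (simp_all add: \<rho>_def field_simps)
  obtain D where D: "countable D" "\<And>v \<epsilon>. v \<in> span (range e) \<Longrightarrow> 0 < \<epsilon> \<Longrightarrow> \<exists>d\<in>D. norm (d - v) < \<epsilon>"
    using span_range_countable_dense[of e] by blast
  \<comment> \<open>Half of the constant is given up to allow rounding the unit vectors z to D. The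
    bound 2 survives this rounding and yields the upper l1-estimate on a branch.\<close>
  define T where "T s \<longleftrightarrow> (\<forall>i<length s. norm (s ! i) \<le> 2) \<and>
    (\<forall>t. \<rho> / 2 * (\<Sum>i<length s. \<bar>t i\<bar>) \<le> norm (\<Sum>i<length s. t i *\<^sub>R s ! i))" for s :: "'a list"
  have "rank_ge D T b []" for b
  proof -
    obtain a z where a: "b \<le> a" and z: "\<And>j. z j \<in> span (range e)" "\<And>j. norm (z j) = 1" and lower_est: "l1_below \<rho> a l z"
      using n[of b] unfolding \<rho>_def by blast
    have "\<forall>j. \<exists>d. d \<in> D \<and> norm (d - z j) < \<rho> / 2" using D(2)[OF z(1), of "\<rho> / 2"] \<rho>(1) by fastforce
    from choice[OF this] obtain d where d: "\<forall>j. d j \<in> D \<and> norm (d j - z j) < \<rho> / 2" ..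
    have d2: "norm (d j) \<le> 2" for j
    proof -
      have "norm (d j) \<le> norm (d j - z j) + norm (z j)" using norm_triangle_ineq[of "d j - z j" "z j"] by simp
      moreover have "norm (d j - z j) < \<rho> / 2" using d by blast
      ultimately show ?thesis using z(2)[of j] \<rho>(2) by linarith
    qed
    have "rank_ge D T a []"
    proof (rule rank_ge_schreier[OF ladder, of d D a 0])
      show "d j \<in> D" for j using d by blast
      fix F assume F: "F \<in> schreier l a"
      have fin: "finite F" by (rule regularD(1)[OF regular_schreier[OF ladder] F])
      let ?xs = "sorted_list_of_set F"
      let ?n = "length ?xs"
      have inj: "inj_on ((!) ?xs) {..<?n}" by (rule inj_onI) (simp add: nth_eq_iff_index_eq)
      have im: "(!) ?xs ` {..<?n} = F" using fin nth_image[of ?n ?xs] by (simp add: lessThan_atLeast0)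
      have "\<rho> / 2 * (\<Sum>i<?n. \<bar>t i\<bar>) \<le> norm (\<Sum>i<?n. t i *\<^sub>R d (?xs ! i))" for t :: "nat \<Rightarrow> real"
      proof -
        define b where "b j = t (the_inv_into {..<?n} ((!) ?xs) j)" for j
        have b: "b (?xs ! i) = t i" if "i < ?n" for i
          unfolding b_def using the_inv_into_f_f[OF inj, of i] that by simp
        have re: "(\<Sum>j\<in>F. g (b j) (z j)) = (\<Sum>i<?n. g (t i) (z (?xs ! i)))"
          for g :: "real \<Rightarrow> 'a \<Rightarrow> 'b::comm_monoid_add"
        proof -
          have "(\<Sum>j\<in>(!) ?xs ` {..<?n}. g (b j) (z j)) = (\<Sum>i<?n. g (t i) (z (?xs ! i)))"
            by (subst sum.reindex[OF inj]) (simp add: b)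
          then show ?thesis by (simp only: im)
        qed
        have "\<rho> * (\<Sum>j\<in>F. \<bar>b j\<bar>) \<le> norm (\<Sum>j\<in>F. b j *\<^sub>R z j)" using lower_est F unfolding l1_below_def by blast
        then have 1: "\<rho> * (\<Sum>i<?n. \<bar>t i\<bar>) \<le> norm (\<Sum>i<?n. t i *\<^sub>R z (?xs ! i))"
          using re[of "\<lambda>r _. \<bar>r\<bar>"] re[of "\<lambda>r v. r *\<^sub>R v"] by simp
        have "norm (\<Sum>i<?n. t i *\<^sub>R (d (?xs ! i) - z (?xs ! i))) \<le> (\<Sum>i<?n. \<bar>t i\<bar> * (\<rho> / 2))"
        proof (rule sum_norm_le)
          fix i
          have "norm (d (?xs ! i) - z (?xs ! i)) \<le> \<rho> / 2" using d less_imp_le by blast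
          then show "norm (t i *\<^sub>R (d (?xs ! i) - z (?xs ! i))) \<le> \<bar>t i\<bar> * (\<rho> / 2)"
            unfolding norm_scaleR by (rule mult_left_mono) simp
        qed
        also have "\<dots> = \<rho> / 2 * (\<Sum>i<?n. \<bar>t i\<bar>)" unfolding sum_distrib_left by (rule sum.cong) simp_all
        finally have 2: "norm (\<Sum>i<?n. t i *\<^sub>R (d (?xs ! i) - z (?xs ! i))) \<le> \<rho> / 2 * (\<Sum>i<?n. \<bar>t i\<bar>)" .
        have "(\<Sum>i<?n. t i *\<^sub>R z (?xs ! i)) = (\<Sum>i<?n. t i *\<^sub>R d (?xs ! i)) - (\<Sum>i<?n. t i *\<^sub>R (d (?xs ! i) - z (?xs ! i)))"
          by (simp add: scaleR_diff_right sum_subtractf)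
        then have "norm (\<Sum>i<?n. t i *\<^sub>R z (?xs ! i))
            \<le> norm (\<Sum>i<?n. t i *\<^sub>R d (?xs ! i)) + norm (\<Sum>i<?n. t i *\<^sub>R (d (?xs ! i) - z (?xs ! i)))"
          by (simp only: norm_triangle_ineq4)
        then show ?thesis using 1 2 by simp
      qed
      then show "T ([] @ map d ?xs)" unfolding T_def using d2 by simp
    qed
    then show ?thesis using a by (rule rank_ge_mono)
  qed
  then obtain u where u: "\<And>n. T (map u [0..<n])" using rank_unbounded_branch[OF D(1), of T] by blast
  have "norm (u i) \<le> 2" for i
  proof -
    have "norm (map u [0..<Suc i] ! i) \<le> 2" using u[of "Suc i"] unfolding T_def by simp
    then show ?thesis by (simp del: upt_Suc)
  qed
  moreover have "\<rho> / 2 * (\<Sum>i<n. \<bar>t i\<bar>) \<le> norm (\<Sum>i<n. t i *\<^sub>R u i)" for n t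
    using u[of n] unfolding T_def by simp
  ultimately have "contains_l1 TYPE('a)" using \<rho>(1) by (intro contains_l1I[of "\<rho> / 2" 2 u]) simp_all
  then show False using no_l1 by blast
qed

section \<open>The spectral index\<close>

theorem theorem4p23:
  fixes l :: "cord \<Rightarrow> nat \<Rightarrow> cord"
    and e :: "nat \<Rightarrow> 'a::banach"
  assumes "ladder_system l"
    and "schauder_basis e"
    and "asymptotic_l1 e"
    and "\<not> contains_l1 TYPE('a)"
  shows "(\<exists>\<alpha>. spectral_index l e = Some (omega_pow \<alpha>)) \<and>
    (\<forall>\<alpha>\<^sub>0 \<theta>. spectral_index l e = Some \<alpha>\<^sub>0 \<and> delta_ddot l \<alpha>\<^sub>0 e = \<theta> \<longrightarrow>
       (\<forall>n \<beta>. \<beta> < \<alpha>\<^sub>0 \<longrightarrow> delta_ddot l (\<alpha>\<^sub>0 * ord_of_nat n + \<beta>) e = \<theta> ^ n) \<and>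
       (\<forall>\<beta>. \<alpha>\<^sub>0 * omega \<le> \<beta> \<longrightarrow> delta_ddot l \<beta> e = 0))"
proof -
  let ?f = "\<lambda>a. delta_ddot l a e"
  note e = schauder_lin_indep[OF assms(2)]
  note mult = delta_ddot_mult_nat[OF assms(1) e assms(3)]
  note anti = delta_ddot_antimono[OF assms(1) e]
  have f0: "0 \<le> ?f a" and f1: "?f a \<le> 1" for a by (rule delta_ddot_bounds(3,4)[OF assms(1) e])+
  define \<alpha> where "\<alpha> = (LEAST a. ?f a < 1)"
  have ex: "\<exists>a. ?f a < 1" by (rule delta_ddot_less_1[OF assms(1) e assms(4)])
  have index: "spectral_index l e = Some \<alpha>" unfolding spectral_index_def \<alpha>_def using ex by simp
  have f\<alpha>: "?f \<alpha> < 1" unfolding \<alpha>_def using ex by (rule LeastI_ex)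
  have below: "?f b = 1" if "b < \<alpha>" for b
    using not_less_Least[OF that[unfolded \<alpha>_def]] f1[of b] by simp
  \<comment> \<open>The modulus is 1 below \<alpha>, powers of 1 are 1, and at \<alpha> and beyond
    it is less than 1.\<close>
  have closed: "b * ord_of_nat n < \<alpha>" if "b < \<alpha>" for b n
  proof (rule ccontr)
    assume "\<not> ?thesis"
    then have "?f (b * ord_of_nat n) \<le> ?f \<alpha>" by (intro anti) simp
    then show False using mult[of b n] below[OF that] f\<alpha> by simp
  qed
  \<comment> \<open>At index 0 the modulus is a zeroth power, hence 1.\<close>
  have "\<alpha> \<noteq> 0" using mult[of \<alpha> 0] f\<alpha> by auto
  then have pow: "\<exists>\<gamma>. \<alpha> = omega_pow \<gamma>" by (rule omega_pow_if_mult_closed) (rule closed)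
  have val: "?f (\<alpha> * ord_of_nat n + \<beta>) = ?f \<alpha> ^ n" if \<beta>: "\<beta> < \<alpha>" for n \<beta>
  proof (rule antisym)
    show "?f (\<alpha> * ord_of_nat n + \<beta>) \<le> ?f \<alpha> ^ n"
      using anti[OF cord_le_add[of "\<alpha> * ord_of_nat n" \<beta>]] unfolding mult .
    show "?f \<alpha> ^ n \<le> ?f (\<alpha> * ord_of_nat n + \<beta>)" (is "?t ^ n \<le> ?v")
    \<comment> \<open>The main case divides by \<open>?t ^ n\<close>. For n = 0 the value is 1
      because \<beta> < \<alpha>, and for \<open>?t = 0\<close> with n > 0 the bound is
      trivial.\<close>
    proof (cases "n = 0 \<or> ?t = 0")
      case True
      then show ?thesis using below[OF \<beta>] f0[of "\<alpha> * ord_of_nat n + \<beta>"] by (cases "n = 0") (simp_all add: power_0_left)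
    next
      case False
      then have t: "0 < ?t" using f0[of \<alpha>] by simp
      then have tn: "0 < ?t ^ n" by simp
      have pow_k: "?t \<le> (?v / ?t ^ n) ^ k" for k
      proof -
        have "?t ^ (n * k + 1) = ?f (\<alpha> * ord_of_nat (n * k + 1))" by (rule mult[symmetric])
        also have "\<dots> \<le> ?f ((\<alpha> * ord_of_nat n + \<beta>) * ord_of_nat k)"
          by (rule anti[OF mult_closed_remainder_bound[OF \<beta> closed]])
        also have "\<dots> = ?v ^ k" by (rule mult)
        finally have "?t * (?t ^ n) ^ k \<le> ?v ^ k" by (simp add: power_mult)
        then show ?thesis using tn by (simp add: power_divide pos_le_divide_eq)
      qed
      show ?thesis
      proof (rule ccontr)
        assume "\<not> ?thesis"
        then have "?v / ?t ^ n < 1" using tn by simp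
        then obtain k where "(?v / ?t ^ n) ^ k < ?t" using real_arch_pow_inv[OF t] by blast
        then show False using pow_k[of k] by simp
      qed
    qed
  qed
  have zero: "?f \<beta> = 0" if "\<alpha> * omega \<le> \<beta>" for \<beta>
  proof (rule ccontr)
    assume "?f \<beta> \<noteq> 0"
    then have "0 < ?f \<beta>" using f0[of \<beta>] by simp
    then obtain n where n: "?f \<alpha> ^ n < ?f \<beta>" using real_arch_pow_inv[OF _ f\<alpha>] by blast
    have "\<alpha> * ord_of_nat n \<le> \<beta>" using that mult_omega_le_iff by blast
    then have "?f \<beta> \<le> ?f \<alpha> ^ n" using anti mult by metis
    then show False using n by simp
  qed
  show ?thesis using index pow val zero by auto
qed

end
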